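(* Let $U\subset\mathrm{Diff}^2_\mu(\mathbf{T}^3)$ be a $C^1$-open set, contained in a sufficiently small $C^1$-neighborhood of $A_3$, such that every $g\in U$ satisfies the following conditions. (1) $g$ is ergodic with respect to $\mu$. (2) There is an equivariant fibration $\pi:\mathbf{T}^3\to\mathbf{T}^2$ such that $\pi g=A_2\pi$. The fibers of $\pi$ are the leaves of a foliation $\mathcal{W}^c_g$ of $\mathbf{T}^3$ by $C^2$ circles. In particular, the set of periodic leaves is dense in $\mathbf{T}^3$. (3) There exists $\lambda^c>0$ such that, for $\mu$-almost every $w\in\mathbf{T}^3$, if $0\ne v\in T_w\mathbf{T}^3$ is tangent to the leaf of $\mathcal{W}^c_g$ containing $w$, then $\lim_{n\to\infty}\frac1n\log\|T_wg^nv\|=\lambda^c$. (4) Consequently, there exists a set of full $\mu$-measure in $\mathbf{T}^3$ that meets every leaf of $\mathcal{W}^c_g$ in a set of leaf-measure $0$, and the foliation $\mathcal{W}^c_g$ is not absolutely continuous. Then for every $g\in U$ there exists $k\in\mathbf{N}$, $k\geq 1$, such that $(\mathbf{T}^3,\mu,g)$ is isomorphic, as a measure-preserving system, to an (ergodic) $k$-point extension of $(\mathbf{T}^2,\pi_*\mu,A_2)$.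
   Context: $\mathbf{T}^d=\mathbf{R}^d/\mathbf{Z}^d$ is the $d$-torus. $\mu$ is Lebesgue–Haar measure on $\mathbf{T}^3$, and $\mathrm{Diff}^2_\mu(\mathbf{T}^3)$ is the set of $C^2$ diffeomorphisms of $\mathbf{T}^3$ that preserve $\mu$. $A_2$ is the automorphism of $\mathbf{T}^2$ given by $\begin{pmatrix}2&1\\1&1\end{pmatrix}$, and $A_3$ is the automorphism of $\mathbf{T}^3$ given by the block matrix $\begin{pmatrix}A_2&0\\0&1\end{pmatrix}$. Such open sets $U$ exist arbitrarily close to $A_3$, by a theorem of Shub and Wilkinson. A leaf is periodic if it is mapped to itself by some positive iterate of $g$. $\pi_*\mu$ denotes the push-forward of $\mu$ under $\pi$. For a compact group $G$, a $G$-extension of a dynamical system $f:X\to X$ is a map $f_\varphi:X\times G\to X\times G$ of the form $(x,y)\mapsto(f(x),\varphi(x)y)$, where $\varphi:X\to G$. If $f$ preserves a measure $\nu$ and $\varphi$ is measurable, then $f_\varphi$ preserves the product of $\nu$ with Lebesgue–Haar measure on $G$, and the extension is considered with this product measure. A $k$-point extension is a $\mathbf{Z}/k\mathbf{Z}$-extension. *)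

theory Defs
  imports
    "HOL-Analysis.Analysis"
    "HOL-Algebra.Elementary_Groups"
begin

section \<open>The torus\<close>

definition torus_rel :: "real ^ 'n \<Rightarrow> real ^ 'n \<Rightarrow> bool"
  where "torus_rel x y \<longleftrightarrow> (\<forall>i. x $ i - y $ i \<in> \<int>)"

lemma equivp_torus_rel: "equivp (torus_rel :: real ^ 'n \<Rightarrow> real ^ 'n \<Rightarrow> bool)"
proof (rule equivpI)
  show "reflp (torus_rel :: real ^ 'n \<Rightarrow> _)"
    by (auto simp: reflp_def torus_rel_def)
  show "symp (torus_rel :: real ^ 'n \<Rightarrow> _)"
    unfolding symp_def torus_rel_def by (metis Ints_minus minus_diff_eq)
  show "transp (torus_rel :: real ^ 'n \<Rightarrow> _)"
  proof (rule transpI)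
    fix x y z :: "real ^ 'n"
    assume xy: "torus_rel x y" and yz: "torus_rel y z"
    have "x $ i - z $ i \<in> \<int>" for i
    proof -
      have "(x $ i - y $ i) + (y $ i - z $ i) \<in> \<int>"
        using xy yz unfolding torus_rel_def by (intro Ints_add) auto
      then show ?thesis by simp
    qed
    then show "torus_rel x z" by (simp add: torus_rel_def)
  qed
qed

quotient_type 'n torus = "(real, 'n::finite) vec" / torus_rel
  by (rule equivp_torus_rel)

lemma abs_torus_eq_iff: "abs_torus x = abs_torus y \<longleftrightarrow> (\<forall>i. x $ i - y $ i \<in> \<int>)"
  using torus.abs_eq_iff[of x y] by (simp add: torus_rel_def)

lemma abs_rep_torus [simp]: "abs_torus (rep_torus w) = w"
  by (rule Quotient_abs_rep[OF Quotient_torus])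

instantiation torus :: (finite) topological_space
begin

definition open_torus :: "'a torus set \<Rightarrow> bool"
  where "open_torus U \<longleftrightarrow> open (abs_torus -` U)"

instance
proof
  show "open (UNIV :: 'a torus set)"
    by (simp add: open_torus_def)
next
  fix S T :: "'a torus set"
  assume "open S" "open T"
  then show "open (S \<inter> T)"
    by (simp add: open_torus_def vimage_Int open_Int)
next
  fix K :: "'a torus set set"
  assume "\<forall>S\<in>K. open S"
  then show "open (\<Union>K)"
    unfolding open_torus_def vimage_Union by (intro open_UN) auto
qed

end

lemma continuous_abs_torus: "continuous_on UNIV abs_torus"
  by (simp add: continuous_on_open_vimage open_torus_def)

definition torus_haar :: "'n::finite torus measure"
  where "torus_haar = distr (restrict_space lborel {x. \<forall>i. x $ i \<in> {0..<1}}) borel abs_torus"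

text \<open>The choice of representative is immaterial only when \<open>A\<close> has integer entries; see below.\<close>

definition toral_map :: "real ^ 'n ^ 'm \<Rightarrow> 'n::finite torus \<Rightarrow> 'm::finite torus"
  where "toral_map A w = abs_torus (A *v rep_torus w)"

lemma toral_map_abs_torus:
  assumes "\<And>i j. A $ i $ j \<in> \<int>"
  shows "toral_map A (abs_torus x) = abs_torus (A *v x)"
proof -
  have "abs_torus (rep_torus (abs_torus x)) = abs_torus x" by simp
  then have r: "rep_torus (abs_torus x) $ i - x $ i \<in> \<int>" for i
    unfolding abs_torus_eq_iff by blast
  have "(A *v rep_torus (abs_torus x)) $ i - (A *v x) $ i \<in> \<int>" for i
  proof -
    have "(A *v rep_torus (abs_torus x)) $ i - (A *v x) $ i
        = (\<Sum>j\<in>UNIV. A $ i $ j * (rep_torus (abs_torus x) $ j - x $ j))"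
      by (simp add: matrix_vector_mult_def right_diff_distrib sum_subtractf)
    also have "\<dots> \<in> \<int>"
      by (intro Ints_sum Ints_mult assms r)
    finally show ?thesis .
  qed
  then show ?thesis by (simp add: toral_map_def abs_torus_eq_iff)
qed

definition A2 :: "2 torus \<Rightarrow> 2 torus"
  where "A2 = toral_map (vector [vector [2, 1], vector [1, 1]])"

definition A3 :: "3 torus \<Rightarrow> 3 torus"
  where "A3 = toral_map (vector [vector [2, 1, 0], vector [1, 1, 0], vector [0, 0, 1]])"


section \<open>Differentiability\<close>

definition C1_on :: "'a::real_normed_vector set \<Rightarrow> ('a \<Rightarrow> 'b::real_normed_vector) \<Rightarrow> bool"
  where "C1_on S f \<longleftrightarrow> (\<exists>f' :: 'a \<Rightarrow> 'a \<Rightarrow>\<^sub>L 'b.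
    (\<forall>x\<in>S. (f has_derivative blinfun_apply (f' x)) (at x)) \<and> continuous_on S f')"

definition C2_on :: "'a::real_normed_vector set \<Rightarrow> ('a \<Rightarrow> 'b::real_normed_vector) \<Rightarrow> bool"
  where "C2_on S f \<longleftrightarrow> (\<exists>f' :: 'a \<Rightarrow> 'a \<Rightarrow>\<^sub>L 'b.
    (\<forall>x\<in>S. (f has_derivative blinfun_apply (f' x)) (at x)) \<and> C1_on S f')"

text \<open>The tangent spaces of the torus are identified with \<open>\<real>\<^sup>n\<close> by the covering
  \<open>abs_torus\<close>, and maps of tori are read in the local inverses of the coverings.\<close>

definition torus_has_derivative ::
    "('n::finite torus \<Rightarrow> 'm::finite torus) \<Rightarrow> (real ^ 'n \<Rightarrow> real ^ 'm) \<Rightarrow> 'n torus \<Rightarrow> bool"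
  where "torus_has_derivative f L w \<longleftrightarrow>
    (\<exists>x F. abs_torus x = w \<and> (\<forall>\<^sub>F y in nhds x. abs_torus (F y) = f (abs_torus y)) \<and>
           (F has_derivative L) (at x))"

definition torus_deriv ::
    "('n::finite torus \<Rightarrow> 'm::finite torus) \<Rightarrow> 'n torus \<Rightarrow> real ^ 'n \<Rightarrow> real ^ 'm"
  where "torus_deriv f w = (THE L. torus_has_derivative f L w)"

definition torus_C2 :: "('n::finite torus \<Rightarrow> 'm::finite torus) \<Rightarrow> bool"
  where "torus_C2 f \<longleftrightarrow>
    (\<forall>x. \<exists>S F. open S \<and> x \<in> S \<and> C2_on S F \<and> (\<forall>y\<in>S. abs_torus (F y) = f (abs_torus y)))"

lemma torus_has_derivative_unique:
  fixes f :: "'n::finite torus \<Rightarrow> 'm::finite torus"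
  assumes "torus_has_derivative f L w" and "torus_has_derivative f M w"
  shows "L = M"
proof -
  obtain x F where x: "abs_torus x = w"
    and F: "\<forall>\<^sub>F y in nhds x. abs_torus (F y) = f (abs_torus y)"
    and dF: "(F has_derivative L) (at x)"
    using assms(1) unfolding torus_has_derivative_def by blast
  obtain x' G where x': "abs_torus x' = w"
    and G: "\<forall>\<^sub>F y in nhds x'. abs_torus (G y) = f (abs_torus y)"
    and dG: "(G has_derivative M) (at x')"
    using assms(2) unfolding torus_has_derivative_def by blast
  define m where "m = x' - x"
  have m: "m $ i \<in> \<int>" for i
    using x x' abs_torus_eq_iff[of x' x] by (simp add: m_def)
  have tr: "abs_torus (y + m) = abs_torus y" for y :: "real ^ 'n"
    using m by (simp add: abs_torus_eq_iff)
  define H where "H y = G (y + m)" for y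
  have dH: "(H has_derivative M) (at x)"
  proof -
    have "((\<lambda>y. y + m) has_derivative (\<lambda>v. v)) (at x)"
      by (auto intro!: derivative_eq_intros)
    moreover have "(G has_derivative M) (at (x + m))"
      using dG by (simp add: m_def)
    ultimately have "(G \<circ> (\<lambda>y. y + m) has_derivative (M \<circ> (\<lambda>v. v))) (at x)"
      by (rule diff_chain_at)
    then show ?thesis by (simp add: H_def[abs_def] o_def)
  qed
  have "filterlim (\<lambda>y. y + m) (nhds x') (nhds x)"
  proof -
    have "((\<lambda>y. y + m) \<longlongrightarrow> x + m) (nhds x)"
      by (intro tendsto_add filterlim_ident tendsto_const)
    then show ?thesis by (simp add: m_def)
  qed
  from eventually_compose_filterlim[OF G this]
  have H: "\<forall>\<^sub>F y in nhds x. abs_torus (H y) = f (abs_torus y)"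
    by (simp add: H_def tr)
  define D where "D y = H y - F y" for y
  have "isCont D x"
    unfolding D_def[abs_def]
    using has_derivative_continuous[OF dH] has_derivative_continuous[OF dF]
    by (intro continuous_diff)
  then have "(D \<longlongrightarrow> D x) (nhds x)"
    by (simp add: continuous_at tendsto_nhds_iff)
  then have close: "\<forall>\<^sub>F y in nhds x. dist (D y) (D x) < 1"
    by (rule tendstoD) simp
  have int: "\<forall>\<^sub>F y in nhds x. \<forall>i. D y $ i \<in> \<int>"
    using H F by eventually_elim (metis D_def abs_torus_eq_iff vector_minus_component)
  have int0: "\<forall>i. D x $ i \<in> \<int>"
    using eventually_nhds_x_imp_x[OF int] .
  have "\<forall>\<^sub>F y in nhds x. H y = F y + D x"
    using close int
  proof eventually_elim
    case (elim y)
    have "D y = D x"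
    proof (rule ccontr)
      assume "D y \<noteq> D x"
      then obtain i where i: "D y $ i - D x $ i \<noteq> 0"
        by (auto simp: vec_eq_iff)
      have "D y $ i - D x $ i \<in> \<int>" using elim int0 by (intro Ints_diff) auto
      with i have "1 \<le> \<bar>D y $ i - D x $ i\<bar>"
        by (rule Ints_nonzero_abs_ge1[rotated])
      also have "\<dots> \<le> dist (D y) (D x)"
        using component_le_norm_cart[of "D y - D x" i] by (simp add: dist_norm)
      finally show False using elim by simp
    qed
    then show ?case by (simp add: D_def algebra_simps)
  qed
  then have ev: "\<forall>\<^sub>F y in at x. H y = F y + D x" and eq: "H x = F x + D x"
    by (auto simp: eventually_nhds_conv_at)
  have "((\<lambda>y. F y + D x) has_derivative L) (at x)"
    using dF by (auto intro!: derivative_eq_intros)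
  moreover have "((\<lambda>y. F y + D x) has_derivative M) (at x)"
    by (rule has_derivative_transform_eventually[OF dH ev]) (use eq in auto)
  ultimately show ?thesis by (rule has_derivative_unique)
qed

definition Diff2_mu :: "('n::finite torus \<Rightarrow> 'n torus) set"
  where "Diff2_mu = {g. bij g \<and> torus_C2 g \<and> torus_C2 (inv_into UNIV g) \<and>
                        distr torus_haar borel g = torus_haar}"

definition C1_close :: "real \<Rightarrow> ('n::finite torus \<Rightarrow> 'n torus) \<Rightarrow> ('n torus \<Rightarrow> 'n torus) \<Rightarrow> bool"
  where "C1_close e g h \<longleftrightarrow>
    (\<forall>w. (\<exists>x y. abs_torus x = g w \<and> abs_torus y = h w \<and> dist x y < e) \<and>
         onorm (\<lambda>v. torus_deriv g w v - torus_deriv h w v) < e)"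

definition C1_open :: "('n::finite torus \<Rightarrow> 'n torus) set \<Rightarrow> bool"
  where "C1_open U \<longleftrightarrow> U \<subseteq> Diff2_mu \<and>
    (\<forall>g\<in>U. \<exists>e>0. \<forall>h\<in>Diff2_mu. C1_close e g h \<longrightarrow> h \<in> U)"


section \<open>Fibrations and foliations by circles\<close>

text \<open>Locally trivial fibre bundles; the model fibre over \<open>V\<close> is taken to be the fibre over \<open>p\<close>.\<close>

definition fibration :: "('a::topological_space \<Rightarrow> 'b::topological_space) \<Rightarrow> bool"
  where "fibration \<pi> \<longleftrightarrow> continuous_on UNIV \<pi> \<and> surj \<pi> \<and>
    (\<forall>p. \<exists>V h k. open V \<and> p \<in> V \<and>
       homeomorphism (\<pi> -` V) (V \<times> (\<pi> -` {p})) h k \<and> (\<forall>w\<in>\<pi> -` V. fst (h w) = \<pi> w))"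

definition fibers :: "('a \<Rightarrow> 'b) \<Rightarrow> 'a set set"
  where "fibers \<pi> = range (\<lambda>p. \<pi> -` {p})"

definition C2_circle_param :: "'n::finite torus set \<Rightarrow> (real \<Rightarrow> real ^ 'n) \<Rightarrow> bool"
  where "C2_circle_param L \<gamma> \<longleftrightarrow> C2_on UNIV \<gamma> \<and> (\<forall>t. vector_derivative \<gamma> (at t) \<noteq> 0) \<and>
    (\<forall>s t. abs_torus (\<gamma> s) = abs_torus (\<gamma> t) \<longleftrightarrow> s - t \<in> \<int>) \<and>
    L = range (abs_torus \<circ> \<gamma>)"

definition C2_circle :: "'n::finite torus set \<Rightarrow> bool"
  where "C2_circle L \<longleftrightarrow> (\<exists>\<gamma>. C2_circle_param L \<gamma>)"

definition tangent_to :: "'n::finite torus set \<Rightarrow> 'n torus \<Rightarrow> real ^ 'n \<Rightarrow> bool"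
  where "tangent_to L w v \<longleftrightarrow> (\<exists>\<gamma> t a. C2_circle_param L \<gamma> \<and> abs_torus (\<gamma> t) = w \<and>
    v = a *\<^sub>R vector_derivative \<gamma> (at t))"

text \<open>Riemannian length of a \<open>C\<^sup>2\<close> circle; it does not depend on the parametrization.\<close>

definition leaf_measure :: "'n::finite torus set \<Rightarrow> 'n torus measure"
  where "leaf_measure L = (let \<gamma> = (SOME \<gamma>. C2_circle_param L \<gamma>) in
    distr (density (restrict_space lborel {0..<1}) (\<lambda>t. ennreal (norm (vector_derivative \<gamma> (at t)))))
      borel (abs_torus \<circ> \<gamma>))"

definition chart_box :: "(real \<times> (real ^ 2)) set"
  where "chart_box = {-1<..<1} \<times> ball 0 1"

definition plaque :: "(real \<times> (real ^ 2) \<Rightarrow> 3 torus) \<Rightarrow> real ^ 2 \<Rightarrow> 3 torus set"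
  where "plaque \<phi> y = \<phi> ` ({-1<..<1} \<times> {y})"

definition foliation_chart :: "3 torus set set \<Rightarrow> (real \<times> (real ^ 2) \<Rightarrow> 3 torus) \<Rightarrow> bool"
  where "foliation_chart \<W> \<phi> \<longleftrightarrow> open (\<phi> ` chart_box) \<and>
    (\<exists>\<psi>. homeomorphism chart_box (\<phi> ` chart_box) \<phi> \<psi>) \<and>
    (\<forall>y\<in>ball 0 1. \<exists>L\<in>\<W>. plaque \<phi> y \<in> components (L \<inter> \<phi> ` chart_box))"

text \<open>A continuous foliation: the charts are homeomorphisms, only the leaves are \<open>C\<^sup>2\<close>.\<close>

definition foliation_by_C2_circles :: "3 torus set set \<Rightarrow> bool"
  where "foliation_by_C2_circles \<W> \<longleftrightarrow>
    \<Union>\<W> = UNIV \<and> disjoint \<W> \<and> (\<forall>L\<in>\<W>. C2_circle L) \<and>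
    (\<forall>w. \<exists>\<phi>. foliation_chart \<W> \<phi> \<and> w \<in> \<phi> ` chart_box)"

definition periodic_leaf :: "('a \<Rightarrow> 'a) \<Rightarrow> 'a set \<Rightarrow> bool"
  where "periodic_leaf g L \<longleftrightarrow> (\<exists>n>0. (g ^^ n) ` L = L)"

text \<open>A transversal is an embedded \<open>C\<^sup>1\<close> disc, given by a lift of its parametrization to \<open>\<real>\<^sup>3\<close>.\<close>

definition transversal :: "3 torus set set \<Rightarrow> (real ^ 2 \<Rightarrow> real ^ 3) \<Rightarrow> bool"
  where "transversal \<W> \<tau> \<longleftrightarrow> C1_on (ball 0 1) \<tau> \<and> inj_on (abs_torus \<circ> \<tau>) (ball 0 1) \<and>
    (\<forall>s\<in>ball 0 1. inj (frechet_derivative \<tau> (at s)) \<and>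
      (\<forall>L\<in>\<W>. \<forall>v. tangent_to L (abs_torus (\<tau> s)) v \<and>
         v \<in> range (frechet_derivative \<tau> (at s)) \<longrightarrow> v = 0))"

text \<open>The holonomy along the plaques of a chart, from one transversal in the chart to another,
  carries null sets to null sets. The area on an embedded \<open>C\<^sup>1\<close> disc has the same null sets
  as Lebesgue measure in the parameters.\<close>

definition absolutely_continuous_foliation :: "3 torus set set \<Rightarrow> bool"
  where "absolutely_continuous_foliation \<W> \<longleftrightarrow>
    (\<forall>\<phi> \<sigma> \<tau>. foliation_chart \<W> \<phi> \<and> transversal \<W> \<sigma> \<and> transversal \<W> \<tau> \<and>
       (abs_torus \<circ> \<sigma>) ` ball 0 1 \<subseteq> \<phi> ` chart_box \<and> (abs_torus \<circ> \<tau>) ` ball 0 1 \<subseteq> \<phi> ` chart_box \<longrightarrow>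
       (\<forall>N \<subseteq> ball 0 1. negligible N \<longrightarrow>
          negligible {t \<in> ball 0 1. \<exists>s\<in>N. \<exists>y\<in>ball 0 1.
            abs_torus (\<sigma> s) \<in> plaque \<phi> y \<and> abs_torus (\<tau> t) \<in> plaque \<phi> y}))"


section \<open>Measure-preserving systems\<close>

definition mp_map :: "'a measure \<Rightarrow> ('a \<Rightarrow> 'a) \<Rightarrow> bool"
  where "mp_map M f \<longleftrightarrow> f \<in> measurable M M \<and> distr M M f = M"

definition ergodic :: "'a measure \<Rightarrow> ('a \<Rightarrow> 'a) \<Rightarrow> bool"
  where "ergodic M f \<longleftrightarrow> mp_map M f \<and>
    (\<forall>E\<in>sets M. f -` E \<inter> space M = E \<longrightarrow> emeasure M E = 0 \<or> emeasure M (space M - E) = 0)"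

definition mp_isomorphic :: "'a measure \<Rightarrow> ('a \<Rightarrow> 'a) \<Rightarrow> 'b measure \<Rightarrow> ('b \<Rightarrow> 'b) \<Rightarrow> bool"
  where "mp_isomorphic M f N h \<longleftrightarrow> mp_map M f \<and> mp_map N h \<and>
    (\<exists>X\<in>sets M. \<exists>Y\<in>sets N. \<exists>\<Phi> \<Psi>.
       emeasure M (space M - X) = 0 \<and> emeasure N (space N - Y) = 0 \<and>
       f ` X \<subseteq> X \<and> h ` Y \<subseteq> Y \<and>
       \<Phi> \<in> measurable (restrict_space M X) (restrict_space N Y) \<and>
       \<Psi> \<in> measurable (restrict_space N Y) (restrict_space M X) \<and>
       (\<forall>x\<in>X. \<Psi> (\<Phi> x) = x) \<and> (\<forall>y\<in>Y. \<Phi> (\<Psi> y) = y) \<and>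
       distr (restrict_space M X) (restrict_space N Y) \<Phi> = restrict_space N Y \<and>
       (\<forall>x\<in>X. \<Phi> (f x) = h (\<Phi> x)))"

definition group_extension ::
    "('g, 'r) monoid_scheme \<Rightarrow> ('a \<Rightarrow> 'a) \<Rightarrow> ('a \<Rightarrow> 'g) \<Rightarrow> 'a \<times> 'g \<Rightarrow> 'a \<times> 'g"
  where "group_extension G f \<phi> = (\<lambda>(x, y). (f x, \<phi> x \<otimes>\<^bsub>G\<^esub> y))"

text \<open>For a finite group the normalized Haar measure is the uniform counting measure.\<close>

definition point_extension_measure :: "nat \<Rightarrow> 'a measure \<Rightarrow> ('a \<times> int) measure"
  where "point_extension_measure k \<nu> =
    \<nu> \<Otimes>\<^sub>M uniform_count_measure (carrier (integer_mod_group k))"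

definition point_extension :: "nat \<Rightarrow> ('a \<Rightarrow> 'a) \<Rightarrow> ('a \<Rightarrow> int) \<Rightarrow> 'a \<times> int \<Rightarrow> 'a \<times> int"
  where "point_extension k f \<phi> = group_extension (integer_mod_group k) f \<phi>"

end

theory Submission imports Defs
begin

text \<open>
Let \<open>\<mu>\<close> be Haar measure and \<open>\<nu>\<close> its image under \<open>\<pi>\<close>. Since \<open>g\<close> expands the leaves on average,
its inverse contracts them, and a measure that is preserved under such a contraction must be atomic along
the leaves. Ergodicity makes all atoms equal, so that almost every leaf carries exactly \<open>k\<close> of them, and
\<open>g\<close> permutes them from leaf to leaf by rotations because it preserves an orientation of the leaves.

Contraction. The foliation is merely continuous, so tangent lines and lengths of leaves are avoided. They are replaced
by \<open>min_dilation r w\<close>, the least factor by which \<open>g\<close> separates \<open>w\<close> from points of its leaf at distance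
less than \<open>r\<close>, which increases to the derivative along the leaf as \<open>r\<close> tends to \<open>0\<close>. For
small \<open>r\<close> its logarithm has positive mean, and \<open>maximal_inequality\<close>, applied to the inverse of \<open>g\<close>, yields a set of
positive measure around each of whose points the leaf is contracted exponentially by all iterates of the inverse, within a radius that does
not depend on the point.

Atoms. The inverse images of a small compact piece of this set keep its measure while their traces on
the leaves shrink to points. By \<open>exists_compact_section\<close> this is possible only if a compact set of positive
measure meets each leaf at most once; \<open>compact_section\<close> combines both steps. The argument uses conditional densities of countably many
cells in place of conditional measures.

Uniformity. The images of this section under the iterates of \<open>g\<close> cover almost everything. Their conditional
densities form an invariant function, hence are all equal to one constant \<open>1/k\<close>. This is \<open>finite_sections\<close>.

Rotation. The leaves are oriented by the winding number of the third coordinate of the torus. Since \<open>g\<close> is close to the automorphism,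
it displaces that coordinate by a real function defined on the whole torus, so it preserves winding numbers and with them the
orientation, provided that they are nonzero. If they were zero, the third coordinate would be homotopic to a circle-valued
function pulled back from the 2-torus; it is invariant under \<open>g\<close> up to homotopy, and the relation \<open>A\<^sup>2 - 3 A + 1 = 0\<close>
for the matrix on the base would make it null-homotopic, which it is not (\<open>fibres_positive\<close>).
Numbering the \<open>k\<close> points of each leaf in cyclic order from a measurable base point therefore gives labels
which \<open>g\<close> shifts by a constant modulo \<open>k\<close> on each leaf (\<open>idx_g\<close>), and the leaf together with the label is the
isomorphism (\<open>isomorphic\<close>).
\<close>

section \<open>The torus as a compact metric space\<close>

text \<open>The quotient metric is computed coordinatewise from the signed distance to a nearest integer. Any two
points have lifts at their distance, and distances below \<open>1/2\<close> agree with those in \<open>\<real>\<^sup>n\<close>, so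
derivatives can be read from ratios of distances.\<close>

definition red :: "real \<Rightarrow> real"
  where "red t = t - of_int (round t)"

lemma red_add_of_int: "red (t + of_int n) = red t"
proof -
  have "round (t + of_int n) = round t + n"
    unfolding round_def by (metis add.assoc add.commute floor_add_int)
  then show ?thesis by (simp add: red_def)
qed

lemma red_cong: "s - t \<in> \<int> \<Longrightarrow> red s = red t"
  by (metis Ints_cases add.commute diff_add_cancel red_add_of_int)

lemma abs_red_le: "\<bar>red t\<bar> \<le> \<bar>t\<bar>"
  unfolding red_def using round_diff_minimal[of t 0] by (simp add: abs_minus_commute)

lemma abs_red_le_half: "\<bar>red t\<bar> \<le> 1/2"
  using of_int_round_abs_le[of t] by (simp only: red_def abs_minus_commute)

lemma red_eq_0_iff: "red t = 0 \<longleftrightarrow> t \<in> \<int>"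
  unfolding red_def by (metis Ints_cases Ints_of_int eq_iff_diff_eq_0 round_of_int)

lemma diff_red_Ints: "t - red t \<in> \<int>"
  by (simp add: red_def)

lemma red_small: "\<bar>t\<bar> < 1/2 \<Longrightarrow> red t = t"
proof -
  assume "\<bar>t\<bar> < 1/2"
  then have "round t = 0" by (intro round_unique') auto
  then show ?thesis by (simp add: red_def)
qed

definition red_vec :: "real ^ 'n \<Rightarrow> real ^ 'n"
  where "red_vec v = (\<chi> i. red (v $ i))"

lemma norm_red_vec_le: "norm (red_vec v) \<le> norm v"
  by (rule norm_le_componentwise_cart) (simp add: red_vec_def abs_red_le)

lemma red_vec_small: "norm v < 1/2 \<Longrightarrow> red_vec v = v"
  unfolding red_vec_def vec_eq_iff
  by (auto intro!: red_small simp del: less_divide_eq_numeral1)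
    (meson component_le_norm_cart order_le_less_trans)

instantiation torus :: (finite) metric_space
begin

definition dist_torus :: "'a torus \<Rightarrow> 'a torus \<Rightarrow> real"
  where "dist_torus w z = norm (red_vec (rep_torus w - rep_torus z))"

definition uniformity_torus :: "('a torus \<times> 'a torus) filter"
  where "uniformity_torus = (INF e\<in>{0 <..}. principal {(x, y). dist x y < e})"

lemma rep_abs_diff: "rep_torus (abs_torus x) $ i - x $ i \<in> \<int>"
  using abs_torus_eq_iff[of "rep_torus (abs_torus x)" x] by simp

lemma dist_abs_torus: "dist (abs_torus x) (abs_torus y) = norm (red_vec (x - y))"
proof -
  have "red_vec (rep_torus (abs_torus x) - rep_torus (abs_torus y)) = red_vec (x - y)"
    unfolding red_vec_def vec_eq_iff
  proof (intro allI, simp, rule red_cong)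
    fix i
    have "(rep_torus (abs_torus x) $ i - x $ i) - (rep_torus (abs_torus y) $ i - y $ i) \<in> \<int>"
      by (intro Ints_diff rep_abs_diff)
    then show "rep_torus (abs_torus x) $ i - rep_torus (abs_torus y) $ i - (x $ i - y $ i) \<in> \<int>"
      by (simp add: algebra_simps)
  qed
  then show ?thesis by (simp add: dist_torus_def)
qed

lemma dist_abs_torus_le: "dist (abs_torus x) (abs_torus y) \<le> norm (x - y)"
  by (simp add: dist_abs_torus norm_red_vec_le)

lemma lift_at_distance:
  obtains y where "abs_torus y = z" "dist (abs_torus x) z = norm (x - y)"
proof
  let ?y = "x - red_vec (x - rep_torus z)"
  show "abs_torus ?y = z"
  proof -
    have "abs_torus ?y = abs_torus (rep_torus z)"
      unfolding abs_torus_eq_iff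
    proof
      fix i
      show "?y $ i - rep_torus z $ i \<in> \<int>"
        using diff_red_Ints[of "x $ i - rep_torus z $ i"] by (simp add: red_vec_def algebra_simps)
    qed
    then show ?thesis by simp
  qed
  show "dist (abs_torus x) z = norm (x - ?y)"
    using dist_abs_torus[of x "rep_torus z"] by simp
qed

lemma open_torus_iff: "open U \<longleftrightarrow> (\<forall>x\<in>U. \<exists>e>0. \<forall>y. dist x y < e \<longrightarrow> y \<in> U)"
  for U :: "'a torus set"
proof
  assume U: "open U"
  show "\<forall>x\<in>U. \<exists>e>0. \<forall>y. dist x y < e \<longrightarrow> y \<in> U"
  proof
    fix w assume w: "w \<in> U"
    define x where "x = rep_torus w"
    have wx: "w = abs_torus x" by (simp add: x_def)
    have "open (abs_torus -` U)" using U by (simp add: open_torus_def)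
    moreover have "x \<in> abs_torus -` U" using w wx by simp
    ultimately obtain e where e: "e > 0" "ball x e \<subseteq> abs_torus -` U"
      by (meson open_contains_ball)
    have "y \<in> U" if "dist w y < e" for y
    proof -
      obtain v where v: "abs_torus v = y" "dist (abs_torus x) y = norm (x - v)"
        by (rule lift_at_distance)
      then have "v \<in> ball x e" using that wx by (simp add: dist_norm)
      then show ?thesis using e v by auto
    qed
    then show "\<exists>e>0. \<forall>y. dist w y < e \<longrightarrow> y \<in> U" using e by blast
  qed
next
  assume R: "\<forall>x\<in>U. \<exists>e>0. \<forall>y. dist x y < e \<longrightarrow> y \<in> U"
  have "open (abs_torus -` U)"
    unfolding open_contains_ball
  proof
    fix x assume "x \<in> abs_torus -` U"
    then obtain e where e: "e > 0" "\<And>y. dist (abs_torus x) y < e \<Longrightarrow> y \<in> U"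
      using R by (metis vimageE)
    have "ball x e \<subseteq> abs_torus -` U"
    proof
      fix y assume "y \<in> ball x e"
      then have "dist (abs_torus x) (abs_torus y) < e"
        using dist_abs_torus_le[of x y] by (simp add: dist_norm)
      then show "y \<in> abs_torus -` U" using e by simp
    qed
    then show "\<exists>e>0. ball x e \<subseteq> abs_torus -` U" using e by blast
  qed
  then show "open U" by (simp add: open_torus_def)
qed

lemma dist_torus_commute: "dist w z = dist z (w :: 'a torus)"
proof -
  obtain x y where "abs_torus x = w" "abs_torus y = z" "dist w z = norm (x - y)"
    by (metis abs_rep_torus lift_at_distance)
  moreover obtain y' x' where "abs_torus y' = z" "abs_torus x' = w" "dist z w = norm (y' - x')"
    by (metis abs_rep_torus lift_at_distance)
  ultimately show ?thesis
    using dist_abs_torus_le[of y x] dist_abs_torus_le[of x' y'] by (simp add: norm_minus_commute)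
qed

instance
proof
  show "uniformity = (INF e\<in>{0<..}. principal {(x, y :: 'a torus). dist x y < e})"
    by (rule uniformity_torus_def)
  show "dist w z = 0 \<longleftrightarrow> w = z" for w z :: "'a torus"
  proof -
    have "dist w z = 0 \<longleftrightarrow> (\<forall>i. rep_torus w $ i - rep_torus z $ i \<in> \<int>)"
      by (simp add: dist_torus_def red_vec_def vec_eq_iff red_eq_0_iff)
    also have "\<dots> \<longleftrightarrow> w = z"
      by (metis abs_rep_torus abs_torus_eq_iff)
    finally show ?thesis .
  qed
  show "dist w u \<le> dist w z + dist u z" for w u z :: "'a torus"
  proof -
    obtain x y where 1: "abs_torus x = w" "abs_torus y = z" "dist w z = norm (x - y)"
      by (metis abs_rep_torus lift_at_distance)
    obtain v where 2: "abs_torus v = u" "dist (abs_torus y) u = norm (y - v)"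
      by (rule lift_at_distance)
    have "dist w u \<le> norm (x - v)" using dist_abs_torus_le[of x v] 1 2 by simp
    also have "\<dots> \<le> norm (x - y) + norm (y - v)"
      by (metis norm_diff_triangle_ineq diff_add_cancel add_diff_eq norm_triangle_ineq)
    finally show ?thesis using 1 2 dist_torus_commute[of u z] by simp
  qed
  show "open U \<longleftrightarrow> (\<forall>x\<in>U. \<forall>\<^sub>F (x', y) in uniformity. x' = x \<longrightarrow> y \<in> U)" for U :: "'a torus set"
  proof -
    have "(\<forall>\<^sub>F (x', y) in uniformity. x' = x \<longrightarrow> y \<in> U) \<longleftrightarrow> (\<exists>e>0. \<forall>y. dist x y < e \<longrightarrow> y \<in> U)"
      for x :: "'a torus"
    proof -
      have "(\<forall>\<^sub>F p in uniformity. (case p of (x', y) \<Rightarrow> x' = x \<longrightarrow> y \<in> U)) \<longleftrightarrow>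
        (\<exists>e\<in>{0<..}. \<forall>\<^sub>F p in principal {(x, y :: 'a torus). dist x y < e}. case p of (x', y) \<Rightarrow> x' = x \<longrightarrow> y \<in> U)"
        unfolding uniformity_torus_def
      proof (rule eventually_INF_base)
        fix a b :: real assume "a \<in> {0<..}" "b \<in> {0<..}"
        then show "\<exists>e\<in>{0<..}. principal {(x, y :: 'a torus). dist x y < e}
            \<le> inf (principal {(x, y). dist x y < a}) (principal {(x, y). dist x y < b})"
          by (intro bexI[of _ "min a b"]) auto
      qed (auto intro: exI[of _ 1])
      then show ?thesis by (auto simp: eventually_principal)
    qed
    then show ?thesis by (simp add: open_torus_iff)
  qed
qed

end

lemma dist_abs_torus_small: "norm (x - y) < 1/2 \<Longrightarrow> dist (abs_torus x) (abs_torus y) = norm (x - y)"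
  by (simp add: dist_abs_torus red_vec_small)

lemma image_ball_abs_torus: "abs_torus ` ball x r = ball (abs_torus x) r"
proof
  show "abs_torus ` ball x r \<subseteq> ball (abs_torus x) r"
    by (auto simp: dist_norm intro: order_le_less_trans[OF dist_abs_torus_le])
  show "ball (abs_torus x) r \<subseteq> abs_torus ` ball x r"
  proof
    fix z assume "z \<in> ball (abs_torus x) r"
    moreover obtain y where "abs_torus y = z" "dist (abs_torus x) z = norm (x - y)"
      by (rule lift_at_distance)
    ultimately show "z \<in> abs_torus ` ball x r" by (auto simp: dist_norm)
  qed
qed

lemma open_image_abs_torus:
  assumes "open S" shows "open (abs_torus ` S)"
  unfolding open_contains_ball
proof
  fix w assume "w \<in> abs_torus ` S"
  then obtain x where x: "x \<in> S" "w = abs_torus x" by blast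
  then obtain r where "r > 0" "ball x r \<subseteq> S" using assms by (meson open_contains_ball)
  then show "\<exists>e>0. ball w e \<subseteq> abs_torus ` S"
    using image_ball_abs_torus[of x r] x by (metis image_mono)
qed

lemma continuous_on_abs_torus [continuous_intros]:
  "continuous_on S f \<Longrightarrow> continuous_on S (\<lambda>x. abs_torus (f x))"
  using continuous_on_compose2[OF continuous_abs_torus] by blast

lemma compact_UNIV_torus: "compact (UNIV :: 'n::finite torus set)"
proof -
  have "UNIV = abs_torus ` cbox 0 (1 :: real ^ 'n)"
  proof (intro equalityI subsetI)
    fix w :: "'n torus"
    let ?x = "\<chi> i. frac (rep_torus w $ i)"
    have "abs_torus ?x = abs_torus (rep_torus w)"
      unfolding abs_torus_eq_iff by (auto simp: frac_def)
    moreover have "?x \<in> cbox 0 1"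
      by (auto simp: mem_box_cart frac_ge_0 less_imp_le[OF frac_lt_1])
    ultimately show "w \<in> abs_torus ` cbox 0 1" by (metis abs_rep_torus image_eqI)
  qed auto
  then show ?thesis
    by (metis compact_cbox compact_continuous_image continuous_abs_torus continuous_on_subset top_greatest)
qed

instance torus :: (finite) second_countable_topology
proof
  obtain B :: "(real ^ 'a) set set" where B: "countable B" "topological_basis B"
    using ex_countable_basis by blast
  have "topological_basis ((`) abs_torus ` B)"
  proof (rule topological_basisI)
    fix S assume "S \<in> (`) abs_torus ` B"
    then show "open S" using B open_image_abs_torus topological_basis_open by blast
  next
    fix O' :: "'a torus set" and w assume O': "open O'" "w \<in> O'"
    then have "open (abs_torus -` O')" "rep_torus w \<in> abs_torus -` O'"
      by (auto simp: open_torus_def)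
    then obtain S where "S \<in> B" "rep_torus w \<in> S" "S \<subseteq> abs_torus -` O'"
      using B topological_basisE by blast
    then show "\<exists>S\<in>(`) abs_torus ` B. w \<in> S \<and> S \<subseteq> O'"
      by (intro bexI[of _ "abs_torus ` S"]) (auto, metis abs_rep_torus image_eqI)
  qed
  then show "\<exists>B :: 'a torus set set. countable B \<and> open = generate_topology B"
    using B topological_basis_imp_subbasis by (intro exI[of _ "(`) abs_torus ` B"]) auto
qed

instance torus :: (finite) complete_space
proof
  fix X :: "nat \<Rightarrow> 'a torus" assume "Cauchy X"
  then show "convergent X"
    using compact_imp_complete[OF compact_UNIV_torus]
    unfolding complete_def convergent_def by blast
qed

lemma connected_UNIV_torus: "connected (UNIV :: 'n::finite torus set)"
proof -
  have "UNIV = range (abs_torus :: real ^ 'n \<Rightarrow> _)" by (metis abs_rep_torus surj_def)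
  then show ?thesis by (metis connected_UNIV connected_continuous_image continuous_abs_torus)
qed

section \<open>Smooth maps of tori\<close>

lemma C2_on_derivative_bounded:
  assumes "C2_on S F" "x \<in> S" "open S"
  obtains r F' B where "r > 0" "ball x r \<subseteq> S"
    "\<And>y. y \<in> ball x r \<Longrightarrow> (F has_derivative blinfun_apply (F' y)) (at y)"
    "\<And>y. y \<in> ball x r \<Longrightarrow> norm (F' y) \<le> B"
proof -
  obtain F' where F': "\<And>y. y \<in> S \<Longrightarrow> (F has_derivative blinfun_apply (F' y)) (at y)" and "C1_on S F'"
    using assms unfolding C2_on_def by blast
  then have "isCont F' x"
    using assms unfolding C1_on_def by (blast intro: has_derivative_continuous)
  then obtain d where d: "d > 0" "\<And>y. dist y x < d \<Longrightarrow> dist (F' y) (F' x) < 1"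
    by (metis continuous_at zero_less_one Lim_at dist_self zero_neq_one continuous_at_eps_delta)
  obtain e where e: "e > 0" "ball x e \<subseteq> S" using assms open_contains_ball by blast
  show thesis
  proof (rule that[of "min d e" F' "norm (F' x) + 1"])
    fix y assume "y \<in> ball x (min d e)"
    then show "(F has_derivative blinfun_apply (F' y)) (at y)" using F' e by auto
    from \<open>y \<in> _\<close> have "dist (F' y) (F' x) < 1" using d(2)[of y] by (simp add: dist_commute)
    then show "norm (F' y) \<le> norm (F' x) + 1"
      using norm_triangle_ineq[of "F' y - F' x" "F' x"] by (simp add: dist_norm)
  qed (use d e in auto)
qed

text \<open>A \<open>C\<^sup>2\<close> map is Lipschitz near each point because its derivative is continuous there; compactness of the
torus makes the constant uniform. Applied to \<open>g\<close> and to its inverse, this bounds all dilation ratios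
away from \<open>0\<close> and \<open>\<infinity>\<close>.\<close>

lemma torus_C2_Lipschitz:
  fixes f :: "'n::finite torus \<Rightarrow> 'm::finite torus"
  assumes "torus_C2 f"
  obtains K where "K-lipschitz_on UNIV f"
proof -
  have "local_lipschitz {0::real} UNIV (\<lambda>_. f)"
  proof (rule local_lipschitzI)
    fix w :: "'n torus" and t :: real
    define x where "x = rep_torus w"
    have x: "abs_torus x = w" by (simp add: x_def)
    obtain S F where S: "open S" "x \<in> S" "C2_on S F" "\<And>y. y \<in> S \<Longrightarrow> abs_torus (F y) = f (abs_torus y)"
      using assms[unfolded torus_C2_def, rule_format, of x] by auto
    obtain r F' B where r: "r > 0" "ball x r \<subseteq> S"
      and F': "\<And>y. y \<in> ball x r \<Longrightarrow> (F has_derivative blinfun_apply (F' y)) (at y)"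
      and B: "\<And>y. y \<in> ball x r \<Longrightarrow> norm (F' y) \<le> B"
      by (rule C2_on_derivative_bounded[OF S(3,2,1)]) (rule that)
    have B0: "0 \<le> B" using B[of x] r norm_ge_zero[of "F' x"] by (simp add: order_trans del: norm_ge_zero)
    have F_lip: "norm (F y - F z) \<le> B * norm (y - z)" if "y \<in> ball x r" "z \<in> ball x r" for y z
    proof (rule differentiable_bound[OF convex_ball[of x r], of F "\<lambda>y. blinfun_apply (F' y)"])
      show "(F has_derivative blinfun_apply (F' y)) (at y within ball x r)" if "y \<in> ball x r" for y
        by (rule has_derivative_at_withinI[OF F'[OF that]])
      show "onorm (blinfun_apply (F' y)) \<le> B" if "y \<in> ball x r" for y
        using B[OF that] by (simp add: norm_blinfun.rep_eq)
    qed (use that in auto)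
    have "B-lipschitz_on (cball w (r/4) \<inter> UNIV) f"
    proof (rule lipschitz_onI)
      fix u v assume uv: "u \<in> cball w (r/4) \<inter> UNIV" "v \<in> cball w (r/4) \<inter> UNIV"
      obtain y where y': "abs_torus y = u" "dist (abs_torus x) u = norm (x - y)"
        by (rule lift_at_distance)
      then have y: "abs_torus y = u" "dist w u = norm (x - y)" using x by auto
      obtain z where z': "abs_torus z = v" "dist (abs_torus y) v = norm (y - z)"
        by (rule lift_at_distance)
      then have z: "abs_torus z = v" "dist u v = norm (y - z)" using y by auto
      have "dist u v \<le> r/2"
        using uv dist_triangle[of u v w] by (simp add: dist_commute)
      then have "norm (x - z) \<le> r/4 + r/2"
        using uv y z norm_triangle_ineq[of "x - y" "y - z"] by simp
      then have "z \<in> ball x r" "y \<in> ball x r" using y uv r by (auto simp: dist_norm)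
      then have "norm (F y - F z) \<le> B * norm (y - z)" "abs_torus (F y) = f u" "abs_torus (F z) = f v"
        using F_lip S r y z by auto
      then show "dist (f u) (f v) \<le> B * dist u v"
        using dist_abs_torus_le[of "F y" "F z"] z by simp
    qed (rule B0)
    then show "\<exists>u>0. \<exists>L. \<forall>t\<in>cball t u \<inter> {0}. L-lipschitz_on (cball w u \<inter> UNIV) f"
      using r by (intro exI[of _ "r/4"]) auto
  qed
  then obtain L where "\<And>t. t \<in> {0::real} \<Longrightarrow> L-lipschitz_on UNIV f"
    by (rule local_lipschitz_compact_implies_lipschitz) (auto simp: compact_UNIV_torus)
  then show thesis using that by blast
qed

lemma torus_C2_has_derivative:
  assumes "torus_C2 f" obtains D where "torus_has_derivative f D w"
proof -
  obtain S F where S: "open S" "rep_torus w \<in> S" "C2_on S F" "\<And>y. y \<in> S \<Longrightarrow> abs_torus (F y) = f (abs_torus y)"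
    using assms[unfolded torus_C2_def, rule_format, of "rep_torus w"] by auto
  obtain D where "(F has_derivative D) (at (rep_torus w))"
    using S unfolding C2_on_def by blast
  moreover have "\<forall>\<^sub>F y in nhds (rep_torus w). abs_torus (F y) = f (abs_torus y)"
    using S unfolding eventually_nhds by blast
  ultimately show thesis
    using that[of D] unfolding torus_has_derivative_def by (metis abs_rep_torus)
qed

lemma torus_deriv_eq: "torus_has_derivative f D w \<Longrightarrow> torus_deriv f w = D"
  unfolding torus_deriv_def by (blast intro: torus_has_derivative_unique)

lemma abs_torus_add_Ints: "\<forall>i. m $ i \<in> \<int> \<Longrightarrow> abs_torus (x + m) = abs_torus x"
  by (simp add: abs_torus_eq_iff)

lemma torus_has_derivative_compose:
  fixes f :: "'n::finite torus \<Rightarrow> 'm::finite torus" and h :: "'m torus \<Rightarrow> 'k::finite torus"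
  assumes "torus_has_derivative f D w" "torus_has_derivative h E (f w)"
  shows "torus_has_derivative (h \<circ> f) (E \<circ> D) w"
proof -
  obtain x F where x: "abs_torus x = w"
    and F: "\<forall>\<^sub>F y in nhds x. abs_torus (F y) = f (abs_torus y)"
    and dF: "(F has_derivative D) (at x)"
    using assms(1) unfolding torus_has_derivative_def by blast
  obtain x' H where x': "abs_torus x' = f w"
    and H: "\<forall>\<^sub>F y in nhds x'. abs_torus (H y) = h (abs_torus y)"
    and dH: "(H has_derivative E) (at x')"
    using assms(2) unfolding torus_has_derivative_def by blast
  define m where "m = x' - F x"
  have "abs_torus (F x) = f w" using eventually_nhds_x_imp_x[OF F] x by simp
  then have m: "\<forall>i. m $ i \<in> \<int>" using x' abs_torus_eq_iff[of x' "F x"] by (simp add: m_def)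
  have dFm: "((\<lambda>y. F y + m) has_derivative D) (at x)"
    using dF by (auto intro!: derivative_eq_intros)
  have x'_eq: "F x + m = x'" by (simp add: m_def)
  have "((\<lambda>y. F y + m) \<longlongrightarrow> x') (nhds x)"
    using has_derivative_continuous[OF dFm] x'_eq by (simp add: continuous_at tendsto_nhds_iff)
  then have "filterlim (\<lambda>y. F y + m) (nhds x') (nhds x)" .
  from eventually_compose_filterlim[OF H this]
  have "\<forall>\<^sub>F y in nhds x. abs_torus (H (F y + m)) = h (abs_torus (F y + m))" .
  then have "\<forall>\<^sub>F y in nhds x. abs_torus (H (F y + m)) = (h \<circ> f) (abs_torus y)"
    using F by eventually_elim (simp add: abs_torus_add_Ints m)
  moreover have "((\<lambda>y. H (F y + m)) has_derivative (E \<circ> D)) (at x)"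
    using diff_chain_at[OF dFm] dH x'_eq by (simp add: o_def)
  ultimately show ?thesis using x unfolding torus_has_derivative_def
    by (intro exI[of _ x] exI[of _ "\<lambda>y. H (F y + m)"] conjI)
qed

lemma torus_has_derivative_funpow:
  fixes g :: "'n::finite torus \<Rightarrow> 'n torus"
  assumes "torus_C2 g" shows "\<exists>D. torus_has_derivative (g ^^ n) D w"
proof (induction n)
  case 0
  have "torus_has_derivative (\<lambda>x. x) (\<lambda>v. v) w"
    unfolding torus_has_derivative_def
    by (rule exI[of _ "rep_torus w"], rule exI[of _ "\<lambda>x. x"]) (auto intro: has_derivative_ident)
  then show ?case by (auto simp: id_def)
next
  case (Suc n)
  then obtain D where "torus_has_derivative (g ^^ n) D w" by blast
  moreover obtain E where "torus_has_derivative g E ((g ^^ n) w)"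
    using torus_C2_has_derivative[OF assms] .
  ultimately have "torus_has_derivative (g \<circ> (g ^^ n)) (E \<circ> D) w"
    by (rule torus_has_derivative_compose)
  then show ?case by (metis funpow.simps(2))
qed

lemma dist_quotient_tendsto_norm:
  fixes \<phi> :: "real \<Rightarrow> real ^ 'n::finite"
  assumes "(\<phi> has_vector_derivative v) (at t)"
  shows "((\<lambda>s. dist (abs_torus (\<phi> s)) (abs_torus (\<phi> t)) / \<bar>s - t\<bar>) \<longlongrightarrow> norm v) (at t)"
proof -
  have "((\<lambda>s. norm (\<phi> s - \<phi> t - (s - t) *\<^sub>R v) / norm (s - t)) \<longlongrightarrow> 0) (at t)"
    using assms unfolding has_vector_derivative_def has_derivative_iff_norm by simp
  then have "((\<lambda>s. norm (\<phi> s - \<phi> t) / \<bar>s - t\<bar> - norm v) \<longlongrightarrow> 0) (at t)"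
  proof (rule Lim_null_comparison[rotated], unfold eventually_at, intro exI[of _ 1] conjI ballI impI)
    fix s assume "s \<noteq> t \<and> dist s t < 1"
    then have st: "\<bar>s - t\<bar> > 0" by simp
    have "\<bar>norm (\<phi> s - \<phi> t) - norm ((s - t) *\<^sub>R v)\<bar> \<le> norm (\<phi> s - \<phi> t - (s - t) *\<^sub>R v)"
      by (rule norm_triangle_ineq3)
    then have "\<bar>norm (\<phi> s - \<phi> t) - norm ((s - t) *\<^sub>R v)\<bar> / \<bar>s - t\<bar>
        \<le> norm (\<phi> s - \<phi> t - (s - t) *\<^sub>R v) / \<bar>s - t\<bar>"
      by (rule divide_right_mono) simp
    moreover have "norm (\<phi> s - \<phi> t) / \<bar>s - t\<bar> - norm v = (norm (\<phi> s - \<phi> t) - norm ((s - t) *\<^sub>R v)) / \<bar>s - t\<bar>"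
      using st unfolding norm_scaleR real_norm_def by (simp add: diff_divide_distrib)
    ultimately show "norm (norm (\<phi> s - \<phi> t) / \<bar>s - t\<bar> - norm v)
        \<le> norm (\<phi> s - \<phi> t - (s - t) *\<^sub>R v) / norm (s - t)" by simp
  qed simp
  then have 1: "((\<lambda>s. norm (\<phi> s - \<phi> t) / \<bar>s - t\<bar>) \<longlongrightarrow> norm v) (at t)"
    by (simp add: LIM_zero_iff)
  have "isCont \<phi> t" using assms has_vector_derivative_continuous by blast
  then have "((\<lambda>s. norm (\<phi> s - \<phi> t)) \<longlongrightarrow> 0) (at t)"
    by (simp add: isCont_def LIM_zero tendsto_norm_zero)
  then have "\<forall>\<^sub>F s in at t. norm (\<phi> s - \<phi> t) < 1/2"
    by (rule order_tendstoD) simp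
  then have "\<forall>\<^sub>F s in at t. norm (\<phi> s - \<phi> t) / \<bar>s - t\<bar> = dist (abs_torus (\<phi> s)) (abs_torus (\<phi> t)) / \<bar>s - t\<bar>"
    by eventually_elim (simp add: dist_abs_torus_small)
  with 1 show ?thesis by (rule tendsto_cong[THEN iffD1, rotated])
qed

text \<open>A \<open>C\<^sup>2\<close> circle is compactly embedded, so points of it that are near in the torus have parameters that
are near modulo \<open>1\<close>. Limits along the parameter are therefore limits along the leaf in the metric of
the torus.\<close>

lemma circle_param_inverse_limit:
  assumes \<gamma>: "C2_circle_param L \<gamma>"
    and lim: "((\<lambda>s. f (abs_torus (\<gamma> s))) \<longlongrightarrow> l) (at t)"
  shows "(f \<longlongrightarrow> l) (at (abs_torus (\<gamma> t)) within L)"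
  unfolding tendsto_def
proof (intro allI impI)
  fix S assume "open S" "l \<in> S"
  then have "\<forall>\<^sub>F s in at t. f (abs_torus (\<gamma> s)) \<in> S" using lim by (simp add: tendsto_def)
  then obtain e where e: "e > 0" "\<And>s. s \<noteq> t \<Longrightarrow> dist s t < e \<Longrightarrow> f (abs_torus (\<gamma> s)) \<in> S"
    unfolding eventually_at by auto
  have inj: "abs_torus (\<gamma> s) = abs_torus (\<gamma> u) \<longleftrightarrow> s - u \<in> \<int>" for s u
    using \<gamma> by (auto simp: C2_circle_param_def)
  have L: "L = range (\<lambda>s. abs_torus (\<gamma> s))"
    using \<gamma> by (auto simp: C2_circle_param_def o_def)
  have "continuous_on UNIV \<gamma>"
    using \<gamma> unfolding C2_circle_param_def C2_on_def
    by (meson UNIV_I continuous_at_imp_continuous_on has_derivative_continuous)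
  then have cont: "continuous_on A (\<lambda>s. abs_torus (\<gamma> s))" for A
    by (intro continuous_on_abs_torus) (auto intro: continuous_on_subset)
  define C where "C = {t - 1/2..t + 1/2} - ball t e"
  have "compact C" unfolding C_def by (intro compact_diff) auto
  then have K: "closed ((\<lambda>s. abs_torus (\<gamma> s)) ` C)"
    by (intro compact_imp_closed compact_continuous_image cont)
  have notin: "abs_torus (\<gamma> t) \<notin> (\<lambda>s. abs_torus (\<gamma> s)) ` C"
  proof
    assume "abs_torus (\<gamma> t) \<in> (\<lambda>s. abs_torus (\<gamma> s)) ` C"
    then obtain s where s: "s \<in> C" "t - s \<in> \<int>" using inj by auto
    then have "\<bar>t - s\<bar> < 1" by (auto simp: C_def)
    then have "s = t" using s Ints_nonzero_abs_less1 by fastforce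
    then show False using s e by (simp add: C_def)
  qed
  then obtain d where d: "d > 0" "\<And>y. y \<in> (\<lambda>s. abs_torus (\<gamma> s)) ` C \<Longrightarrow> d \<le> dist (abs_torus (\<gamma> t)) y"
  proof -
    have "open (- ((\<lambda>s. abs_torus (\<gamma> s)) ` C))" using K by (simp add: open_Compl)
    from this[unfolded open_contains_ball, rule_format, OF Compl_iff[THEN iffD2, OF notin]]
    obtain d where d: "d > 0" "ball (abs_torus (\<gamma> t)) d \<subseteq> - ((\<lambda>s. abs_torus (\<gamma> s)) ` C)"
      by auto
    show thesis
    proof (rule that[OF d(1)])
      fix y assume "y \<in> (\<lambda>s. abs_torus (\<gamma> s)) ` C"
      then have "y \<notin> ball (abs_torus (\<gamma> t)) d" using d(2) by (meson ComplD subsetD)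
      then show "d \<le> dist (abs_torus (\<gamma> t)) y" by simp
    qed
  qed
  have "f y \<in> S" if y: "y \<in> L" "y \<noteq> abs_torus (\<gamma> t)" "dist y (abs_torus (\<gamma> t)) < d" for y
  proof -
    obtain s0 where s0: "y = abs_torus (\<gamma> s0)" using y L by auto
    define s where "s = t + red (s0 - t)"
    have "s0 - s \<in> \<int>" using diff_red_Ints[of "s0 - t"] by (simp add: s_def algebra_simps)
    then have s: "y = abs_torus (\<gamma> s)" using inj s0 by simp
    have "\<bar>s - t\<bar> \<le> 1/2" using abs_red_le_half[of "s0 - t"] by (simp add: s_def)
    then have "s \<in> {t - 1/2..t + 1/2}" unfolding atLeastAtMost_iff by linarith
    moreover have "s \<notin> C" using d(2)[of y] y s by (auto simp: dist_commute)
    ultimately have "dist s t < e" by (simp add: C_def dist_commute)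
    then show ?thesis using e(2)[of s] s y by auto
  qed
  then show "\<forall>\<^sub>F y in at (abs_torus (\<gamma> t)) within L. f y \<in> S"
    unfolding eventually_at using d by auto
qed

text \<open>Nothing is assumed about how the tangent lines vary from leaf to leaf. Replacing the derivative along
a leaf by this limit of ratios removes tangent vectors from the rest of the argument.\<close>

lemma leaf_dilation_limit:
  fixes f :: "'n::finite torus \<Rightarrow> 'm::finite torus"
  assumes tan: "tangent_to L w v" "v \<noteq> 0" and D: "torus_has_derivative f D w"
  shows "((\<lambda>y. dist (f y) (f w) / dist y w) \<longlongrightarrow> norm (D v) / norm v) (at w within L)"
proof -
  obtain \<gamma> t a where \<gamma>: "C2_circle_param L \<gamma>" and w: "abs_torus (\<gamma> t) = w"
    and v: "v = a *\<^sub>R vector_derivative \<gamma> (at t)"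
    using tan unfolding tangent_to_def by blast
  define u where "u = vector_derivative \<gamma> (at t)"
  have a: "a \<noteq> 0" and u: "u \<noteq> 0" using tan v by (auto simp: u_def)
  have "\<gamma> differentiable (at t)"
    using \<gamma> unfolding C2_circle_param_def C2_on_def differentiable_def by blast
  then have d\<gamma>: "(\<gamma> has_vector_derivative u) (at t)"
    unfolding u_def by (simp add: vector_derivative_works)
  obtain x F where x: "abs_torus x = w"
    and F: "\<forall>\<^sub>F y in nhds x. abs_torus (F y) = f (abs_torus y)"
    and dF: "(F has_derivative D) (at x)"
    using D unfolding torus_has_derivative_def by blast
  define m where "m = x - \<gamma> t"
  have m: "\<forall>i. m $ i \<in> \<int>" using x w abs_torus_eq_iff[of x "\<gamma> t"] by (simp add: m_def)
  have x_eq: "\<gamma> t + m = x" by (simp add: m_def)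
  have d\<gamma>m: "((\<lambda>s. \<gamma> s + m) has_vector_derivative u) (at t)"
    using d\<gamma> by (auto intro!: derivative_eq_intros)
  have dF\<gamma>: "((\<lambda>s. F (\<gamma> s + m)) has_vector_derivative D u) (at t)"
    using vector_derivative_diff_chain_within[OF d\<gamma>m, of F D] dF x_eq
    by (simp add: o_def has_derivative_at_withinI)
  have "((\<lambda>s. \<gamma> s + m) \<longlongrightarrow> x) (nhds t)"
    using has_vector_derivative_continuous[OF d\<gamma>m] x_eq by (simp add: continuous_at tendsto_nhds_iff)
  from eventually_compose_filterlim[OF F this]
  have ev: "\<forall>\<^sub>F s in nhds t. abs_torus (F (\<gamma> s + m)) = f (abs_torus (\<gamma> s))"
    by (simp add: abs_torus_add_Ints m)
  then have "f w = abs_torus (F (\<gamma> t + m))"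
    using w by (auto dest: eventually_nhds_x_imp_x)
  moreover have "\<forall>\<^sub>F s in at t. abs_torus (F (\<gamma> s + m)) = f (abs_torus (\<gamma> s))"
    using ev by (simp add: eventually_nhds_conv_at)
  ultimately have "\<forall>\<^sub>F s in at t. dist (abs_torus (F (\<gamma> s + m))) (abs_torus (F (\<gamma> t + m))) / \<bar>s - t\<bar>
      = dist (f (abs_torus (\<gamma> s))) (f w) / \<bar>s - t\<bar>"
    by (auto elim: eventually_mono)
  then have 1: "((\<lambda>s. dist (f (abs_torus (\<gamma> s))) (f w) / \<bar>s - t\<bar>) \<longlongrightarrow> norm (D u)) (at t)"
    using dist_quotient_tendsto_norm[OF dF\<gamma>] by (rule tendsto_cong[THEN iffD1])
  have 2: "((\<lambda>s. dist (abs_torus (\<gamma> s)) w / \<bar>s - t\<bar>) \<longlongrightarrow> norm u) (at t)"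
    using dist_quotient_tendsto_norm[OF d\<gamma>] w by simp
  have "((\<lambda>s. (dist (f (abs_torus (\<gamma> s))) (f w) / \<bar>s - t\<bar>) / (dist (abs_torus (\<gamma> s)) w / \<bar>s - t\<bar>))
      \<longlongrightarrow> norm (D u) / norm u) (at t)"
    by (rule tendsto_divide[OF 1 2]) (use u in auto)
  moreover have "\<forall>\<^sub>F s in at t. (dist (f (abs_torus (\<gamma> s))) (f w) / \<bar>s - t\<bar>) / (dist (abs_torus (\<gamma> s)) w / \<bar>s - t\<bar>)
      = dist (f (abs_torus (\<gamma> s))) (f w) / dist (abs_torus (\<gamma> s)) w"
    by (auto simp: eventually_at intro!: exI[of _ 1])
  ultimately have "((\<lambda>s. dist (f (abs_torus (\<gamma> s))) (f w) / dist (abs_torus (\<gamma> s)) w) \<longlongrightarrow> norm (D u) / norm u) (at t)"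
    by (rule tendsto_cong[THEN iffD1, rotated])
  from circle_param_inverse_limit[OF \<gamma>, of "\<lambda>y. dist (f y) (f w) / dist y w", OF this] w
  have "((\<lambda>y. dist (f y) (f w) / dist y w) \<longlongrightarrow> norm (D u) / norm u) (at w within L)" by simp
  moreover have "norm (D v) / norm v = norm (D u) / norm u"
  proof -
    have "linear D" using dF has_derivative_linear by blast
    then have "D v = a *\<^sub>R D u" by (simp add: v u_def linear_scale)
    then show ?thesis using a by (simp add: v u_def)
  qed
  ultimately show ?thesis by simp
qed

section \<open>A maximal inequality\<close>

text \<open>Garsia's argument. The running maximum \<open>F\<close> of the Birkhoff sums satisfies \<open>F - F \<circ> T \<le> f\<close> wherever it
is positive and \<open>F - F \<circ> T \<le> 0\<close> elsewhere, while \<open>F - F \<circ> T\<close> has integral \<open>0\<close>; hence \<open>f\<close> has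
nonnegative integral over \<open>{F > 0}\<close>. If almost every orbit had a positive sum, these sets would
exhaust the space.\<close>

lemma maximal_inequality:
  fixes f :: "'a \<Rightarrow> real"
  assumes "finite_measure M" and T: "mp_map M T" and f: "f \<in> borel_measurable M"
    and bnd: "\<And>w. \<bar>f w\<bar> \<le> C" and neg: "(\<integral>w. f w \<partial>M) < 0"
  shows "emeasure M {w \<in> space M. \<forall>n. (\<Sum>i<n. f ((T ^^ i) w)) \<le> 0} > 0"
proof -
  interpret finite_measure M by fact
  have Tm [measurable]: "T \<in> measurable M M" and TM: "distr M M T = M" using T by (auto simp: mp_map_def)
  note f [measurable]
  define F where "F = rec_nat (\<lambda>w. 0 :: real) (\<lambda>n Fn w. max 0 (f w + Fn (T w)))"
  have F0: "F 0 w = 0" and FS: "F (Suc n) w = max 0 (f w + F n (T w))" for n w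
    by (simp_all add: F_def)
  have C0: "0 \<le> C" using bnd abs_ge_zero order_trans by blast
  have F_meas [measurable]: "F n \<in> borel_measurable M" for n
  proof (induction n)
    case 0 then show ?case by (simp add: F_def)
  next
    case (Suc n)
    note Suc.IH [measurable]
    have "F (Suc n) = (\<lambda>w. max 0 (f w + F n (T w)))" by (rule ext) (simp add: FS)
    then show ?case by simp
  qed
  have F_nonneg: "0 \<le> F n w" for n w by (cases n) (auto simp: F0 FS)
  have F_le: "F n w \<le> n * C" for n w
  proof (induction n arbitrary: w)
    case (Suc n)
    have "f w + F n (T w) \<le> C + n * C" using bnd[of w] Suc[of "T w"] by linarith
    then show ?case using C0 by (simp add: FS algebra_simps)
  qed (simp add: F0)
  have F_mono: "F n w \<le> F (Suc n) w" for n w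
  proof (induction n arbitrary: w)
    case (Suc n)
    show ?case using Suc.IH[of "T w"]
      by (simp only: FS[of n w] FS[of "Suc n" w])
  qed (simp add: F0 F_nonneg)
  have F_int: "integrable M (F n)" for n
    by (rule integrable_const_bound[of _ "n * C"]) (use F_nonneg F_le in auto)
  have FT_int: "integrable M (\<lambda>w. F n (T w))" for n
    by (rule integrable_const_bound[of _ "n * C"]) (use F_nonneg F_le in auto)
  have FT: "(\<integral>w. F n (T w) \<partial>M) = (\<integral>w. F n w \<partial>M)" for n
    using integral_distr[of T M M "F n"] TM by simp
  have f_int: "integrable M f" by (rule integrable_const_bound[of _ C]) (use bnd in auto)
  define G where "G n w = (if F n w > 0 then f w else 0)" for n w
  have G_meas [measurable]: "G n \<in> borel_measurable M" for n unfolding G_def by measurable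
  have G_nonneg: "0 \<le> (\<integral>w. G (Suc n) w \<partial>M)" for n
  proof -
    have G_int: "integrable M (G (Suc n))"
      by (rule integrable_const_bound[of _ C]) (use bnd C0 in \<open>auto simp: G_def\<close>)
    have "0 = (\<integral>w. F (Suc n) w - F (Suc n) (T w) \<partial>M)"
      using F_int FT_int by (simp add: FT)
    also have "\<dots> \<le> (\<integral>w. G (Suc n) w \<partial>M)"
    proof (rule integral_mono)
      fix w
      show "F (Suc n) w - F (Suc n) (T w) \<le> G (Suc n) w"
        using F_mono[of n "T w"] F_nonneg[of "Suc n" "T w"] F_nonneg[of "Suc n" w] FS[of n w]
        by (auto simp: G_def max_def split: if_splits)
    qed (use F_int FT_int G_int in auto)
    finally show ?thesis .
  qed
  define Z where "Z = {w \<in> space M. \<forall>n. F n w = 0}"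
  have Z_meas: "Z \<in> sets M" unfolding Z_def by measurable
  have Z_pos: "emeasure M Z > 0"
  proof (rule ccontr)
    assume "\<not> emeasure M Z > 0"
    then have "Z \<in> null_sets M" using Z_meas by (auto simp: null_sets_def)
    then have ae: "AE w in M. \<exists>n. F n w > 0"
    proof (rule AE_I')
      show "{w \<in> space M. \<not> (\<exists>n. F n w > 0)} \<subseteq> Z"
        using F_nonneg unfolding Z_def by (auto simp: not_less intro: antisym)
    qed
    have "(\<lambda>n. \<integral>w. G n w \<partial>M) \<longlonglongrightarrow> (\<integral>w. f w \<partial>M)"
    proof (rule integral_dominated_convergence[of _ _ _ "\<lambda>_. C"])
      show "AE w in M. (\<lambda>n. G n w) \<longlonglongrightarrow> f w"
        using ae
      proof eventually_elim
        case (elim w)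
        then obtain n where n: "F n w > 0" by blast
        have "F m w > 0" if "m \<ge> n" for m
          using that by (induction rule: dec_induct) (use n F_mono in \<open>auto intro: order_less_le_trans\<close>)
        then have "\<forall>\<^sub>F m in sequentially. G m w = f w"
          unfolding eventually_sequentially by (auto simp: G_def)
        then show ?case by (rule tendsto_eventually)
      qed
    qed (use bnd C0 in \<open>auto simp: G_def\<close>)
    then have "(\<lambda>n. \<integral>w. G (Suc n) w \<partial>M) \<longlonglongrightarrow> (\<integral>w. f w \<partial>M)" by (rule LIMSEQ_Suc)
    then have "0 \<le> (\<integral>w. f w \<partial>M)" by (rule LIMSEQ_le_const) (use G_nonneg in auto)
    then show False using neg by simp
  qed
  have sum_le: "(\<Sum>i<n. f ((T ^^ i) w)) \<le> F n w" for n w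
  proof (induction n arbitrary: w)
    case (Suc n)
    have "(\<Sum>i<Suc n. f ((T ^^ i) w)) = f w + (\<Sum>i<n. f ((T ^^ i) (T w)))"
      by (subst sum.lessThan_Suc_shift) (simp add: funpow_Suc_right del: funpow.simps)
    also have "\<dots> \<le> F (Suc n) w" using Suc[of "T w"] by (simp add: FS)
    finally show ?case .
  qed (simp add: F0)
  have "Z \<subseteq> {w \<in> space M. \<forall>n. (\<Sum>i<n. f ((T ^^ i) w)) \<le> 0}"
    by (auto simp: Z_def intro: order_trans[OF sum_le])
  moreover have "{w \<in> space M. \<forall>n. (\<Sum>i<n. f ((T ^^ i) w)) \<le> 0} \<in> sets M"
  proof -
    have [measurable]: "(T ^^ i) \<in> measurable M M" for i by (rule measurable_compose_n) measurable
    show ?thesis by measurable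
  qed
  ultimately have "emeasure M Z \<le> emeasure M {w \<in> space M. \<forall>n. (\<Sum>i<n. f ((T ^^ i) w)) \<le> 0}"
    by (rule emeasure_mono)
  with Z_pos show ?thesis by (rule order_less_le_trans)
qed

section \<open>Conditional densities along a factor map\<close>

locale fibred_measure =
  fixes M :: "'a::{second_countable_topology, complete_space} measure"
    and \<pi> :: "'a \<Rightarrow> 'b::{second_countable_topology, metric_space}"
  assumes sets_M: "sets M = sets borel" and total: "emeasure M UNIV = 1"
    and cont: "continuous_on UNIV \<pi>"
begin

definition \<nu> :: "'b measure" where "\<nu> = distr M borel \<pi>"

lemma space_M: "space M = UNIV" using sets_eq_imp_space_eq[OF sets_M] by simp

sublocale finite_measure M by standard (simp add: space_M total)

lemma \<pi>_meas: "\<pi> \<in> borel_measurable M"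
  using borel_measurable_continuous_onI[OF cont] measurable_cong_sets[OF sets_M refl] by blast

lemma \<pi>_borel [measurable]: "\<pi> \<in> borel_measurable borel"
  using borel_measurable_continuous_onI[OF cont] by blast

lemma sets_\<nu> [measurable_cong]: "sets \<nu> = sets borel" and space_\<nu>: "space \<nu> = UNIV"
  by (simp_all add: \<nu>_def)

lemma emeasure_\<nu>: "E \<in> sets borel \<Longrightarrow> emeasure \<nu> E = emeasure M (\<pi> -` E)"
  using emeasure_distr[OF \<pi>_meas] by (simp add: \<nu>_def space_M)

sublocale \<nu>: finite_measure \<nu>
  by standard (simp add: space_\<nu> emeasure_\<nu> total)

lemma vimage_\<pi> [measurable]: "E \<in> sets borel \<Longrightarrow> \<pi> -` E \<in> sets borel"
  using measurable_sets[OF \<pi>_borel] by simp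

lemma AE_\<nu>_D: "AE p in \<nu>. P p \<Longrightarrow> AE w in M. P (\<pi> w)"
  unfolding \<nu>_def by (rule AE_distrD[OF \<pi>_meas])

text \<open>The conditional probability of \<open>S\<close> given \<open>\<pi>\<close>, as a function on the base. Densities of countably
many sets replace a disintegration of \<open>M\<close> along the fibres.\<close>

definition dens :: "'a set \<Rightarrow> 'b \<Rightarrow> real"
  where "dens S p = enn2real (RN_deriv \<nu> (distr (density M (indicator S)) borel \<pi>) p)"

lemma dens_nonneg [simp]: "0 \<le> dens S p" by (simp add: dens_def)

lemma dens_measurable [measurable]: "dens S \<in> borel_measurable borel"
proof -
  have "dens S \<in> borel_measurable \<nu>" unfolding dens_def by measurable
  then show ?thesis using measurable_cong_sets[OF sets_\<nu> refl] by blast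
qed

lemma emeasure_dens:
  assumes [measurable]: "S \<in> sets borel" "E \<in> sets borel"
  shows "emeasure M (S \<inter> \<pi> -` E) = (\<integral>\<^sup>+p. ennreal (dens S p) * indicator E p \<partial>\<nu>)"
proof -
  define N where "N = distr (density M (indicator S)) borel \<pi>"
  have N: "emeasure N E = emeasure M (S \<inter> \<pi> -` E)" if [measurable]: "E \<in> sets borel" for E
  proof -
    have "\<pi> \<in> measurable (density M (indicator S)) borel" using \<pi>_meas by simp
    then have "emeasure N E = emeasure (density M (indicator S)) (\<pi> -` E)"
      unfolding N_def using emeasure_distr that by (metis space_M space_density inf_top.right_neutral)
    also have "\<dots> = emeasure M (S \<inter> \<pi> -` E)"
      using emeasure_density[of "indicator S" M "\<pi> -` E"] sets_M
      by (simp add: indicator_inter_arith[symmetric])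
    finally show ?thesis .
  qed
  have ac: "absolutely_continuous \<nu> N"
    unfolding absolutely_continuous_def
  proof
    fix E assume E: "E \<in> null_sets \<nu>"
    then have [measurable]: "E \<in> sets borel" by (auto simp: sets_\<nu>)
    have "emeasure M (S \<inter> \<pi> -` E) \<le> emeasure M (\<pi> -` E)"
      by (rule emeasure_mono) (auto simp: sets_M)
    then have "emeasure N E = 0" using E by (simp add: N emeasure_\<nu> null_sets_def)
    then show "E \<in> null_sets N" by (auto simp: null_sets_def N_def)
  qed
  have sN: "sets N = sets \<nu>" by (simp add: N_def sets_\<nu>)
  have "emeasure N (space N) \<noteq> \<infinity>"
    using N[of UNIV] by (simp add: N_def emeasure_eq_measure)
  then interpret N: finite_measure N by standard
  have fin: "AE p in \<nu>. RN_deriv \<nu> N p \<noteq> \<infinity>"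
    by (rule \<nu>.RN_deriv_finite[OF _ ac sN]) standard
  have "emeasure M (S \<inter> \<pi> -` E) = emeasure (density \<nu> (RN_deriv \<nu> N)) E"
    using \<nu>.density_RN_deriv[OF ac sN] N[of E] by simp
  also have "\<dots> = (\<integral>\<^sup>+p. RN_deriv \<nu> N p * indicator E p \<partial>\<nu>)"
    by (rule emeasure_density) (auto simp: sets_\<nu>)
  also have "\<dots> = (\<integral>\<^sup>+p. ennreal (dens S p) * indicator E p \<partial>\<nu>)"
    by (rule nn_integral_cong_AE) (use fin in eventually_elim, auto simp: dens_def N_def[symmetric] less_top)
  finally show ?thesis .
qed

lemma dens_unique:
  fixes f :: "'b \<Rightarrow> real"
  assumes [measurable]: "S \<in> sets borel" "D \<in> sets borel" "f \<in> borel_measurable borel"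
    and f0: "\<And>p. 0 \<le> f p"
    and eq: "\<And>E. E \<in> sets borel \<Longrightarrow> E \<subseteq> D \<Longrightarrow>
      emeasure M (S \<inter> \<pi> -` E) = (\<integral>\<^sup>+p. ennreal (f p) * indicator E p \<partial>\<nu>)"
  shows "AE p in \<nu>. p \<in> D \<longrightarrow> dens S p = f p"
proof -
  have "AE p in \<nu>. ennreal (dens S p) * indicator D p = ennreal (f p) * indicator D p"
  proof (rule \<nu>.density_unique_finite_measure)
    fix A assume "A \<in> sets \<nu>"
    then have [measurable]: "A \<in> sets borel" by (simp add: sets_\<nu>)
    have "(\<integral>\<^sup>+p. ennreal (dens S p) * indicator D p * indicator A p \<partial>\<nu>)
        = (\<integral>\<^sup>+p. ennreal (dens S p) * indicator (D \<inter> A) p \<partial>\<nu>)"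
      by (simp add: indicator_inter_arith mult.assoc)
    also have "\<dots> = (\<integral>\<^sup>+p. ennreal (f p) * indicator (D \<inter> A) p \<partial>\<nu>)"
      using eq[of "D \<inter> A"] emeasure_dens[of S "D \<inter> A"] by simp
    also have "\<dots> = (\<integral>\<^sup>+p. ennreal (f p) * indicator D p * indicator A p \<partial>\<nu>)"
      by (simp add: indicator_inter_arith mult.assoc)
    finally show "(\<integral>\<^sup>+p. ennreal (dens S p) * indicator D p * indicator A p \<partial>\<nu>) =
      (\<integral>\<^sup>+p. ennreal (f p) * indicator D p * indicator A p \<partial>\<nu>)" .
  qed (auto simp: measurable_cong_sets[OF sets_\<nu> refl])
  then show ?thesis by eventually_elim (auto simp: f0)
qed

text \<open>An inequality rather than additivity, since it is applied to two small cells inside a larger one.\<close>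

lemma dens_disjoint_le:
  assumes [measurable]: "S \<in> sets borel" "S1 \<in> sets borel" "S2 \<in> sets borel"
    and sub: "S1 \<subseteq> S" "S2 \<subseteq> S" "S1 \<inter> S2 = {}"
  shows "AE p in \<nu>. dens S1 p + dens S2 p \<le> dens S p"
proof -
  define R where "R = S - S1 - S2"
  have [measurable]: "R \<in> sets borel" by (simp add: R_def)
  have "AE p in \<nu>. p \<in> UNIV \<longrightarrow> dens S p = dens S1 p + dens S2 p + dens R p"
  proof (rule dens_unique)
    fix E :: "'b set" assume [measurable]: "E \<in> sets borel"
    have "S \<inter> \<pi> -` E = (S1 \<inter> \<pi> -` E) \<union> (S2 \<inter> \<pi> -` E) \<union> (R \<inter> \<pi> -` E)"
      using sub by (auto simp: R_def)
    then have "emeasure M (S \<inter> \<pi> -` E) = emeasure M (((S1 \<inter> \<pi> -` E) \<union> (S2 \<inter> \<pi> -` E)) \<union> (R \<inter> \<pi> -` E))"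
      by (rule arg_cong)
    also have "\<dots> = emeasure M ((S1 \<inter> \<pi> -` E) \<union> (S2 \<inter> \<pi> -` E)) + emeasure M (R \<inter> \<pi> -` E)"
      by (rule plus_emeasure[symmetric]) (auto simp: sets_M R_def)
    also have "emeasure M ((S1 \<inter> \<pi> -` E) \<union> (S2 \<inter> \<pi> -` E)) = emeasure M (S1 \<inter> \<pi> -` E) + emeasure M (S2 \<inter> \<pi> -` E)"
      by (rule plus_emeasure[symmetric]) (use sub in \<open>auto simp: sets_M\<close>)
    also have "\<dots> + emeasure M (R \<inter> \<pi> -` E) = (\<integral>\<^sup>+p. ennreal (dens S1 p) * indicator E p \<partial>\<nu>)
        + (\<integral>\<^sup>+p. ennreal (dens S2 p) * indicator E p \<partial>\<nu>) + (\<integral>\<^sup>+p. ennreal (dens R p) * indicator E p \<partial>\<nu>)"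
      by (simp add: emeasure_dens)
    also have "\<dots> = (\<integral>\<^sup>+p. ennreal (dens S1 p + dens S2 p + dens R p) * indicator E p \<partial>\<nu>)"
      by (simp add: nn_integral_add[symmetric] distrib_right[symmetric] measurable_cong_sets[OF sets_\<nu> refl])
    finally show "emeasure M (S \<inter> \<pi> -` E) = \<dots>" .
  qed auto
  then show ?thesis by eventually_elim auto
qed

lemma dens_mono:
  assumes "S \<in> sets borel" "S1 \<in> sets borel" "S1 \<subseteq> S"
  shows "AE p in \<nu>. dens S1 p \<le> dens S p"
  using dens_disjoint_le[of S S1 "{}"] assms by (auto elim!: eventually_mono) (meson dens_nonneg order_trans le_add_same_cancel1)

lemma inner_compact:
  assumes "S \<in> sets borel" "e > 0"
  obtains K where "compact K" "K \<subseteq> S" "measure M (S - K) < e"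
proof -
  have "emeasure M S = (SUP K \<in> {K. K \<subseteq> S \<and> compact K}. emeasure M K)"
    by (rule inner_regular) (use assms sets_M total space_M in auto)
  moreover have "emeasure M S < (emeasure M S) + ennreal e"
    using assms by (simp add: emeasure_eq_measure ennreal_plus[symmetric] ennreal_less_iff del: ennreal_plus)
  ultimately have "\<exists>K\<in>{K. K \<subseteq> S \<and> compact K}. emeasure M S < emeasure M K + ennreal e"
  proof -
    have "\<exists>x\<in>emeasure M ` {K. K \<subseteq> S \<and> compact K}. emeasure M S < x + ennreal e"
    proof (rule ccontr)
      assume "\<not> ?thesis"
      then have le: "emeasure M K + ennreal e \<le> emeasure M S" if "K \<subseteq> S" "compact K" for K
        using that by (auto simp: not_less)
      have "emeasure M K \<le> ennreal (measure M S - e)" if "K \<subseteq> S" "compact K" for K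
      proof -
        have "measure M K + e \<le> measure M S"
          using le[OF that] assms by (simp add: emeasure_eq_measure ennreal_plus[symmetric] del: ennreal_plus)
        then show ?thesis by (simp add: emeasure_eq_measure ennreal_leI)
      qed
      then have "emeasure M S \<le> ennreal (measure M S - e)"
        unfolding \<open>emeasure M S = _\<close> by (auto intro!: SUP_least)
      moreover have "e \<le> measure M S"
        using le[of "{}"] assms by (simp add: emeasure_eq_measure)
      ultimately show False using assms by (simp add: emeasure_eq_measure)
    qed
    then show ?thesis by auto
  qed
  then obtain K where K: "K \<subseteq> S" "compact K" "emeasure M S < emeasure M K + ennreal e" by auto
  then have Kb: "K \<in> sets borel" by (simp add: compact_imp_closed)
  have "measure M S < measure M K + e"
    using K assms by (simp add: emeasure_eq_measure ennreal_plus[symmetric] ennreal_less_iff del: ennreal_plus)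
  moreover have "measure M (S - K) = measure M S - measure M K"
    using K Kb assms by (intro finite_measure_Diff) (auto simp: sets_M)
  ultimately show thesis using that K by force
qed


section \<open>Sets that shrink along the fibres\<close>

lemma compact_borel: "compact K \<Longrightarrow> K \<in> sets borel" for K :: "'c::t2_space set"
  by (simp add: compact_imp_closed)

lemma compact_image_\<pi>: "compact K \<Longrightarrow> compact (\<pi> ` K)"
  using cont by (blast intro: compact_continuous_image continuous_on_subset)

lemma compact_family_separated:
  fixes K :: "'i \<Rightarrow> 'c::metric_space set"
  assumes "finite I" and K: "\<And>i. i \<in> I \<Longrightarrow> compact (K i)"
    and disj: "\<And>i j. i \<in> I \<Longrightarrow> j \<in> I \<Longrightarrow> i \<noteq> j \<Longrightarrow> K i \<inter> K j = {}"
  shows "\<exists>\<eta>>0. \<forall>i\<in>I. \<forall>j\<in>I. \<forall>x\<in>K i. \<forall>y\<in>K j. dist x y < \<eta> \<longrightarrow> i = j"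
proof -
  define Z where "Z = (\<Union>(i, j) \<in> {(i, j). i \<in> I \<and> j \<in> I \<and> i \<noteq> j}. K i \<times> K j)"
  have "finite {(i, j). i \<in> I \<and> j \<in> I \<and> i \<noteq> j}"
    by (rule finite_subset[of _ "I \<times> I"]) (use assms(1) in auto)
  then have Z: "compact Z" unfolding Z_def by (rule compact_UN) (auto intro: compact_Times K)
  have pos: "0 < dist (fst z) (snd z)" if "z \<in> Z" for z
    using that disj by (fastforce simp: Z_def)
  show ?thesis
  proof (cases "Z = {}")
    case True
    then show ?thesis by (intro exI[of _ 1]) (auto simp: Z_def)
  next
    case False
    have "continuous_on Z (\<lambda>z. dist (fst z) (snd z))" by (intro continuous_intros)
    then obtain z where z: "z \<in> Z" "\<And>y. y \<in> Z \<Longrightarrow> dist (fst z) (snd z) \<le> dist (fst y) (snd y)"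
      using continuous_attains_inf[OF Z False] by blast
    have "i = j" if "i \<in> I" "j \<in> I" "x \<in> K i" "y \<in> K j" "dist x y < dist (fst z) (snd z)" for i j x y
    proof (rule ccontr)
      assume "i \<noteq> j"
      then have "(x, y) \<in> Z" using that by (auto simp: Z_def)
      then show False using z(2)[of "(x, y)"] that by simp
    qed
    then show ?thesis using pos[OF z(1)] by blast
  qed
qed

text \<open>The cells of level \<open>n\<close> are the atoms of the partition generated by the first \<open>n\<close> members of a
sequence of open sets. They are finitely many at each level and refine each other; if the sequence
is a base of the topology, distinct points end up in distinct cells. Their shapes do not matter.\<close>

definition cell :: "nat \<Rightarrow> (nat \<Rightarrow> 'a set) \<Rightarrow> nat set \<Rightarrow> 'a set"
  where "cell n B A = {w. \<forall>i<n. w \<in> B i \<longleftrightarrow> i \<in> A}"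

definition code :: "nat \<Rightarrow> (nat \<Rightarrow> 'a set) \<Rightarrow> 'a \<Rightarrow> nat set"
  where "code n B w = {i. i < n \<and> w \<in> B i}"

lemma code_in: "code n B w \<in> Pow {..<n}" by (auto simp: code_def)

lemma in_cell_code: "w \<in> cell n B (code n B w)" by (simp add: cell_def code_def)

lemma in_cell_iff: "A \<in> Pow {..<n} \<Longrightarrow> w \<in> cell n B A \<longleftrightarrow> A = code n B w"
  by (auto simp: cell_def code_def)

lemma cell_borel:
  assumes B: "\<And>i. open (B i)" shows "cell n B A \<in> sets borel"
proof -
  define S where "S i = (if i \<in> A then B i else - B i)" for i
  have "S i \<in> sets borel" for i using B by (auto simp: S_def intro!: borel_comp)
  then have "(\<Inter>i\<in>{..<n}. S i) \<in> sets borel" if "n > 0"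
    using that by (intro sets.finite_INT) auto
  moreover have "cell n B A = (\<Inter>i\<in>{..<n}. S i)"
    by (auto simp: cell_def S_def split: if_splits)
  ultimately show ?thesis by (cases "n = 0") auto
qed

text \<open>As \<open>n\<close> grows this decreases to the mass of the atom at \<open>w\<close> of the conditional measure on the fibre
of \<open>w\<close>.\<close>

definition cell_mass :: "nat \<Rightarrow> (nat \<Rightarrow> 'a set) \<Rightarrow> 'a \<Rightarrow> real"
  where "cell_mass n B w = dens (cell n B (code n B w)) (\<pi> w)"

lemma cell_mass_measurable:
  assumes B: "\<And>i. open (B i)" shows "cell_mass n B \<in> borel_measurable borel"
proof -
  note cell_borel[OF B, measurable]
  have "cell_mass n B = (\<lambda>w. \<Sum>A\<in>Pow {..<n}. dens (cell n B A) (\<pi> w) * indicator (cell n B A) w)"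
  proof
    fix w
    have "(\<Sum>A\<in>Pow {..<n}. dens (cell n B A) (\<pi> w) * indicator (cell n B A) w)
        = (\<Sum>A\<in>Pow {..<n}. if A = code n B w then dens (cell n B A) (\<pi> w) else 0)"
      by (rule sum.cong) (auto simp: in_cell_iff indicator_def)
    also have "\<dots> = cell_mass n B w"
      using code_in[of n B w] by (subst sum.delta) (auto simp: cell_mass_def)
    finally show "cell_mass n B w = (\<Sum>A\<in>Pow {..<n}. dens (cell n B A) (\<pi> w) * indicator (cell n B A) w)"
      by simp
  qed
  moreover have "\<dots> \<in> borel_measurable borel" by measurable
  ultimately show ?thesis by simp
qed

text \<open>Up to mass \<open>c/2\<close> the cells of level \<open>n\<close> can be replaced by disjoint compact sets, which lie at a
positive distance \<open>\<eta>\<close> from each other. A set \<open>C j\<close> of fibre diameter below \<open>\<eta>\<close> meets each fibre in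
a single one of them, so the projections \<open>E A\<close> of its pieces are disjoint. The part of \<open>C j\<close> where
the cell has conditional mass below \<open>c/4\<close> then has mass at most \<open>c/4\<close>, however many cells there
are.\<close>

lemma measure_cell_mass_ge:
  assumes B: "\<And>i. open (B i)"
    and C: "\<And>j. compact (C j)" "\<And>j. c \<le> measure M (C j)" and c: "c > 0"
    and diam: "\<And>e. e > 0 \<Longrightarrow> \<exists>j. \<forall>x\<in>C j. \<forall>y\<in>C j. \<pi> x = \<pi> y \<longrightarrow> dist x y < e"
  shows "c / 4 \<le> measure M {w. c / 4 \<le> cell_mass n B w}"
proof -
  define I where "I = Pow {..<n}"
  have I: "finite I" by (simp add: I_def)
  note cell_borel[OF B, measurable] cell_mass_measurable[OF B, measurable]
  \<comment> \<open>Chosen so that the masses lost from all cells together are at most \<open>c / 2\<close>.\<close>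
  define e where "e = c / (2 * real (card I))"
  have I0: "card I > 0" using I by (auto simp: card_gt_0_iff I_def)
  then have e: "e > 0" using c by (simp add: e_def)
  have "\<exists>K. compact K \<and> K \<subseteq> cell n B A \<and> measure M (cell n B A - K) < e" for A
    by (rule inner_compact[OF cell_borel[OF B] e]) (intro exI conjI)
  then obtain K where K: "\<And>A. compact (K A)" "\<And>A. K A \<subseteq> cell n B A"
    "\<And>A. measure M (cell n B A - K A) < e" by metis
  note compact_borel[OF K(1), measurable] compact_borel[OF C(1), measurable]
  define KK where "KK = (\<Union>A\<in>I. K A)"
  have [measurable]: "KK \<in> sets borel" unfolding KK_def using I by (intro sets.finite_UN) auto
  have "measure M (- KK) \<le> measure M (\<Union>A\<in>I. cell n B A - K A)"
  proof (rule finite_measure_mono)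
    show "- KK \<subseteq> (\<Union>A\<in>I. cell n B A - K A)"
    proof
      fix w assume "w \<in> - KK"
      moreover have "code n B w \<in> I" unfolding I_def by (rule code_in)
      ultimately show "w \<in> (\<Union>A\<in>I. cell n B A - K A)"
        by (intro UN_I[of "code n B w"]) (auto simp: KK_def in_cell_code)
    qed
    show "(\<Union>A\<in>I. cell n B A - K A) \<in> sets M"
      using I by (intro sets.finite_UN) (auto simp: sets_M)
  qed
  also have "\<dots> \<le> (\<Sum>A\<in>I. measure M (cell n B A - K A))"
    using I by (intro finite_measure_subadditive_finite) (auto simp: sets_M)
  also have "\<dots> \<le> (\<Sum>A\<in>I. e)" by (rule sum_mono) (rule less_imp_le, rule K(3))
  also have "\<dots> = c / 2" using I0 by (simp add: e_def)
  finally have small: "measure M (- KK) \<le> c / 2" .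
  have "K A \<inter> K A' = {}" if "A \<in> I" "A' \<in> I" "A \<noteq> A'" for A A'
  proof -
    have "cell n B A \<inter> cell n B A' = {}" using that by (auto simp: in_cell_iff I_def)
    then show ?thesis using K by blast
  qed
  then have "\<exists>\<eta>>0. \<forall>A\<in>I. \<forall>A'\<in>I. \<forall>x\<in>K A. \<forall>y\<in>K A'. dist x y < \<eta> \<longrightarrow> A = A'"
    by (intro compact_family_separated I K)
  then obtain \<eta> where \<eta>: "\<eta> > 0"
    "\<And>A A' x y. A \<in> I \<Longrightarrow> A' \<in> I \<Longrightarrow> x \<in> K A \<Longrightarrow> y \<in> K A' \<Longrightarrow> dist x y < \<eta> \<Longrightarrow> A = A'"
    by blast
  obtain j where j: "\<And>x y. x \<in> C j \<Longrightarrow> y \<in> C j \<Longrightarrow> \<pi> x = \<pi> y \<Longrightarrow> dist x y < \<eta>"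
    using diam[OF \<eta>(1)] by blast
  define C' where "C' = C j \<inter> KK"
  have [measurable]: "C' \<in> sets borel" by (simp add: C'_def)
  have "measure M (C j) \<le> measure M (C' \<union> - KK)"
    by (rule finite_measure_mono) (auto simp: C'_def sets_M)
  also have "\<dots> \<le> measure M C' + measure M (- KK)"
    by (rule measure_Un_le) (auto simp: sets_M)
  finally have C': "c / 2 \<le> measure M C'" using C(2)[of j] small by linarith
  define E where "E A = \<pi> ` (C j \<inter> K A)" for A
  have E [measurable]: "E A \<in> sets borel" for A
    unfolding E_def by (intro compact_borel compact_image_\<pi> compact_Int C K)
  have E_disj: "E A \<inter> E A' = {}" if "A \<in> I" "A' \<in> I" "A \<noteq> A'" for A A'
    using \<eta>(2)[OF that(1,2)] j that(3) by (fastforce simp: E_def)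
  define F where "F A = {p \<in> E A. dens (cell n B A) p < c / 4}" for A
  have F [measurable]: "F A \<in> sets borel" for A unfolding F_def by measurable
  have F_disj: "disjoint_family_on F I"
    using E_disj unfolding disjoint_family_on_def F_def by blast
  have F_le: "emeasure M (cell n B A \<inter> \<pi> -` F A) \<le> ennreal (c / 4) * emeasure \<nu> (F A)" for A
  proof -
    have "emeasure M (cell n B A \<inter> \<pi> -` F A) = (\<integral>\<^sup>+p. ennreal (dens (cell n B A) p) * indicator (F A) p \<partial>\<nu>)"
      by (rule emeasure_dens) auto
    also have "\<dots> \<le> (\<integral>\<^sup>+p. ennreal (c / 4) * indicator (F A) p \<partial>\<nu>)"
      by (rule nn_integral_mono) (auto simp: F_def indicator_def intro!: ennreal_leI)
    also have "\<dots> = ennreal (c / 4) * emeasure \<nu> (F A)"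
      by (rule nn_integral_cmult_indicator) (simp add: sets_\<nu>)
    finally show ?thesis .
  qed
  have "emeasure M (C' \<inter> {w. cell_mass n B w < c / 4}) \<le> emeasure M (\<Union>A\<in>I. cell n B A \<inter> \<pi> -` F A)"
  proof (rule emeasure_mono)
    show "C' \<inter> {w. cell_mass n B w < c / 4} \<subseteq> (\<Union>A\<in>I. cell n B A \<inter> \<pi> -` F A)"
    proof
      fix w assume w: "w \<in> C' \<inter> {w. cell_mass n B w < c / 4}"
      then obtain A where A: "A \<in> I" "w \<in> K A" "w \<in> C j" by (auto simp: C'_def KK_def)
      then have "w \<in> cell n B A" using K by blast
      moreover have "A = code n B w" using calculation A by (simp add: in_cell_iff I_def)
      ultimately have "w \<in> cell n B A \<inter> \<pi> -` F A"
        using w A by (auto simp: F_def E_def cell_mass_def)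
      then show "w \<in> (\<Union>A\<in>I. cell n B A \<inter> \<pi> -` F A)" using A by blast
    qed
    show "(\<Union>A\<in>I. cell n B A \<inter> \<pi> -` F A) \<in> sets M"
      using I by (intro sets.finite_UN) (auto simp: sets_M)
  qed
  also have "\<dots> \<le> (\<Sum>A\<in>I. emeasure M (cell n B A \<inter> \<pi> -` F A))"
    using I by (intro emeasure_subadditive_finite) (auto simp: sets_M)
  also have "\<dots> \<le> (\<Sum>A\<in>I. ennreal (c / 4) * emeasure \<nu> (F A))" by (intro sum_mono F_le)
  also have "\<dots> = ennreal (c / 4) * (\<Sum>A\<in>I. emeasure \<nu> (F A))" by (simp add: sum_distrib_left)
  also have "(\<Sum>A\<in>I. emeasure \<nu> (F A)) = emeasure \<nu> (\<Union>A\<in>I. F A)"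
    by (rule sum_emeasure) (use I F_disj in \<open>auto simp: sets_\<nu>\<close>)
  also have "\<dots> \<le> emeasure \<nu> UNIV" by (rule emeasure_mono) (auto simp: sets_\<nu>)
  also have "\<dots> = 1" by (simp add: emeasure_\<nu> total)
  finally have "emeasure M (C' \<inter> {w. cell_mass n B w < c / 4}) \<le> ennreal (c / 4)"
    by (simp add: mult_left_mono)
  then have bad: "measure M (C' \<inter> {w. cell_mass n B w < c / 4}) \<le> c / 4"
    using c by (simp add: emeasure_eq_measure)
  have "measure M C' \<le> measure M ((C' \<inter> {w. cell_mass n B w < c / 4}) \<union> {w. c / 4 \<le> cell_mass n B w})"
    by (rule finite_measure_mono) (auto simp: sets_M)
  also have "\<dots> \<le> measure M (C' \<inter> {w. cell_mass n B w < c / 4}) + measure M {w. c / 4 \<le> cell_mass n B w}"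
    by (rule measure_Un_le) (auto simp: sets_M)
  finally show ?thesis using bad C' by linarith
qed

end

context fibred_measure
begin

lemma positive_compact_subset:
  assumes "S \<in> sets borel" "measure M S > 0"
  obtains K where "compact K" "K \<subseteq> S" "measure M K > 0"
proof -
  obtain K where K: "compact K" "K \<subseteq> S" "measure M (S - K) < measure M S"
    using inner_compact[OF assms] by blast
  have "measure M (S - K) = measure M S - measure M K"
    using K assms by (intro finite_measure_Diff) (auto simp: sets_M compact_borel)
  then show thesis using that K by simp
qed

lemma cell_refine: "w \<in> cell n B A \<Longrightarrow> n \<le> m \<Longrightarrow> cell m B (code m B w) \<subseteq> cell n B A"
  by (auto simp: cell_def code_def)

lemma AE_null_setE:
  assumes "AE p in \<nu>. P p" shows "\<exists>N\<in>null_sets \<nu>. \<forall>p. p \<notin> N \<longrightarrow> P p"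
  using assms unfolding eventually_ae_filter by (auto simp: space_\<nu>)

text \<open>By \<open>measure_cell_mass_ge\<close> the limit of the cell masses, the atom mass \<open>a\<close>, is at least \<open>c/4\<close> on a set of
mass \<open>c/4\<close>. Choose \<open>v\<close> with \<open>v < a < 2 v\<close> and a level at which the cell mass is still below \<open>2 v\<close>: two
points of one fibre in this cell would each have atom mass above \<open>v\<close>, more than the cell can hold.
Countably many such choices cover the set, so one of them gives a piece of positive measure on which
\<open>\<pi>\<close> is injective.\<close>

theorem exists_compact_section:
  assumes C: "\<And>j. compact (C j)" "\<And>j. c \<le> measure M (C j)" and c: "c > 0"
    and diam: "\<And>e. e > 0 \<Longrightarrow> \<exists>j. \<forall>x\<in>C j. \<forall>y\<in>C j. \<pi> x = \<pi> y \<longrightarrow> dist x y < e"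
  obtains D where "compact D" "inj_on \<pi> D" "measure M D > 0"
proof -
  obtain \<B> :: "'a set set" where \<B>: "countable \<B>" "topological_basis \<B>"
    using ex_countable_basis by blast
  have "\<B> \<noteq> {}" using topological_basisE[OF \<B>(2) open_UNIV, of undefined] by auto
  define B where "B = from_nat_into \<B>"
  have rB: "range B = \<B>" unfolding B_def using \<B> \<open>\<B> \<noteq> {}\<close> by (simp add: range_from_nat_into)
  have B: "open (B i)" for i using rB \<B>(2) topological_basis_open by blast
  note cell_borel[OF B, measurable] cell_mass_measurable[OF B, measurable]
  have separate: "\<exists>i. x \<in> B i \<and> y \<notin> B i" if "x \<noteq> y" for x y
  proof -
    have "open (- {y})" "x \<in> - {y}" using that by auto
    then obtain V where "V \<in> \<B>" "x \<in> V" "V \<subseteq> - {y}"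
      by (rule topological_basisE[OF \<B>(2)])
    then show ?thesis using rB by blast
  qed
  have "AE p in \<nu>. \<forall>n m. \<forall>A\<in>Pow {..<n}. \<forall>A1\<in>Pow {..<m}. \<forall>A2\<in>Pow {..<m}.
     A1 \<noteq> A2 \<longrightarrow> cell m B A1 \<subseteq> cell n B A \<longrightarrow> cell m B A2 \<subseteq> cell n B A \<longrightarrow>
     dens (cell m B A1) p + dens (cell m B A2) p \<le> dens (cell n B A) p"
  proof (intro AE_all_countable[THEN iffD2] allI AE_finite_allI finite_Pow_iff[THEN iffD2] finite_lessThan)
    fix n m A A1 A2 assume *: "A \<in> Pow {..<n::nat}" "A1 \<in> Pow {..<m::nat}" "A2 \<in> Pow {..<m}"
    show "AE p in \<nu>. A1 \<noteq> A2 \<longrightarrow> cell m B A1 \<subseteq> cell n B A \<longrightarrow> cell m B A2 \<subseteq> cell n B A \<longrightarrow>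
     dens (cell m B A1) p + dens (cell m B A2) p \<le> dens (cell n B A) p"
    proof (cases "A1 \<noteq> A2 \<and> cell m B A1 \<subseteq> cell n B A \<and> cell m B A2 \<subseteq> cell n B A")
      case True
      have "cell m B A1 \<inter> cell m B A2 = {}" using * True by (auto simp: in_cell_iff)
      then have "AE p in \<nu>. dens (cell m B A1) p + dens (cell m B A2) p \<le> dens (cell n B A) p"
        using True by (intro dens_disjoint_le) auto
      then show ?thesis by eventually_elim simp
    qed auto
  qed
  moreover have "AE p in \<nu>. \<forall>n m. \<forall>A\<in>Pow {..<n}. \<forall>A1\<in>Pow {..<m}. cell m B A1 \<subseteq> cell n B A \<longrightarrow>
     dens (cell m B A1) p \<le> dens (cell n B A) p"
  proof (intro AE_all_countable[THEN iffD2] allI AE_finite_allI finite_Pow_iff[THEN iffD2] finite_lessThan)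
    fix n m A A1 assume "A \<in> Pow {..<n::nat}" "A1 \<in> Pow {..<m::nat}"
    show "AE p in \<nu>. cell m B A1 \<subseteq> cell n B A \<longrightarrow> dens (cell m B A1) p \<le> dens (cell n B A) p"
    proof (cases "cell m B A1 \<subseteq> cell n B A")
      case True
      then have "AE p in \<nu>. dens (cell m B A1) p \<le> dens (cell n B A) p" by (intro dens_mono) auto
      then show ?thesis by eventually_elim simp
    qed auto
  qed
  ultimately have "AE p in \<nu>. (\<forall>n m. \<forall>A\<in>Pow {..<n}. \<forall>A1\<in>Pow {..<m}. \<forall>A2\<in>Pow {..<m}.
     A1 \<noteq> A2 \<longrightarrow> cell m B A1 \<subseteq> cell n B A \<longrightarrow> cell m B A2 \<subseteq> cell n B A \<longrightarrow>
     dens (cell m B A1) p + dens (cell m B A2) p \<le> dens (cell n B A) p) \<and>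
     (\<forall>n m. \<forall>A\<in>Pow {..<n}. \<forall>A1\<in>Pow {..<m}. cell m B A1 \<subseteq> cell n B A \<longrightarrow>
     dens (cell m B A1) p \<le> dens (cell n B A) p)" by (rule AE_conjI)
  from AE_null_setE[OF this] obtain N where N: "N \<in> null_sets \<nu>"
    and good: "\<And>p. p \<notin> N \<Longrightarrow> (\<forall>n m. \<forall>A\<in>Pow {..<n}. \<forall>A1\<in>Pow {..<m}. \<forall>A2\<in>Pow {..<m}.
     A1 \<noteq> A2 \<longrightarrow> cell m B A1 \<subseteq> cell n B A \<longrightarrow> cell m B A2 \<subseteq> cell n B A \<longrightarrow>
     dens (cell m B A1) p + dens (cell m B A2) p \<le> dens (cell n B A) p) \<and>
     (\<forall>n m. \<forall>A\<in>Pow {..<n}. \<forall>A1\<in>Pow {..<m}. cell m B A1 \<subseteq> cell n B A \<longrightarrow>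
     dens (cell m B A1) p \<le> dens (cell n B A) p)" by metis
  have N1: "\<And>p n m A A1 A2. p \<notin> N \<Longrightarrow> A \<in> Pow {..<n} \<Longrightarrow> A1 \<in> Pow {..<m} \<Longrightarrow> A2 \<in> Pow {..<m} \<Longrightarrow>
     A1 \<noteq> A2 \<Longrightarrow> cell m B A1 \<subseteq> cell n B A \<Longrightarrow> cell m B A2 \<subseteq> cell n B A \<Longrightarrow>
     dens (cell m B A1) p + dens (cell m B A2) p \<le> dens (cell n B A) p"
    using good by metis
  have N2: "\<And>p n m A A1. p \<notin> N \<Longrightarrow> A \<in> Pow {..<n} \<Longrightarrow> A1 \<in> Pow {..<m} \<Longrightarrow> cell m B A1 \<subseteq> cell n B A \<Longrightarrow>
     dens (cell m B A1) p \<le> dens (cell n B A) p"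
    using good by metis
  have [measurable]: "N \<in> sets borel" using N sets_\<nu> by blast
  define P where "P = \<pi> -` (- N)"
  have [measurable]: "P \<in> sets borel" unfolding P_def by (intro vimage_\<pi> borel_comp) measurable
  have P_full: "measure M (- P) = 0"
  proof -
    have "emeasure M (\<pi> -` N) = 0" using N emeasure_\<nu>[of N] by (auto simp: null_sets_def)
    moreover have "- P = \<pi> -` N" by (auto simp: P_def)
    ultimately show ?thesis by (simp add: measure_def)
  qed
  let ?d = "\<lambda>n w. cell_mass n B w"
  have mono: "?d m w \<le> ?d n w" if "w \<in> P" "n \<le> m" for w n m
    unfolding cell_mass_def
    by (rule N2[OF _ code_in code_in cell_refine[OF in_cell_code that(2)]]) (use that in \<open>auto simp: P_def\<close>)
  define G where "G n = P \<inter> {w. c / 4 \<le> ?d n w}" for n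
  have [measurable]: "G n \<in> sets borel" for n unfolding G_def by measurable
  have G_ge: "c / 4 \<le> measure M (G n)" for n
  proof -
    have "c / 4 \<le> measure M {w. c / 4 \<le> ?d n w}"
      using measure_cell_mass_ge[OF B C c diam] .
    also have "\<dots> \<le> measure M (G n \<union> - P)"
      by (rule finite_measure_mono) (auto simp: G_def sets_M)
    also have "\<dots> \<le> measure M (G n) + measure M (- P)"
      by (rule measure_Un_le) (auto simp: sets_M)
    finally show ?thesis using P_full by simp
  qed
  have "decseq G"
    unfolding decseq_def G_def using mono by (auto intro: order_trans)
  moreover have "range G \<subseteq> sets M" by (auto simp: sets_M)
  ultimately have "(\<lambda>n. measure M (G n)) \<longlonglongrightarrow> measure M (\<Inter>n. G n)"
    by (intro finite_Lim_measure_decseq)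
  then have G_pos: "c / 4 \<le> measure M (\<Inter>n. G n)"
    by (rule LIMSEQ_le_const) (use G_ge in auto)
  define W where "W v n A = {w \<in> cell n B A \<inter> P. (\<forall>m\<in>{n..}. v < ?d m w) \<and> ?d n w < 2 * v}" for v n A
  have W_meas [measurable]: "W v n A \<in> sets borel" for v n A
  proof -
    have "W v n A = cell n B A \<inter> P \<inter> (\<Inter>m\<in>{n..}. {w. v < ?d m w}) \<inter> {w. ?d n w < 2 * v}"
      by (auto simp: W_def)
    moreover have "(\<Inter>m\<in>{n..}. {w. v < ?d m w}) \<in> sets borel"
      by (rule sets.countable_INT') auto
    ultimately show ?thesis by auto
  qed
  have W_inj: "inj_on \<pi> (W v n A)" if A: "A \<in> Pow {..<n}" for v n A
  proof (rule inj_onI, rule ccontr)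
    fix x y assume x: "x \<in> W v n A" and y: "y \<in> W v n A" and eq: "\<pi> x = \<pi> y" and ne: "x \<noteq> y"
    obtain i where i: "x \<in> B i" "y \<notin> B i" using separate[OF ne] by blast
    define m where "m = max n (Suc i)"
    have m: "n \<le> m" "i < m" by (auto simp: m_def)
    have "code m B x \<noteq> code m B y" using i m by (auto simp: code_def)
    moreover have "cell m B (code m B x) \<subseteq> cell n B A" "cell m B (code m B y) \<subseteq> cell n B A"
      using cell_refine[OF _ m(1)] x y by (auto simp: W_def)
    ultimately have "dens (cell m B (code m B x)) (\<pi> x) + dens (cell m B (code m B y)) (\<pi> x) \<le> dens (cell n B A) (\<pi> x)"
      using x by (intro N1[OF _ A code_in code_in]) (auto simp: W_def P_def)
    then have "?d m x + ?d m y \<le> dens (cell n B A) (\<pi> x)" by (simp add: cell_mass_def eq)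
    moreover have "A = code n B x" using x A by (simp add: W_def in_cell_iff[symmetric])
    then have "dens (cell n B A) (\<pi> x) = ?d n x" by (simp add: cell_mass_def)
    moreover have "v < ?d m x" "v < ?d m y" "?d n x < 2 * v" using x y m by (auto simp: W_def)
    ultimately show False by linarith
  qed
  have cover: "(\<Inter>n. G n) \<subseteq> (\<Union>v\<in>\<rat>. \<Union>n. \<Union>A\<in>Pow {..<n}. W v n A)"
  proof
    fix w assume w: "w \<in> (\<Inter>n. G n)"
    then have wP: "w \<in> P" and ge: "c / 4 \<le> ?d n w" for n by (auto simp: G_def)
    define a where "a = (INF n. ?d n w)"
    have bdd: "bdd_below (range (\<lambda>n. ?d n w))" by (rule bdd_belowI2[OF ge])
    have "c / 4 \<le> a" unfolding a_def by (rule cINF_greatest) (use ge in auto)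
    then have "a / 2 < a" using c by simp
    then obtain v where v: "v \<in> \<rat>" "a / 2 < v" "v < a" using Rats_dense_in_real by blast
    have "\<exists>n. ?d n w < 2 * v"
    proof (rule ccontr)
      assume "\<not> ?thesis"
      then have "2 * v \<le> a" unfolding a_def by (intro cINF_greatest) (auto simp: not_less)
      then show False using v by simp
    qed
    then obtain n where n: "?d n w < 2 * v" by blast
    have "v < ?d m w" for m using v cINF_lower[OF bdd, of m] by (simp add: a_def)
    then have "w \<in> W v n (code n B w)" using n wP in_cell_code by (simp add: W_def)
    then show "w \<in> (\<Union>v\<in>\<rat>. \<Union>n. \<Union>A\<in>Pow {..<n}. W v n A)"
      by (intro UN_I[OF v(1)] UN_I[OF UNIV_I] UN_I[OF code_in])
  qed
  have "\<exists>v n A. A \<in> Pow {..<n} \<and> measure M (W v n A) > 0"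
  proof (rule ccontr)
    assume "\<not> ?thesis"
    then have z: "W v n A \<in> null_sets M" if "A \<in> Pow {..<n}" for v n A
      using that by (auto simp: null_sets_def sets_M emeasure_eq_measure not_less intro!: antisym)
    have "(\<Union>v\<in>\<rat>. \<Union>n. \<Union>A\<in>Pow {..<n}. W v n A) \<in> null_sets M"
      by (intro null_sets_UN' null_sets_UN countable_rat z countable_finite) auto
    then have "measure M (\<Inter>n. G n) = 0"
      using cover null_sets_subset[of _ M "\<Inter>n. G n"] by (auto simp: sets_M measure_def null_sets_def)
    then show False using G_pos c by simp
  qed
  then obtain v n A where WA: "A \<in> Pow {..<n}" "measure M (W v n A) > 0" by blast
  obtain D where "compact D" "D \<subseteq> W v n A" "measure M D > 0"
    using positive_compact_subset[OF W_meas WA(2)] by blast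
  then show thesis using that W_inj[OF WA(1)] by (meson inj_on_subset)
qed

end

section \<open>Ergodicity turns one section into finitely many\<close>

locale skew_factor = fibred_measure M \<pi>
  for M :: "'a::{second_countable_topology, complete_space} measure"
    and \<pi> :: "'a \<Rightarrow> 'b::{second_countable_topology, metric_space}" +
  fixes g g' :: "'a \<Rightarrow> 'a" and A A' :: "'b \<Rightarrow> 'b"
  assumes erg: "ergodic M g"
    and g_cont: "continuous_on UNIV g" and g'_cont: "continuous_on UNIV g'"
    and A_cont: "continuous_on UNIV A" and A'_cont: "continuous_on UNIV A'"
    and gg' [simp]: "g (g' w) = w" and g'g [simp]: "g' (g w) = w"
    and AA' [simp]: "A (A' p) = p" and A'A [simp]: "A' (A p) = p"
    and \<pi>g [simp]: "\<pi> (g w) = A (\<pi> w)"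
begin

lemma \<pi>g' [simp]: "\<pi> (g' w) = A' (\<pi> w)"
  by (metis \<pi>g gg' A'A)

lemma meas [measurable]: "g \<in> borel_measurable borel" "g' \<in> borel_measurable borel"
  "A \<in> borel_measurable borel" "A' \<in> borel_measurable borel"
  by (intro borel_measurable_continuous_onI g_cont g'_cont A_cont A'_cont)+

lemma g_mp: "mp_map M g" using erg by (simp add: ergodic_def)

lemma distr_g: "distr M M g = M" and g_meas_M: "g \<in> measurable M M"
  using g_mp by (auto simp: mp_map_def)

lemma emeasure_vimage_g: "S \<in> sets borel \<Longrightarrow> emeasure M (g -` S) = emeasure M S"
  using emeasure_distr[OF g_meas_M, of S] by (simp add: distr_g sets_M space_M)

lemma image_g: "g ` S = g' -` S"
proof (intro equalityI subsetI)
  fix x assume "x \<in> g' -` S"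
  then have "x = g (g' x)" "g' x \<in> S" by auto
  then show "x \<in> g ` S" by blast
qed auto

lemma image_g_borel: "S \<in> sets borel \<Longrightarrow> g ` S \<in> sets borel"
  unfolding image_g using measurable_sets[OF meas(2)] by simp

lemma emeasure_image_g: "S \<in> sets borel \<Longrightarrow> emeasure M (g ` S) = emeasure M S"
  using emeasure_vimage_g[OF image_g_borel, of S] by (simp add: image_g vimage_def)

lemma distr_A: "distr \<nu> borel A = \<nu>"
proof (rule measure_eqI)
  fix E assume "E \<in> sets (distr \<nu> borel A)"
  then have E [measurable]: "E \<in> sets borel" by simp
  have [measurable]: "A -` E \<in> sets borel" using measurable_sets[OF meas(3) E] by simp
  have "emeasure (distr \<nu> borel A) E = emeasure \<nu> (A -` E)"
    by (subst emeasure_distr) (auto simp: space_\<nu> measurable_cong_sets[OF sets_\<nu> refl])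
  also have "\<dots> = emeasure M (g -` (\<pi> -` E))"
    by (subst emeasure_\<nu>) (auto simp: vimage_def)
  also have "\<dots> = emeasure \<nu> E" by (simp add: emeasure_vimage_g emeasure_\<nu>)
  finally show "emeasure (distr \<nu> borel A) E = emeasure \<nu> E" .
qed (simp add: sets_\<nu>)

lemma AE_g:
  assumes "AE w in M. P w" shows "AE w in M. P (g w)"
  by (rule AE_distrD[OF g_meas_M]) (subst distr_g, rule assms)

lemma AE_g_pow: "AE w in M. P w \<Longrightarrow> AE w in M. P ((g ^^ n) w)"
proof (induction n)
  case (Suc n)
  from AE_g[OF Suc.IH[OF Suc.prems]] show ?case by (simp add: funpow_swap1)
qed simp

lemma A_meas_\<nu>: "A \<in> measurable \<nu> borel"
  by (simp add: measurable_cong_sets[OF sets_\<nu> refl])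

lemma AE_A:
  assumes "AE p in \<nu>. P p" shows "AE p in \<nu>. P (A p)"
  by (rule AE_distrD[OF A_meas_\<nu>]) (subst distr_A, rule assms)

lemma AE_A_pow: "AE p in \<nu>. P p \<Longrightarrow> AE p in \<nu>. P ((A ^^ n) p)"
proof (induction n)
  case (Suc n)
  from AE_A[OF Suc.IH[OF Suc.prems]] show ?case by (simp add: funpow_swap1)
qed simp

text \<open>Ergodicity speaks of sets with \<open>g -` E = E\<close>. The set of points whose orbit eventually stays in \<open>S\<close> is of
this kind and agrees with \<open>S\<close> almost everywhere.\<close>

lemma almost_invariant_set:
  assumes S [measurable]: "S \<in> sets borel" and inv: "AE w in M. w \<in> S \<longleftrightarrow> g w \<in> S"
  shows "(AE w in M. w \<in> S) \<or> (AE w in M. w \<notin> S)"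
proof -
  define S' where "S' = {w. \<exists>N. \<forall>n. N \<le> n \<longrightarrow> (g ^^ n) w \<in> S}"
  have [measurable]: "(g ^^ n) \<in> borel_measurable borel" for n
    by (rule measurable_compose_n) measurable
  have [measurable]: "S' \<in> sets borel" unfolding S'_def by measurable
  have "AE w in M. \<forall>n. (g ^^ n) w \<in> S \<longleftrightarrow> g ((g ^^ n) w) \<in> S"
    using AE_g_pow[OF inv] by (simp add: AE_all_countable)
  then have eq: "AE w in M. w \<in> S \<longleftrightarrow> w \<in> S'"
  proof eventually_elim
    case (elim w)
    have "(g ^^ n) w \<in> S \<longleftrightarrow> w \<in> S" for n by (induction n) (use elim in auto)
    then show ?case by (auto simp: S'_def)
  qed
  have "g -` S' = S'"
  proof (intro equalityI subsetI)
    fix w assume "w \<in> g -` S'"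
    then obtain N where "\<And>n. N \<le> n \<Longrightarrow> (g ^^ Suc n) w \<in> S"
      by (auto simp: S'_def funpow_swap1)
    then have "\<forall>n. Suc N \<le> n \<longrightarrow> (g ^^ n) w \<in> S" by (metis Suc_le_D Suc_le_mono)
    then show "w \<in> S'" unfolding S'_def by blast
  next
    fix w assume "w \<in> S'"
    then obtain N where "\<And>n. N \<le> n \<Longrightarrow> (g ^^ n) w \<in> S" by (auto simp: S'_def)
    then have "\<forall>n. N \<le> n \<longrightarrow> (g ^^ n) (g w) \<in> S"
      by (metis funpow_simps_right(2) comp_apply le_SucI)
    then show "w \<in> g -` S'" unfolding S'_def by blast
  qed
  then have "emeasure M S' = 0 \<or> emeasure M (UNIV - S') = 0"
    using erg by (auto simp: ergodic_def space_M sets_M)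
  then show ?thesis
  proof
    assume "emeasure M S' = 0"
    then have "AE w in M. w \<notin> S'" by (intro AE_not_in) (auto simp: null_sets_def sets_M)
    with eq have "AE w in M. w \<notin> S" by eventually_elim simp
    then show ?thesis ..
  next
    assume "emeasure M (UNIV - S') = 0"
    then have "AE w in M. w \<notin> UNIV - S'" by (intro AE_not_in) (auto simp: null_sets_def sets_M)
    with eq have "AE w in M. w \<in> S" by eventually_elim simp
    then show ?thesis ..
  qed
qed

lemma not_AE_False: "\<not> (AE w in M. False)"
proof
  assume "AE w in M. False"
  then obtain N where "N \<in> null_sets M" "UNIV \<subseteq> N"
    unfolding eventually_ae_filter by (auto simp: space_M)
  then show False using total by (auto simp: top.extremum_unique null_sets_def)
qed

lemma almost_invariant_constant:
  fixes b :: "'a \<Rightarrow> real"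
  assumes b [measurable]: "b \<in> borel_measurable borel" and inv: "AE w in M. b (g w) = b w"
  shows "\<exists>c. AE w in M. b w = c"
proof -
  have dich: "(AE w in M. b w < t) \<or> (AE w in M. t \<le> b w)" for t
  proof -
    have "AE w in M. w \<in> {w. b w < t} \<longleftrightarrow> g w \<in> {w. b w < t}"
      using inv by eventually_elim simp
    from almost_invariant_set[OF _ this] show ?thesis by (auto simp: not_less)
  qed
  define T where "T = {t. AE w in M. t \<le> b w}"
  have "\<exists>n::nat. - real n \<in> T"
  proof (rule ccontr)
    assume "\<not> ?thesis"
    then have "AE w in M. \<forall>n::nat. b w < - real n" using dich by (auto simp: T_def AE_all_countable)
    then have "AE w in M. False"
    proof eventually_elim
      case (elim w)
      obtain n :: nat where "- b w < real n" using reals_Archimedean2 by blast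
      then show ?case using elim[rule_format, of n] by simp
    qed
    then show False using not_AE_False by simp
  qed
  then have "T \<noteq> {}" by blast
  have "\<exists>n::nat. AE w in M. b w < real n"
  proof (rule ccontr)
    assume "\<not> ?thesis"
    then have "AE w in M. \<forall>n::nat. real n \<le> b w" using dich by (auto simp: AE_all_countable)
    then have "AE w in M. False"
    proof eventually_elim
      case (elim w)
      obtain n :: nat where "b w < real n" using reals_Archimedean2 by blast
      then show ?case using elim[rule_format, of n] by simp
    qed
    then show False using not_AE_False by simp
  qed
  then obtain n :: nat where n: "AE w in M. b w < real n" by blast
  have bdd: "t \<le> real n" if "t \<in> T" for t
  proof (rule ccontr)
    assume "\<not> t \<le> real n"
    have "AE w in M. t \<le> b w" using that by (simp add: T_def)
    with n have "AE w in M. False" by eventually_elim (use \<open>\<not> t \<le> real n\<close> in linarith)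
    then show False using not_AE_False by simp
  qed
  then have bdd': "bdd_above T" by (auto simp: bdd_above_def)
  define c where "c = Sup T"
  have lo: "AE w in M. c - 1 / Suc k \<le> b w" for k
  proof -
    have "c - 1 / Suc k < Sup T" by (simp add: c_def)
    then obtain t where "t \<in> T" "c - 1 / Suc k < t" using \<open>T \<noteq> {}\<close> less_cSup_iff[OF _ bdd'] by blast
    then show ?thesis by (auto simp: T_def elim: eventually_mono)
  qed
  have hi: "AE w in M. b w < c + 1 / Suc k" for k
  proof -
    have "c + 1 / Suc k \<notin> T"
    proof
      assume "c + 1 / Suc k \<in> T"
      then have "c + 1 / Suc k \<le> c" unfolding c_def using bdd' by (rule cSup_upper)
      moreover have "0 < 1 / real (Suc k)" by simp
      ultimately show False by linarith
    qed
    then show ?thesis using dich by (auto simp: T_def)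
  qed
  have "AE w in M. \<forall>k. c - 1 / Suc k \<le> b w \<and> b w < c + 1 / Suc k"
    using lo hi by (simp add: AE_all_countable)
  then have "AE w in M. b w = c"
  proof eventually_elim
    case (elim w)
    show ?case
    proof (rule ccontr)
      assume "b w \<noteq> c"
      then obtain k where "1 / Suc k < \<bar>b w - c\<bar>" using nat_approx_posE[of "\<bar>b w - c\<bar>"] by auto
      then show False using elim[rule_format, of k] by (auto simp: abs_if split: if_splits)
    qed
  qed
  then show ?thesis ..
qed

end

lemma suminf_indicator_card:
  fixes c :: ennreal and K :: "nat set"
  assumes "(\<Sum>i. c * indicator K i) = 1"
  shows "finite K" "of_nat (card K) * c = 1"
proof -
  have 1: "c * emeasure (count_space UNIV) K = 1"
  proof -
    have "(\<Sum>i. c * indicator K i) = (\<integral>\<^sup>+i. c * indicator K i \<partial>count_space UNIV)"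
      by (rule nn_integral_count_space_nat[symmetric])
    also have "\<dots> = c * emeasure (count_space UNIV) K"
      by (rule nn_integral_cmult_indicator) simp
    finally show ?thesis using assms by simp
  qed
  show "finite K"
  proof (rule ccontr)
    assume "infinite K"
    then have "c * \<infinity> = (1 :: ennreal)" using 1 by simp
    then show False by (cases "c = 0") (auto simp: ennreal_mult_top)
  qed
  then show "of_nat (card K) * c = 1" using 1 by (simp add: mult.commute)
qed

lemma continuous_on_funpow:
  fixes f :: "'c::topological_space \<Rightarrow> 'c"
  assumes "continuous_on UNIV f" shows "continuous_on UNIV (f ^^ n)"
proof (induction n)
  case 0
  show ?case using continuous_on_id by (simp add: id_def)
next
  case (Suc n)
  have "continuous_on UNIV (\<lambda>x. f ((f ^^ n) x))"
    by (rule continuous_on_compose2[OF assms Suc]) simp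
  then show ?case by (simp add: comp_def)
qed

context fibred_measure
begin

text \<open>Projections of Borel sets need not be Borel. Over a compact section the projection has a continuous
inverse, and all sets projected below lie in countably many such sections.\<close>

lemma image_borel_of_compact_section:
  assumes D: "compact D" "inj_on \<pi> D" and W: "W \<in> sets borel" "W \<subseteq> D"
  shows "\<pi> ` W \<in> sets borel"
proof -
  define s where "s = inv_into D \<pi>"
  have sD: "s (\<pi> x) = x" if "x \<in> D" for x using D that by (simp add: s_def inv_into_f_f)
  have "continuous_on (\<pi> ` D) s"
    by (rule continuous_on_inv[OF _ D(1)]) (use cont sD in \<open>auto intro: continuous_on_subset\<close>)
  moreover have Db: "\<pi> ` D \<in> sets borel" by (intro compact_borel compact_image_\<pi> D)
  ultimately have "s -` W \<inter> \<pi> ` D \<in> sets (restrict_space borel (\<pi> ` D))"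
    using measurable_sets[OF borel_measurable_continuous_on_restrict W(1)] by (simp add: space_restrict_space)
  then have "s -` W \<inter> \<pi> ` D \<in> sets borel"
    using Db by (simp add: sets_restrict_space_iff)
  moreover have "s -` W \<inter> \<pi> ` D = \<pi> ` W"
  proof (intro equalityI subsetI)
    fix p assume "p \<in> s -` W \<inter> \<pi> ` D"
    then obtain x where "x \<in> D" "p = \<pi> x" "s p \<in> W" by auto
    then show "p \<in> \<pi> ` W" using sD[of x] by auto
  next
    fix p assume "p \<in> \<pi> ` W"
    then obtain x where "x \<in> W" "p = \<pi> x" by blast
    then show "p \<in> s -` W \<inter> \<pi> ` D" using sD[of x] W by auto
  qed
  ultimately show ?thesis by simp
qed

end

context skew_factor
begin

lemma \<nu>_pull: "E \<in> sets borel \<Longrightarrow> f \<in> borel_measurable borel \<Longrightarrow>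
  (\<integral>\<^sup>+p. ennreal (f p) * indicator (A' -` E) p \<partial>\<nu>) = (\<integral>\<^sup>+p. ennreal (f (A p)) * indicator E p \<partial>\<nu>)"
proof -
  assume [measurable]: "E \<in> sets borel" "f \<in> borel_measurable borel"
  have [measurable]: "A' -` E \<in> sets borel" using measurable_sets[OF meas(4)] by simp
  have "(\<integral>\<^sup>+p. ennreal (f p) * indicator (A' -` E) p \<partial>\<nu>)
      = (\<integral>\<^sup>+p. ennreal (f p) * indicator (A' -` E) p \<partial>(distr \<nu> borel A))" by (simp add: distr_A)
  also have "\<dots> = (\<integral>\<^sup>+p. ennreal (f (A p)) * indicator (A' -` E) (A p) \<partial>\<nu>)"
    by (rule nn_integral_distr[OF A_meas_\<nu>]) measurable
  also have "\<dots> = (\<integral>\<^sup>+p. ennreal (f (A p)) * indicator E p \<partial>\<nu>)"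
    by (rule nn_integral_cong) (auto simp: indicator_def)
  finally show ?thesis .
qed

text \<open>Over sections, \<open>g\<close> carries the part of \<open>S\<close> that it maps into \<open>S'\<close> bijectively and measure-preservingly onto a part of \<open>S'\<close>,
and the base map preserves \<open>\<nu>\<close>. Both densities therefore integrate to the same values over the projection of that part.\<close>

lemma dens_equivariant:
  assumes S [measurable]: "S \<in> sets borel" "S' \<in> sets borel" and inj: "inj_on \<pi> S" "inj_on \<pi> S'"
    and D: "\<pi> ` (S \<inter> g -` S') \<in> sets borel"
  shows "AE w in M. w \<in> S \<longrightarrow> g w \<in> S' \<longrightarrow> dens S (\<pi> w) = dens S' (A (\<pi> w))"
proof -
  define W where "W = S \<inter> g -` S'"
  have Wm [measurable]: "W \<in> sets borel" unfolding W_def using measurable_sets[OF meas(1) S(2)] by simp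
  have "AE p in \<nu>. p \<in> \<pi> ` W \<longrightarrow> dens S p = dens S' (A p)"
  proof (rule dens_unique[OF S(1)])
    show "\<pi> ` W \<in> sets borel" using D by (simp add: W_def)
    show "(\<lambda>p. dens S' (A p)) \<in> borel_measurable borel" by measurable
    fix E :: "'b set" assume E [measurable]: "E \<in> sets borel" and sub: "E \<subseteq> \<pi> ` W"
    have A'E [measurable]: "A' -` E \<in> sets borel" using measurable_sets[OF meas(4) E] by simp
    have "S \<inter> \<pi> -` E = W \<inter> \<pi> -` E"
    proof (intro equalityI subsetI)
      fix x assume x: "x \<in> S \<inter> \<pi> -` E"
      then obtain w where w: "w \<in> W" "\<pi> w = \<pi> x" using sub by force
      then have "w = x" using inj(1) x by (auto simp: W_def inj_on_def)
      then show "x \<in> W \<inter> \<pi> -` E" using w x by simp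
    qed (auto simp: W_def)
    then have "emeasure M (S \<inter> \<pi> -` E) = emeasure M (g ` (W \<inter> \<pi> -` E))"
      by (simp add: emeasure_image_g)
    also have "g ` (W \<inter> \<pi> -` E) = S' \<inter> \<pi> -` (A' -` E)"
    proof (intro equalityI subsetI)
      fix x assume x: "x \<in> S' \<inter> \<pi> -` (A' -` E)"
      then obtain w where w: "w \<in> W" "\<pi> w = A' (\<pi> x)" using sub by force
      then have "\<pi> (g w) = \<pi> x" by simp
      then have "g w = x" using inj(2) x w by (auto simp: W_def inj_on_def)
      moreover have "w \<in> \<pi> -` E" using w x by simp
      ultimately show "x \<in> g ` (W \<inter> \<pi> -` E)" using w by blast
    qed (auto simp: W_def)
    also have "emeasure M (S' \<inter> \<pi> -` (A' -` E)) = (\<integral>\<^sup>+p. ennreal (dens S' p) * indicator (A' -` E) p \<partial>\<nu>)"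
      by (rule emeasure_dens) auto
    also have "\<dots> = (\<integral>\<^sup>+p. ennreal (dens S' (A p)) * indicator E p \<partial>\<nu>)"
      by (rule \<nu>_pull) auto
    finally show "emeasure M (S \<inter> \<pi> -` E) = \<dots>" .
  qed auto
  then show ?thesis by (rule AE_\<nu>_D[THEN eventually_mono]) (auto simp: W_def)
qed

text \<open>The images of \<open>D\<close> under the powers of \<open>g\<close> and its inverse cover almost everything; disjointifying them gives sections
\<open>P i\<close>. The function \<open>b\<close>, whose value on \<open>P i\<close> is the conditional mass of \<open>P i\<close>, is invariant by
\<open>dens_equivariant\<close>, hence a constant \<open>c\<close>. So almost every fibre carries atoms of mass \<open>c\<close> only, and
there are \<open>k = 1/c\<close> of them. Since null subsets of their union \<open>X0\<close> have null projections, exceptional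
points can be discarded fibre by fibre, which makes \<open>X\<close> forward invariant with exactly \<open>k\<close>
points over each point of \<open>T\<close>.\<close>

theorem finite_sections:
  assumes D: "compact D" "inj_on \<pi> D" "measure M D > 0"
  obtains k X T S where "k \<ge> (1::nat)" "X \<in> sets borel" "T \<in> sets borel"
    "emeasure M (- X) = 0" "emeasure \<nu> (- T) = 0"
    "\<pi> ` X \<subseteq> T" "A ` T \<subseteq> T" "g ` X \<subseteq> X" "\<And>p. p \<in> T \<Longrightarrow> card (X \<inter> \<pi> -` {p}) = k"
    "\<And>W. W \<in> sets borel \<Longrightarrow> W \<subseteq> X \<Longrightarrow> \<pi> ` W \<in> sets borel"
    "\<And>i::nat. S i \<in> sets borel" "\<And>i. inj_on \<pi> (S i)" "X = (\<Union>i. S i)" "disjoint_family S"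
    "\<And>W. W \<in> sets borel \<Longrightarrow> W \<subseteq> X \<Longrightarrow> inj_on \<pi> W \<Longrightarrow> of_nat k * emeasure M W = emeasure \<nu> (\<pi> ` W)"
proof -
  define Dn where "Dn n = (if even n then (g ^^ (n div 2)) ` D else (g' ^^ (n div 2)) ` D)" for n :: nat
  have pow_cont: "continuous_on UNIV (g ^^ n)" "continuous_on UNIV (g' ^^ n)" for n
    using continuous_on_funpow[OF g_cont] continuous_on_funpow[OF g'_cont] by auto
  have Dn_compact: "compact (Dn n)" for n
    using D(1) pow_cont unfolding Dn_def
    by (auto intro: compact_continuous_image continuous_on_subset)
  have \<pi>_pow: "\<pi> ((g ^^ n) w) = (A ^^ n) (\<pi> w)" "\<pi> ((g' ^^ n) w) = (A' ^^ n) (\<pi> w)" for n w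
    by (induction n) auto
  have "inj A" "inj A'" by (metis A'A injI, metis AA' injI)
  then have inj_pow: "inj (A ^^ n)" "inj (A' ^^ n)" for n by (simp_all add: inj_fn)
  have Dn_inj: "inj_on \<pi> (Dn n)" for n
  proof (rule inj_onI)
    fix x y assume xy: "x \<in> Dn n" "y \<in> Dn n" "\<pi> x = \<pi> y"
    show "x = y"
    proof (cases "even n")
      case True
      then obtain u v where uv: "u \<in> D" "v \<in> D" "x = (g ^^ (n div 2)) u" "y = (g ^^ (n div 2)) v"
        using xy by (auto simp: Dn_def)
      then have "\<pi> u = \<pi> v" using xy(3) injD[OF inj_pow(1)] by (simp add: \<pi>_pow)
      then show ?thesis using uv D(2) by (simp add: inj_on_eq_iff)
    next
      case False
      then obtain u v where uv: "u \<in> D" "v \<in> D" "x = (g' ^^ (n div 2)) u" "y = (g' ^^ (n div 2)) v"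
        using xy by (auto simp: Dn_def)
      then have "\<pi> u = \<pi> v" using xy(3) injD[OF inj_pow(2)] by (simp add: \<pi>_pow)
      then show ?thesis using uv D(2) by (simp add: inj_on_eq_iff)
    qed
  qed
  define Y where "Y = (\<Union>n. Dn n)"
  have Y_iff: "w \<in> Y \<longleftrightarrow> (\<exists>n. \<exists>x\<in>D. w = (g ^^ n) x \<or> w = (g' ^^ n) x)" for w
  proof
    assume "w \<in> Y"
    then show "\<exists>n. \<exists>x\<in>D. w = (g ^^ n) x \<or> w = (g' ^^ n) x"
      by (auto simp: Y_def Dn_def split: if_splits)
  next
    assume "\<exists>n. \<exists>x\<in>D. w = (g ^^ n) x \<or> w = (g' ^^ n) x"
    then obtain n x where x: "x \<in> D" "w = (g ^^ n) x \<or> w = (g' ^^ n) x" by blast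
    then have "w \<in> Dn (2 * n) \<or> w \<in> Dn (Suc (2 * n))" by (auto simp: Dn_def)
    then show "w \<in> Y" by (auto simp: Y_def)
  qed
  have Dn_borel [measurable]: "Dn n \<in> sets borel" for n by (rule compact_borel[OF Dn_compact])
  have Y_borel [measurable]: "Y \<in> sets borel" unfolding Y_def by measurable
  have "g -` Y = Y"
  proof (intro equalityI subsetI)
    fix w assume "w \<in> g -` Y"
    then obtain n x where x: "x \<in> D" "g w = (g ^^ n) x \<or> g w = (g' ^^ n) x" by (auto simp: Y_iff)
    have "w = g' (g w)" by simp
    show "w \<in> Y"
    proof (cases "g w = (g' ^^ n) x")
      case True
      then have "w = (g' ^^ Suc n) x" using \<open>w = g' (g w)\<close> by simp
      then show ?thesis using x by (auto simp: Y_iff simp del: funpow.simps)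
    next
      case False
      then have eq: "g w = (g ^^ n) x" using x by simp
      show ?thesis
      proof (cases n)
        case 0
        then have "w = (g' ^^ 1) x" using eq \<open>w = g' (g w)\<close> by simp
        then show ?thesis using x by (auto simp: Y_iff simp del: funpow.simps)
      next
        case (Suc m)
        then have "g' (g w) = g' (g ((g ^^ m) x))" using eq by simp
        then have "w = (g ^^ m) x" by simp
        then show ?thesis using x by (auto simp: Y_iff)
      qed
    qed
  next
    fix w assume "w \<in> Y"
    then obtain n x where x: "x \<in> D" "w = (g ^^ n) x \<or> w = (g' ^^ n) x" by (auto simp: Y_iff)
    show "w \<in> g -` Y"
    proof (cases "w = (g ^^ n) x")
      case True
      then have "g w = (g ^^ Suc n) x" by simp
      then show ?thesis using x by (auto simp: Y_iff simp del: funpow.simps)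
    next
      case False
      then have eq: "w = (g' ^^ n) x" using x by simp
      show ?thesis
      proof (cases n)
        case 0
        then show ?thesis using eq False by simp
      next
        case (Suc m)
        then have "g w = (g' ^^ m) x" using eq by simp
        then show ?thesis using x by (auto simp: Y_iff)
      qed
    qed
  qed
  then have "emeasure M Y = 0 \<or> emeasure M (UNIV - Y) = 0"
    using erg by (auto simp: ergodic_def space_M sets_M)
  moreover have "emeasure M Y \<noteq> 0"
  proof -
    have "Dn 0 = D" by (simp add: Dn_def)
    then have "D \<subseteq> Y" unfolding Y_def by blast
    then have "emeasure M D \<le> emeasure M Y" by (intro emeasure_mono) (auto simp: sets_M)
    then show ?thesis using D(3) by (auto simp: emeasure_eq_measure)
  qed
  ultimately have Y_full: "AE w in M. w \<in> Y"
    using AE_not_in[of "UNIV - Y" M] by (auto simp: null_sets_def sets_M)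
  \<comment> \<open>Each fibre is met at most once by each \<open>P i\<close>, and \<open>b\<close> is the atom mass at the point.\<close>
  define P where "P = disjointed Dn"
  have P_sub: "P i \<subseteq> Dn i" for i by (simp add: P_def disjointed_subset)
  have P_un: "(\<Union>i. P i) = Y" by (simp add: P_def UN_disjointed_eq Y_def)
  have P_disj: "disjoint_family P" by (simp add: P_def disjoint_family_disjointed)
  have P_uniq: "i = j" if "w \<in> P i" "w \<in> P j" for w i j
    using P_disj that unfolding disjoint_family_on_def by blast
  have P_borel [measurable]: "P i \<in> sets borel" for i
  proof -
    have "range P \<subseteq> sets borel" unfolding P_def by (rule sets.range_disjointed_sets) auto
    then show ?thesis by blast
  qed
  have P_inj: "inj_on \<pi> (P i)" for i using Dn_inj P_sub inj_on_subset by blast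
  have im_borel: "\<pi> ` W \<in> sets borel" if "W \<in> sets borel" "W \<subseteq> Y" for W
  proof -
    have "\<pi> ` W = (\<Union>i. \<pi> ` (W \<inter> Dn i))" using that unfolding Y_def by blast
    moreover have "\<pi> ` (W \<inter> Dn i) \<in> sets borel" for i
      by (rule image_borel_of_compact_section[OF Dn_compact Dn_inj]) (use that in auto)
    ultimately show ?thesis by auto
  qed
  define b where "b w = (\<Sum>i. dens (P i) (\<pi> w) * indicator (P i) w)" for w
  have b_meas [measurable]: "b \<in> borel_measurable borel"
    unfolding b_def by measurable
  have b_eq: "b w = dens (P j) (\<pi> w)" if "w \<in> P j" for w j
  proof -
    have "indicator (P i) w = (0 :: real)" if "i \<noteq> j" for i
      using P_disj \<open>w \<in> P j\<close> that by (auto simp: disjoint_family_on_def indicator_def)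
    then have "(\<lambda>i. dens (P i) (\<pi> w) * indicator (P i) w) = (\<lambda>i. if i = j then dens (P i) (\<pi> w) else 0)"
      using that by (auto simp: fun_eq_iff)
    then show ?thesis using sums_unique[OF sums_single[of j "\<lambda>i. dens (P i) (\<pi> w)"]] by (simp add: b_def)
  qed
  have "AE w in M. \<forall>i j. w \<in> P i \<longrightarrow> g w \<in> P j \<longrightarrow> dens (P i) (\<pi> w) = dens (P j) (A (\<pi> w))"
  proof (simp only: AE_all_countable, intro allI)
    fix i j
    have "P i \<inter> g -` P j \<in> sets borel" using measurable_sets[OF meas(1) P_borel] by auto
    moreover have "P i \<inter> g -` P j \<subseteq> Y" using P_un by blast
    ultimately show "AE w in M. w \<in> P i \<longrightarrow> g w \<in> P j \<longrightarrow> dens (P i) (\<pi> w) = dens (P j) (A (\<pi> w))"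
      by (intro dens_equivariant P_inj P_borel im_borel)
  qed
  with Y_full AE_g[OF Y_full] have "AE w in M. b (g w) = b w"
  proof eventually_elim
    case (elim w)
    then obtain i j where "w \<in> P i" "g w \<in> P j" using P_un by blast
    then show ?case using elim b_eq[of w i] b_eq[of "g w" j] by simp
  qed
  then obtain c where c: "AE w in M. b w = c"
    using almost_invariant_constant[OF b_meas] by blast
  have null_dens: "AE p in \<nu>. p \<in> E \<longrightarrow> dens (P i) p = 0"
    if "E \<in> sets borel" "emeasure M (P i \<inter> \<pi> -` E) = 0" for E i
  proof -
    have "AE p in \<nu>. p \<in> E \<longrightarrow> dens (P i) p = (\<lambda>_. 0) p"
    proof (rule dens_unique)
      fix F assume F: "F \<in> sets borel" "F \<subseteq> E"
      have "emeasure M (P i \<inter> \<pi> -` F) \<le> emeasure M (P i \<inter> \<pi> -` E)"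
        by (rule emeasure_mono) (use F that in \<open>auto simp: sets_M\<close>)
      then show "emeasure M (P i \<inter> \<pi> -` F) = (\<integral>\<^sup>+p. ennreal 0 * indicator F p \<partial>\<nu>)"
        using that by simp
    qed (use that in auto)
    then show ?thesis by simp
  qed
  have "AE p in \<nu>. \<forall>i. dens (P i) p \<noteq> c \<longrightarrow> dens (P i) p = 0"
  proof (simp only: AE_all_countable, intro allI)
    fix i
    define E where "E = {p. dens (P i) p \<noteq> c}"
    have E: "E \<in> sets borel" unfolding E_def by measurable
    have "AE w in M. w \<notin> P i \<inter> \<pi> -` E"
      using c by eventually_elim (use b_eq in \<open>auto simp: E_def\<close>)
    then have "emeasure M (P i \<inter> \<pi> -` E) = 0"
      using AE_iff_measurable[of "P i \<inter> \<pi> -` E" M "\<lambda>w. w \<notin> P i \<inter> \<pi> -` E"] E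
      by (auto simp: space_M sets_M)
    from null_dens[OF E this] show "AE p in \<nu>. dens (P i) p \<noteq> c \<longrightarrow> dens (P i) p = 0"
      by (simp add: E_def)
  qed
  moreover have "AE p in \<nu>. \<forall>i. p \<notin> \<pi> ` P i \<longrightarrow> dens (P i) p = 0"
  proof (simp only: AE_all_countable, intro allI)
    fix i
    have "P i \<subseteq> Y" using P_un by blast
    then have "- \<pi> ` P i \<in> sets borel" by (intro borel_comp im_borel P_borel)
    moreover have "emeasure M (P i \<inter> \<pi> -` (- \<pi> ` P i)) = 0"
    proof -
      have "P i \<inter> \<pi> -` (- \<pi> ` P i) = {}" by auto
      then show ?thesis by simp
    qed
    ultimately have "AE p in \<nu>. p \<in> - \<pi> ` P i \<longrightarrow> dens (P i) p = 0" by (rule null_dens)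
    then show "AE p in \<nu>. p \<notin> \<pi> ` P i \<longrightarrow> dens (P i) p = 0" by simp
  qed
  moreover have "AE p in \<nu>. (\<Sum>i. ennreal (dens (P i) p)) = 1"
  proof (rule \<nu>.density_unique_finite_measure)
    fix E assume "E \<in> sets \<nu>"
    then have E [measurable]: "E \<in> sets borel" by (simp add: sets_\<nu>)
    have "(\<integral>\<^sup>+p. (\<Sum>i. ennreal (dens (P i) p)) * indicator E p \<partial>\<nu>)
        = (\<integral>\<^sup>+p. (\<Sum>i. ennreal (dens (P i) p) * indicator E p) \<partial>\<nu>)"
      by (simp add: ennreal_suminf_multc)
    also have "\<dots> = (\<Sum>i. \<integral>\<^sup>+p. ennreal (dens (P i) p) * indicator E p \<partial>\<nu>)"
      by (rule nn_integral_suminf) (simp add: measurable_cong_sets[OF sets_\<nu> refl])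
    also have "\<dots> = (\<Sum>i. emeasure M (P i \<inter> \<pi> -` E))" by (simp add: emeasure_dens)
    also have "\<dots> = emeasure M (\<Union>i. P i \<inter> \<pi> -` E)"
      by (rule suminf_emeasure) (use P_disj in \<open>auto simp: sets_M disjoint_family_on_def\<close>)
    also have "\<dots> = emeasure M (\<pi> -` E)"
      by (rule emeasure_eq_AE) (use Y_full P_un in \<open>auto simp: sets_M elim!: eventually_mono\<close>)
    also have "\<dots> = (\<integral>\<^sup>+p. 1 * indicator E p \<partial>\<nu>)" by (simp add: emeasure_\<nu> sets_\<nu>)
    finally show "(\<integral>\<^sup>+p. (\<Sum>i. ennreal (dens (P i) p)) * indicator E p \<partial>\<nu>) = (\<integral>\<^sup>+p. 1 * indicator E p \<partial>\<nu>)" .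
  qed (auto simp: measurable_cong_sets[OF sets_\<nu> refl])
  ultimately have "AE p in \<nu>. (\<forall>i. dens (P i) p \<noteq> c \<longrightarrow> dens (P i) p = 0) \<and>
      (\<forall>i. p \<notin> \<pi> ` P i \<longrightarrow> dens (P i) p = 0) \<and> (\<Sum>i. ennreal (dens (P i) p)) = 1"
    by eventually_elim blast
  from AE_null_setE[OF this] obtain N0 where N0: "N0 \<in> null_sets \<nu>"
    and good: "\<And>p. p \<notin> N0 \<Longrightarrow> (\<forall>i. dens (P i) p \<noteq> c \<longrightarrow> dens (P i) p = 0) \<and>
      (\<forall>i. p \<notin> \<pi> ` P i \<longrightarrow> dens (P i) p = 0) \<and> (\<Sum>i. ennreal (dens (P i) p)) = 1" by blast
  have N0b [measurable]: "N0 \<in> sets borel" using N0 sets_\<nu> by blast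
  define K where "K p = {i. dens (P i) p = c}" for p
  have c0: "0 < c"
  proof -
    have "emeasure \<nu> UNIV = 1" using emeasure_\<nu>[of UNIV] total by simp
    then have "N0 \<noteq> UNIV" using N0 by (auto simp: null_sets_def)
    then obtain p where p: "p \<notin> N0" by blast
    have "\<exists>i. dens (P i) p \<noteq> 0"
    proof (rule ccontr)
      assume "\<not> ?thesis"
      then have "(\<Sum>i. ennreal (dens (P i) p)) = 0" by simp
      then show False using good[OF p] by simp
    qed
    then obtain i where "dens (P i) p \<noteq> 0" by blast
    moreover have "dens (P i) p = c" using good[OF p] calculation by blast
    ultimately show ?thesis using dens_nonneg[of "P i" p] by linarith
  qed
  have Kp: "finite (K p)" "of_nat (card (K p)) * ennreal c = 1" if p: "p \<notin> N0" for p
  proof -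
    have "ennreal (dens (P i) p) = ennreal c * indicator (K p) i" for i
      using good[OF p] by (auto simp: K_def indicator_def)
    then have "(\<Sum>i. ennreal c * indicator (K p) i) = 1" using good[OF p] by simp
    from suminf_indicator_card[OF this] show "finite (K p)" "of_nat (card (K p)) * ennreal c = 1" .
  qed
  have Kp': "real (card (K p)) * c = 1" if p: "p \<notin> N0" for p
  proof -
    have "ennreal (real (card (K p)) * c) = 1"
      using Kp(2)[OF p] c0 by (simp add: ennreal_mult ennreal_of_nat_eq_real_of_nat)
    then show ?thesis using c0 by simp
  qed
  define k where "k = nat \<lfloor>1 / c\<rfloor>"
  have k: "card (K p) = k" if p: "p \<notin> N0" for p
  proof -
    have "1 / c = real (card (K p))" using Kp'[OF p] c0 by (simp add: field_simps)
    then show ?thesis by (simp add: k_def)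
  qed
  have kc: "real k * c = 1"
  proof -
    have "emeasure \<nu> UNIV = 1" using emeasure_\<nu>[of UNIV] total by simp
    then have "N0 \<noteq> UNIV" using N0 by (auto simp: null_sets_def)
    then obtain p where p: "p \<notin> N0" by blast
    show ?thesis using Kp'[OF p] k[OF p] by simp
  qed
  then have k1: "k \<ge> 1" by (cases k) auto
  define S0 where "S0 i = P i \<inter> \<pi> -` {p. dens (P i) p = c}" for i
  have S0_borel [measurable]: "S0 i \<in> sets borel" for i unfolding S0_def by measurable
  define X0 where "X0 = (\<Union>i. S0 i)"
  have X0_borel [measurable]: "X0 \<in> sets borel" unfolding X0_def by measurable
  have X0_Y: "X0 \<subseteq> Y" using P_un by (auto simp: X0_def S0_def)
  have X0_full: "AE w in M. w \<in> X0"
    using Y_full c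
  proof eventually_elim
    case (elim w)
    then obtain i where "w \<in> P i" using P_un by blast
    then show ?case using elim b_eq by (auto simp: X0_def S0_def)
  qed
  have card_X0: "card (X0 \<inter> \<pi> -` {p}) = k" if p: "p \<notin> N0" for p
  proof -
    have "bij_betw (\<lambda>i. the_inv_into (P i) \<pi> p) (K p) (X0 \<inter> \<pi> -` {p})"
    proof (rule bij_betwI')
      have pt: "the_inv_into (P i) \<pi> p \<in> P i" "\<pi> (the_inv_into (P i) \<pi> p) = p" if "i \<in> K p" for i
      proof -
        have "dens (P i) p \<noteq> 0" using that c0 by (simp add: K_def)
        then have "p \<in> \<pi> ` P i" using good[OF p] by blast
        then show "the_inv_into (P i) \<pi> p \<in> P i" "\<pi> (the_inv_into (P i) \<pi> p) = p"
          using the_inv_into_into[OF P_inj _ subset_refl] f_the_inv_into_f[OF P_inj] by blast+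
      qed
      { fix i j assume ij: "i \<in> K p" "j \<in> K p"
        show "(the_inv_into (P i) \<pi> p = the_inv_into (P j) \<pi> p) = (i = j)"
          using pt(1)[OF ij(1)] pt(1)[OF ij(2)] P_uniq by metis }
      { fix i assume i: "i \<in> K p"
        have "the_inv_into (P i) \<pi> p \<in> S0 i" using pt[OF i] i by (simp add: S0_def K_def)
        then show "the_inv_into (P i) \<pi> p \<in> X0 \<inter> \<pi> -` {p}" using pt[OF i] by (auto simp: X0_def) }
      { fix w assume w: "w \<in> X0 \<inter> \<pi> -` {p}"
        then obtain i where i: "w \<in> P i" "dens (P i) p = c" by (auto simp: X0_def S0_def)
        then have "w = the_inv_into (P i) \<pi> p" using w the_inv_into_f_f[OF P_inj i(1)] by simp
        then show "\<exists>i\<in>K p. w = the_inv_into (P i) \<pi> p" using i by (auto simp: K_def) }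
    qed
    then show ?thesis using bij_betw_same_card k[OF p] by metis
  qed
  have piece: "of_nat k * emeasure M (W \<inter> P i) = emeasure \<nu> (\<pi> ` (W \<inter> P i))"
    if W: "W \<in> sets borel" "W \<subseteq> X0" for W i
  proof -
    have [measurable]: "\<pi> ` (W \<inter> P i) \<in> sets borel" using W X0_Y by (intro im_borel) auto
    have "W \<inter> P i = P i \<inter> \<pi> -` (\<pi> ` (W \<inter> P i))"
      using P_inj[of i] by (auto simp: inj_on_def)
    then have "emeasure M (W \<inter> P i) = (\<integral>\<^sup>+p. ennreal (dens (P i) p) * indicator (\<pi> ` (W \<inter> P i)) p \<partial>\<nu>)"
      using emeasure_dens[of "P i" "\<pi> ` (W \<inter> P i)"] by simp
    also have "\<dots> = (\<integral>\<^sup>+p. ennreal c * indicator (\<pi> ` (W \<inter> P i)) p \<partial>\<nu>)"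
    proof (rule nn_integral_cong)
      fix p
      have "dens (P i) p = c" if pW: "p \<in> \<pi> ` (W \<inter> P i)"
      proof -
        obtain w where w: "w \<in> W" "w \<in> P i" "p = \<pi> w" using pW by blast
        then obtain j where j: "w \<in> P j" "dens (P j) p = c" using W by (auto simp: X0_def S0_def)
        then have "j = i" using P_uniq w by blast
        then show ?thesis using j by simp
      qed
      then show "ennreal (dens (P i) p) * indicator (\<pi> ` (W \<inter> P i)) p = ennreal c * indicator (\<pi> ` (W \<inter> P i)) p"
        by (auto simp: indicator_def)
    qed
    also have "\<dots> = ennreal c * emeasure \<nu> (\<pi> ` (W \<inter> P i))"
      by (rule nn_integral_cmult_indicator) (simp add: sets_\<nu>)
    finally have "of_nat k * emeasure M (W \<inter> P i) = (of_nat k * ennreal c) * emeasure \<nu> (\<pi> ` (W \<inter> P i))"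
      by (simp add: mult.assoc)
    also have "of_nat k * ennreal c = 1"
      using kc c0 by (simp add: ennreal_of_nat_eq_real_of_nat ennreal_mult[symmetric])
    finally show ?thesis by simp
  qed
  have uniform: "of_nat k * emeasure M W = emeasure \<nu> (\<pi> ` W)"
    if W [measurable]: "W \<in> sets borel" "W \<subseteq> X0" "inj_on \<pi> W" for W
  proof -
    have "W = (\<Union>i. W \<inter> P i)" using W X0_Y P_un by blast
    then have "emeasure M W = (\<Sum>i. emeasure M (W \<inter> P i))"
      by (subst (1) \<open>W = _\<close>, intro suminf_emeasure[symmetric])
        (use P_disj in \<open>auto simp: sets_M disjoint_family_on_def\<close>)
    then have "of_nat k * emeasure M W = (\<Sum>i. emeasure \<nu> (\<pi> ` (W \<inter> P i)))"
      by (simp only: ennreal_suminf_cmult[symmetric] piece[OF W(1,2)])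
    also have "\<dots> = emeasure \<nu> (\<Union>i. \<pi> ` (W \<inter> P i))"
    proof (rule suminf_emeasure)
      show "range (\<lambda>i. \<pi> ` (W \<inter> P i)) \<subseteq> sets \<nu>"
        using W X0_Y by (auto simp: sets_\<nu> intro!: im_borel)
      show "disjoint_family (\<lambda>i. \<pi> ` (W \<inter> P i))"
        using P_disj W(3) unfolding disjoint_family_on_def inj_on_def by blast
    qed
    also have "(\<Union>i. \<pi> ` (W \<inter> P i)) = \<pi> ` W" using \<open>W = _\<close> by blast
    finally show ?thesis .
  qed
  have null_image: "\<pi> ` W \<in> null_sets \<nu>" if W: "W \<in> sets borel" "W \<subseteq> X0" "emeasure M W = 0" for W
  proof -
    have "\<pi> ` (W \<inter> P i) \<in> null_sets \<nu>" for i
    proof -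
      have "emeasure M (W \<inter> P i) \<le> emeasure M W" by (rule emeasure_mono) (use W in \<open>auto simp: sets_M\<close>)
      then have "emeasure \<nu> (\<pi> ` (W \<inter> P i)) = 0" using piece[OF W(1,2), of i] W(3) by simp
      moreover have "\<pi> ` (W \<inter> P i) \<in> sets borel" using W X0_Y by (intro im_borel) auto
      ultimately show ?thesis by (auto simp: null_sets_def sets_\<nu>)
    qed
    then have "(\<Union>i. \<pi> ` (W \<inter> P i)) \<in> null_sets \<nu>" by (rule null_sets_UN)
    moreover have "(\<Union>i. \<pi> ` (W \<inter> P i)) = \<pi> ` W" using W X0_Y P_un by blast
    ultimately show ?thesis by simp
  qed
  \<comment> \<open>Only a null set of points of \<open>X0\<close> leaves \<open>X0\<close>; the fibres of these points, and all fibres that reach them later, are discarded.\<close>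
  define N1 where "N1 = X0 \<inter> g -` (- X0)"
  have N1_borel: "N1 \<in> sets borel" unfolding N1_def using measurable_sets[OF meas(1), of "- X0"] by auto
  have "emeasure M N1 = 0"
  proof -
    have "AE w in M. w \<notin> N1" using AE_g[OF X0_full] by eventually_elim (simp add: N1_def)
    then show ?thesis
      using AE_iff_measurable[of N1 M "\<lambda>w. w \<notin> N1"] N1_borel by (auto simp: space_M sets_M)
  qed
  then have N1: "\<pi> ` N1 \<in> null_sets \<nu>" using N1_borel by (intro null_image) (auto simp: N1_def)
  then have [measurable]: "\<pi> ` N1 \<in> sets borel" using sets_\<nu> by blast
  define T where "T = {p. \<forall>n. (A ^^ n) p \<notin> N0 \<union> \<pi> ` N1}"
  have [measurable]: "(A ^^ n) \<in> borel_measurable borel" for n by (rule measurable_compose_n) measurable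
  have T_borel [measurable]: "T \<in> sets borel" unfolding T_def by measurable
  have T_full: "AE p in \<nu>. p \<in> T"
  proof -
    have "AE p in \<nu>. p \<notin> N0 \<union> \<pi> ` N1" by (rule AE_not_in) (use N0 N1 in auto)
    then have "AE p in \<nu>. (A ^^ n) p \<notin> N0 \<union> \<pi> ` N1" for n by (rule AE_A_pow)
    then show ?thesis by (simp add: T_def AE_all_countable)
  qed
  have T_A: "A ` T \<subseteq> T"
  proof
    fix q assume "q \<in> A ` T"
    then obtain p where p: "p \<in> T" "q = A p" by blast
    have "(A ^^ n) q \<notin> N0 \<union> \<pi> ` N1" for n
      using p(1)[unfolded T_def mem_Collect_eq, rule_format, of "Suc n"] by (simp only: p(2) funpow_Suc_right comp_apply) simp
    then show "q \<in> T" by (simp add: T_def)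
  qed
  have T0: "p \<notin> N0 \<union> \<pi> ` N1" if "p \<in> T" for p
    using that[unfolded T_def mem_Collect_eq, rule_format, of 0] by simp
  define X where "X = X0 \<inter> \<pi> -` T"
  have X_borel [measurable]: "X \<in> sets borel" unfolding X_def by measurable
  show thesis
  proof (rule that[of k X T "\<lambda>i. S0 i \<inter> X"])
    show "emeasure M (- X) = 0"
    proof -
      have "AE w in M. w \<notin> - X"
        using X0_full AE_\<nu>_D[OF T_full] by eventually_elim (simp add: X_def)
      then show ?thesis
        using AE_iff_measurable[of "- X" M "\<lambda>w. w \<notin> - X"] by (auto simp: space_M sets_M)
    qed
    show "emeasure \<nu> (- T) = 0"
      using AE_iff_measurable[of "- T" \<nu> "\<lambda>p. p \<in> T"] T_full by (auto simp: space_\<nu> sets_\<nu>)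
    show "g ` X \<subseteq> X"
    proof
      fix x assume "x \<in> g ` X"
      then obtain w where w: "w \<in> X0" "\<pi> w \<in> T" "x = g w" by (auto simp: X_def)
      have "w \<notin> N1" using T0[OF w(2)] by blast
      then have "x \<in> X0" using w by (simp add: N1_def)
      moreover have "\<pi> x \<in> T" using w T_A by auto
      ultimately show "x \<in> X" by (simp add: X_def)
    qed
    show "card (X \<inter> \<pi> -` {p}) = k" if "p \<in> T" for p
    proof -
      have "X \<inter> \<pi> -` {p} = X0 \<inter> \<pi> -` {p}" using that by (auto simp: X_def)
      then show ?thesis using card_X0 T0[OF that] by simp
    qed
    show "\<pi> ` W \<in> sets borel" if "W \<in> sets borel" "W \<subseteq> X" for W
      using that X0_Y by (intro im_borel) (auto simp: X_def)
    show "inj_on \<pi> (S0 i \<inter> X)" for i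
      by (rule inj_on_subset[OF P_inj]) (auto simp: S0_def)
    show "disjoint_family (\<lambda>i. S0 i \<inter> X)"
      using P_disj unfolding disjoint_family_on_def S0_def by blast
    show "X = (\<Union>i. S0 i \<inter> X)" by (auto simp: X_def X0_def)
    show "of_nat k * emeasure M W = emeasure \<nu> (\<pi> ` W)" if "W \<in> sets borel" "W \<subseteq> X" "inj_on \<pi> W" for W
      using that by (intro uniform) (auto simp: X_def)
  qed (use k1 T_A in \<open>auto simp: X_def\<close>)
qed

end

section \<open>Contraction under the inverse along expanding fibres\<close>

text \<open>The number \<open>l w\<close> is the derivative of \<open>g\<close> at \<open>w\<close> along the fibre. It is given only as a limit of ratios, and
\<open>lam\<close> is the exponent of its Birkhoff averages.\<close>

locale expanding_fibres = skew_factor M \<pi> g g' A A'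
  for M :: "'a::{second_countable_topology, complete_space} measure"
    and \<pi> :: "'a \<Rightarrow> 'b::{second_countable_topology, metric_space}" and g g' A A' +
  fixes K :: real and l :: "'a \<Rightarrow> real" and lam :: real
  assumes comp: "compact (UNIV :: 'a set)" and K1: "1 \<le> K"
    and g_lip: "dist (g x) (g y) \<le> K * dist x y" and g'_lip: "dist (g' x) (g' y) \<le> K * dist x y"
    and dil: "((\<lambda>y. dist (g y) (g w) / dist y w) \<longlongrightarrow> l w) (at w within \<pi> -` {\<pi> w})"
    and no_isolated: "at w within \<pi> -` {\<pi> w} \<noteq> bot"
    and lam_pos: "0 < lam"
    and exponent: "AE w in M. (\<lambda>n. (\<Sum>i<n. ln (l ((g ^^ i) w))) / real n) \<longlonglongrightarrow> lam"
begin

definition rivals :: "real \<Rightarrow> 'a \<Rightarrow> 'a set"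
  where "rivals r w = {y. \<pi> y = \<pi> w \<and> y \<noteq> w \<and> dist y w < r}"

text \<open>The least factor by which \<open>g\<close> separates \<open>w\<close> from nearby points of its own fibre. Unlike the derivative it controls
points at a definite distance \<open>r\<close>. The element \<open>K\<close>, an upper bound for all the ratios, keeps the infimum
meaningful when there are no rivals.\<close>

definition min_dilation :: "real \<Rightarrow> 'a \<Rightarrow> real"
  where "min_dilation r w = Inf (insert K ((\<lambda>y. dist (g y) (g w) / dist y w) ` rivals r w))"

lemma ratio_bounds:
  assumes "y \<noteq> w"
  shows "1 / K \<le> dist (g y) (g w) / dist y w" "dist (g y) (g w) / dist y w \<le> K"
proof -
  have d: "dist y w > 0" using assms by simp
  have "dist y w \<le> K * dist (g y) (g w)" using g'_lip[of "g y" "g w"] by simp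
  then show "1 / K \<le> dist (g y) (g w) / dist y w" using d K1 by (simp add: field_simps)
  show "dist (g y) (g w) / dist y w \<le> K" using g_lip[of y w] d by (simp add: field_simps)
qed

lemma min_dilation_set_lower: "x \<in> insert K ((\<lambda>y. dist (g y) (g w) / dist y w) ` rivals r w) \<Longrightarrow> 1 / K \<le> x"
proof -
  assume x: "x \<in> insert K ((\<lambda>y. dist (g y) (g w) / dist y w) ` rivals r w)"
  have "1 / K \<le> 1" using K1 by simp
  then have "1 / K \<le> K" using K1 by linarith
  then show ?thesis using x ratio_bounds(1) by (auto simp: rivals_def)
qed

lemma min_dilation_bdd: "bdd_below (insert K ((\<lambda>y. dist (g y) (g w) / dist y w) ` rivals r w))"
  unfolding bdd_below_def using min_dilation_set_lower by blast

lemma min_dilation_bounds: "1 / K \<le> min_dilation r w" "min_dilation r w \<le> K"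
  unfolding min_dilation_def by (rule cInf_greatest, simp, erule min_dilation_set_lower) (rule cInf_lower[OF _ min_dilation_bdd], simp)

lemma min_dilation_pos: "0 < min_dilation r w"
  using min_dilation_bounds(1)[of r w] K1 by (meson less_le_trans zero_less_divide_1_iff zero_less_one)

lemma min_dilation_mult_le:
  assumes "\<pi> y = \<pi> w" "dist y w < r"
  shows "min_dilation r w * dist y w \<le> dist (g y) (g w)"
proof (cases "y = w")
  case False
  then have "min_dilation r w \<le> dist (g y) (g w) / dist y w"
    unfolding min_dilation_def using assms by (intro cInf_lower[OF _ min_dilation_bdd]) (auto simp: rivals_def)
  then show ?thesis using False by (simp add: field_simps)
qed simp

text \<open>The set where \<open>min_dilation r\<close> is below \<open>a\<close> is a countable union of projections of compact
sets of pairs, since the strict inequalities between \<open>w\<close> and a rival hold with some margin \<open>1 / Suc m\<close>.\<close>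

lemma min_dilation_measurable [measurable]: "min_dilation r \<in> borel_measurable borel"
proof (rule borel_measurableI_less)
  fix a
  show "{w \<in> space borel. min_dilation r w < a} \<in> sets borel"
  proof (cases "K < a")
    case True
    then have "{w \<in> space borel. min_dilation r w < a} = UNIV" by (auto intro: le_less_trans[OF min_dilation_bounds(2)])
    then show ?thesis by simp
  next
    case False
    define Z where "Z m = {z :: 'a \<times> 'a. \<pi> (snd z) = \<pi> (fst z) \<and> 1 / Suc m \<le> dist (snd z) (fst z) \<and>
      dist (snd z) (fst z) \<le> r - 1 / Suc m \<and> dist (g (snd z)) (g (fst z)) \<le> (a - 1 / Suc m) * dist (snd z) (fst z)}" for m
    have cc: "continuous_on UNIV (\<lambda>z :: 'a \<times> 'a. \<pi> (snd z))" "continuous_on UNIV (\<lambda>z :: 'a \<times> 'a. \<pi> (fst z))"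
      "continuous_on UNIV (\<lambda>z :: 'a \<times> 'a. g (snd z))" "continuous_on UNIV (\<lambda>z :: 'a \<times> 'a. g (fst z))"
      by (rule continuous_on_compose2[OF cont] continuous_on_compose2[OF g_cont], rule continuous_on_snd continuous_on_fst, rule continuous_on_id, simp)+
    have Z_closed: "closed (Z m)" for m
      unfolding Z_def
      by (intro closed_Collect_conj closed_Collect_eq closed_Collect_le continuous_intros cc)
    have "compact (UNIV :: ('a \<times> 'a) set)" using compact_Times[OF comp comp] by simp
    then have "compact (Z m)" for m using Z_closed compact_Int_closed[of UNIV "Z m"] by simp
    then have "compact (fst ` Z m)" for m by (intro compact_continuous_image continuous_on_fst continuous_on_id)
    then have "(\<Union>m. fst ` Z m) \<in> sets borel" using compact_borel by blast
    moreover have "{w \<in> space borel. min_dilation r w < a} = (\<Union>m. fst ` Z m)"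
    proof (intro equalityI subsetI)
      fix w assume "w \<in> {w \<in> space borel. min_dilation r w < a}"
      then have "Inf (insert K ((\<lambda>y. dist (g y) (g w) / dist y w) ` rivals r w)) < a" by (simp add: min_dilation_def)
      from cInf_lessD[OF insert_not_empty this]
      obtain x where x: "x \<in> insert K ((\<lambda>y. dist (g y) (g w) / dist y w) ` rivals r w)" "x < a" ..
      then obtain y where y: "y \<in> rivals r w" "dist (g y) (g w) / dist y w < a" using False by auto
      then have y': "\<pi> y = \<pi> w" "0 < dist y w" "dist y w < r" by (auto simp: rivals_def)
      define e where "e = min (dist y w) (min (r - dist y w) (a - dist (g y) (g w) / dist y w))"
      have "e > 0" using y y' by (simp add: e_def)
      then obtain m where m: "1 / Suc m < e" using nat_approx_posE by blast
      have m3: "1 / Suc m < a - dist (g y) (g w) / dist y w" "1 / Suc m < dist y w" "1 / Suc m < r - dist y w"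
        using m by (auto simp: e_def)
      then have "dist (g y) (g w) / dist y w \<le> a - 1 / Suc m" by linarith
      then have "dist (g y) (g w) \<le> (a - 1 / Suc m) * dist y w" using y'(2) by (simp only: pos_divide_le_eq)
      then have "(w, y) \<in> Z m" using m3 y' by (auto simp: Z_def)
      then show "w \<in> (\<Union>m. fst ` Z m)" by force
    next
      fix w assume "w \<in> (\<Union>m. fst ` Z m)"
      then obtain m y where Z: "(w, y) \<in> Z m" by force
      have m: "0 < 1 / real (Suc m)" by simp
      have "1 / Suc m \<le> dist y w" "dist y w \<le> r - 1 / Suc m" using Z by (auto simp: Z_def)
      then have d: "0 < dist y w" "dist y w < r" using m by linarith+
      have "\<pi> y = \<pi> w" using Z by (simp add: Z_def)
      note d = d this
      have "min_dilation r w * dist y w \<le> dist (g y) (g w)" by (rule min_dilation_mult_le) (use d in auto)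
      also have "\<dots> \<le> (a - 1 / Suc m) * dist y w" using Z by (simp add: Z_def)
      finally have "min_dilation r w \<le> a - 1 / Suc m" using d(1) by simp
      then have "min_dilation r w < a" using m by linarith
      then show "w \<in> {w \<in> space borel. min_dilation r w < a}" by simp
    qed
    ultimately show ?thesis by simp
  qed
qed

lemma min_dilation_tendsto: "(\<lambda>n. min_dilation (1 / Suc n) w) \<longlonglongrightarrow> l w"
proof (rule LIMSEQ_I)
  fix e :: real assume e: "e > 0"
  have lK: "l w \<le> K"
  proof (rule tendsto_upperbound[OF dil _ no_isolated])
    show "\<forall>\<^sub>F y in at w within \<pi> -` {\<pi> w}. dist (g y) (g w) / dist y w \<le> K"
      using ratio_bounds(2) by (auto simp: eventually_at_filter)
  qed
  have "\<forall>\<^sub>F y in at w within \<pi> -` {\<pi> w}. dist (dist (g y) (g w) / dist y w) (l w) < e / 2"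
    using e by (intro tendstoD[OF dil]) simp
  then obtain d where d: "d > 0"
    "\<And>y. y \<in> \<pi> -` {\<pi> w} \<Longrightarrow> y \<noteq> w \<Longrightarrow> dist y w < d \<Longrightarrow> dist (dist (g y) (g w) / dist y w) (l w) < e / 2"
    unfolding eventually_at by blast
  obtain N where N: "1 / Suc N < d" using nat_approx_posE[OF d(1)] by blast
  have "norm (min_dilation (1 / Suc n) w - l w) < e" if n: "n \<ge> N" for n
  proof -
    have "1 / real (Suc n) \<le> 1 / real (Suc N)" using n by (intro divide_left_mono) auto
    then have nd: "1 / Suc n < d" using N by linarith
    have "l w - e / 2 \<le> min_dilation (1 / Suc n) w"
      unfolding min_dilation_def
    proof (rule cInf_greatest)
      fix x assume "x \<in> insert K ((\<lambda>y. dist (g y) (g w) / dist y w) ` rivals (1 / Suc n) w)"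
      then consider "x = K" | y where "y \<in> rivals (1 / Suc n) w" "x = dist (g y) (g w) / dist y w" by blast
      then show "l w - e / 2 \<le> x"
      proof cases
        case 2
        then have "dist x (l w) < e / 2" using d(2)[of y] nd by (auto simp: rivals_def)
        then show ?thesis unfolding dist_real_def by linarith
      qed (use lK e in simp)
    qed simp
    moreover have "min_dilation (1 / Suc n) w < l w + e / 2"
    proof -
      have "\<forall>\<^sub>F y in at w within \<pi> -` {\<pi> w}. y \<in> \<pi> -` {\<pi> w} \<and> y \<noteq> w \<and> dist y w < 1 / Suc n"
        unfolding eventually_at by (intro exI[of _ "1 / Suc n"]) auto
      then obtain y where y: "y \<in> \<pi> -` {\<pi> w}" "y \<noteq> w" "dist y w < 1 / Suc n"
        using eventually_happens' no_isolated by blast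
      have "min_dilation (1 / Suc n) w \<le> dist (g y) (g w) / dist y w"
        unfolding min_dilation_def using y by (intro cInf_lower[OF _ min_dilation_bdd]) (auto simp: rivals_def)
      moreover have "dist (dist (g y) (g w) / dist y w) (l w) < e / 2" using d(2)[of y] y nd by auto
      ultimately show ?thesis unfolding dist_real_def by linarith
    qed
    ultimately show ?thesis using e by (simp add: abs_less_iff)
  qed
  then show "\<exists>no. \<forall>n\<ge>no. norm (min_dilation (1 / Suc n) w - l w) < e" by blast
qed

lemma l_bounds: "1 / K \<le> l w" "l w \<le> K"
  using LIMSEQ_le_const[OF min_dilation_tendsto] LIMSEQ_le_const2[OF min_dilation_tendsto] min_dilation_bounds by blast+

lemma l_pos: "0 < l w"
  using l_bounds(1)[of w] K1 by (meson less_le_trans zero_less_divide_1_iff zero_less_one)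

lemma ln_bound: "1 / K \<le> x \<Longrightarrow> x \<le> K \<Longrightarrow> \<bar>ln x\<bar> \<le> ln K"
proof -
  assume x: "1 / K \<le> x" "x \<le> K"
  have "0 < 1 / K" using K1 by simp
  then have "ln (1 / K) \<le> ln x" "ln x \<le> ln K" using x by (subst ln_le_cancel_iff; linarith)+
  then show ?thesis using K1 by (simp add: ln_div abs_le_iff)
qed

lemma l_measurable [measurable]: "l \<in> borel_measurable borel"
  by (rule borel_measurable_LIMSEQ_real[of _ "\<lambda>n. min_dilation (1 / Suc n)"]) (use min_dilation_tendsto in auto)

lemma borel_M: "f \<in> borel_measurable borel \<Longrightarrow> f \<in> borel_measurable M" for f :: "'a \<Rightarrow> real"
  using measurable_cong_sets[OF sets_M refl] by blast

lemma integral_g_pow: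
  fixes f :: "'a \<Rightarrow> real"
  assumes "f \<in> borel_measurable borel"
  shows "(\<integral>w. f ((g ^^ i) w) \<partial>M) = (\<integral>w. f w \<partial>M)"
proof (induction i)
  case (Suc i)
  have [measurable]: "(g ^^ i) \<in> borel_measurable borel" for i by (rule measurable_compose_n) measurable
  note assms [measurable]
  have m: "(\<lambda>w. f ((g ^^ i) w)) \<in> borel_measurable M" by (rule borel_M) measurable
  have "(\<integral>w. f ((g ^^ Suc i) w) \<partial>M) = (\<integral>w. f ((g ^^ i) (g w)) \<partial>M)"
    by (simp add: funpow_swap1)
  also have "\<dots> = (\<integral>w. f ((g ^^ i) w) \<partial>(distr M M g))"
    using integral_distr[OF g_meas_M m] by simp
  finally show ?case using Suc by (simp add: distr_g)
qed simp

text \<open>The averages have the same integral for every \<open>n > 0\<close> and are bounded, so their almost sure limit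
\<open>lam\<close> is that integral. This replaces Birkhoff's theorem for the inverse map.\<close>

lemma integral_log_dilation: "(\<integral>w. ln (l w) \<partial>M) = lam"
proof -
  have [measurable]: "(g ^^ i) \<in> borel_measurable borel" for i by (rule measurable_compose_n) measurable
  have bnd: "\<bar>ln (l w)\<bar> \<le> ln K" for w by (rule ln_bound[OF l_bounds])
  have M1: "measure M (space M) = 1" by (simp add: measure_def total space_M)
  have "(\<lambda>n. \<integral>w. (\<Sum>i<n. ln (l ((g ^^ i) w))) / real n \<partial>M) \<longlonglongrightarrow> (\<integral>w. lam \<partial>M)"
  proof (rule integral_dominated_convergence[of _ _ _ "\<lambda>_. ln K"])
    show "AE w in M. norm ((\<Sum>i<n. ln (l ((g ^^ i) w))) / real n) \<le> ln K" for n
    proof (rule AE_I2)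
      fix w
      have "\<bar>\<Sum>i<n. ln (l ((g ^^ i) w))\<bar> \<le> (\<Sum>i<n. \<bar>ln (l ((g ^^ i) w))\<bar>)" by (rule sum_abs)
      also have "\<dots> \<le> (\<Sum>i<n. ln K)" by (intro sum_mono bnd)
      finally have "\<bar>\<Sum>i<n. ln (l ((g ^^ i) w))\<bar> \<le> real n * ln K" by simp
      then show "norm ((\<Sum>i<n. ln (l ((g ^^ i) w))) / real n) \<le> ln K"
        using K1 by (cases "n = 0") (auto simp: abs_divide field_simps)
    qed
  qed (use exponent in \<open>auto intro!: borel_M\<close>)
  moreover have "(\<integral>w. (\<Sum>i<n. ln (l ((g ^^ i) w))) / real n \<partial>M) = (\<integral>w. ln (l w) \<partial>M)" if "n > 0" for n
  proof -
    have int: "integrable M (\<lambda>w. ln (l ((g ^^ i) w)))" for i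
      by (rule integrable_const_bound[of _ "ln K"]) (use bnd in \<open>auto intro!: borel_M\<close>)
    have "(\<integral>w. (\<Sum>i<n. ln (l ((g ^^ i) w))) / real n \<partial>M) = (\<Sum>i<n. \<integral>w. ln (l ((g ^^ i) w)) \<partial>M) / real n"
      using int by simp
    also have "\<dots> = (\<Sum>i<n. \<integral>w. ln (l w) \<partial>M) / real n"
      using integral_g_pow[of "\<lambda>w. ln (l w)"] by simp
    finally show ?thesis using that by simp
  qed
  then have "(\<lambda>n. \<integral>w. (\<Sum>i<n. ln (l ((g ^^ i) w))) / real n \<partial>M) \<longlonglongrightarrow> (\<integral>w. ln (l w) \<partial>M)"
    by (intro tendsto_eventually) (auto simp: eventually_sequentially intro!: exI[of _ 1])
  ultimately have "(\<integral>w. lam \<partial>M) = (\<integral>w. ln (l w) \<partial>M)" by (rule LIMSEQ_unique)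
  then show ?thesis by (simp add: M1)
qed

lemma g'_mp: "mp_map M g'"
proof -
  have m: "g' \<in> measurable M M"
    using meas(2) measurable_cong_sets[OF sets_M sets_M] by blast
  moreover have "distr M M g' = M"
  proof (rule measure_eqI)
    fix E assume "E \<in> sets (distr M M g')"
    then have "E \<in> sets borel" by (simp add: sets_M)
    then show "emeasure (distr M M g') E = emeasure M E"
      using emeasure_image_g[of E] emeasure_distr[OF m, of E] by (simp add: image_g space_M sets_M)
  qed simp
  ultimately show ?thesis by (simp add: mp_map_def)
qed

lemma emeasure_image_g'_pow: "S \<in> sets borel \<Longrightarrow> emeasure M ((g' ^^ n) ` S) = emeasure M S \<and> (g' ^^ n) ` S \<in> sets borel"
proof (induction n)
  case (Suc n)
  define R where "R = (g' ^^ n) ` S"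
  have R: "emeasure M R = emeasure M S" "R \<in> sets borel" using Suc by (auto simp: R_def)
  have im: "g' ` R = g -` R"
  proof (intro equalityI subsetI)
    fix x assume "x \<in> g -` R"
    then have "x = g' (g x)" "g x \<in> R" by auto
    then show "x \<in> g' ` R" by blast
  qed auto
  have "(g' ^^ Suc n) ` S = g' ` R" by (auto simp: R_def)
  then show ?case using R emeasure_vimage_g[OF R(2)] measurable_sets[OF meas(1) R(2)] by (simp add: im)
qed simp

text \<open>Fix \<open>r\<close> so small that \<open>ln (min_dilation r)\<close> has mean above \<open>lam/2\<close>. By \<open>maximal_inequality\<close> for the
inverse, a set \<open>\<Lambda>\<close> of positive measure consists of points all of whose backward sums of this function are
at least \<open>n lam/2\<close>. Along such an orbit the a priori bound \<open>K\<close> on one step keeps a point starting at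
distance below \<open>\<delta> = r/K\<close> within distance \<open>r\<close> after one more inverse step, so the dilation estimate can be
used again, inductively for all times. A compact piece of \<open>\<Lambda>\<close> of diameter below \<open>\<delta>\<close> thus has
backward images of constant measure whose traces on the fibres shrink to points.\<close>

theorem compact_section:
  obtains D where "compact D" "inj_on \<pi> D" "measure M D > 0"
proof -
  have "(\<lambda>n. \<integral>w. ln (min_dilation (1 / Suc n) w) \<partial>M) \<longlonglongrightarrow> (\<integral>w. ln (l w) \<partial>M)"
  proof (rule integral_dominated_convergence[of _ _ _ "\<lambda>_. ln K"])
    show "AE w in M. norm (ln (min_dilation (1 / Suc n) w)) \<le> ln K" for n
      using ln_bound[OF min_dilation_bounds] by simp
    show "AE w in M. (\<lambda>n. ln (min_dilation (1 / Suc n) w)) \<longlonglongrightarrow> ln (l w)"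
      by (intro AE_I2 tendsto_ln min_dilation_tendsto) (use l_pos in \<open>simp add: less_imp_neq[symmetric]\<close>)
  qed (auto intro!: borel_M)
  then have "\<forall>\<^sub>F n in sequentially. lam / 2 < (\<integral>w. ln (min_dilation (1 / Suc n) w) \<partial>M)"
    by (rule order_tendstoD) (use lam_pos integral_log_dilation in simp)
  then obtain n0 where n0: "lam / 2 < (\<integral>w. ln (min_dilation (1 / Suc n0) w) \<partial>M)"
    unfolding eventually_sequentially by blast
  define r where "r = 1 / real (Suc n0)"
  have r: "r > 0" by (simp add: r_def)
  define \<psi> where "\<psi> w = ln (min_dilation r w)" for w
  have \<psi>_meas [measurable]: "\<psi> \<in> borel_measurable borel" unfolding \<psi>_def by measurable
  have \<psi>_bnd: "\<bar>\<psi> w\<bar> \<le> ln K" for w unfolding \<psi>_def by (rule ln_bound[OF min_dilation_bounds])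
  have \<psi>_int: "lam / 2 < (\<integral>w. \<psi> w \<partial>M)" using n0 by (simp add: \<psi>_def r_def)
  \<comment> \<open>The function \<open>f\<close> has negative mean, and its sums are nonpositive exactly when those of \<open>\<psi>\<close> along the backward orbit grow at rate \<open>\<sigma>\<close>.\<close>
  define \<sigma> where "\<sigma> = lam / 2"
  have \<sigma>: "\<sigma> > 0" using lam_pos by (simp add: \<sigma>_def)
  define f where "f w = \<sigma> - \<psi> (g' w)" for w
  have f_neg: "(\<integral>w. f w \<partial>M) < 0"
  proof -
    have int: "integrable M (\<lambda>w. \<psi> (g' w))"
      by (rule integrable_const_bound[of _ "ln K"]) (use \<psi>_bnd in \<open>auto intro!: borel_M\<close>)
    have g'm: "g' \<in> measurable M M" "distr M M g' = M" using g'_mp by (auto simp: mp_map_def)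
    have "(\<integral>w. \<psi> (g' w) \<partial>M) = (\<integral>w. \<psi> w \<partial>M)"
      using integral_distr[OF g'm(1) borel_M[OF \<psi>_meas]] by (simp add: g'm(2))
    moreover have "measure M (space M) = 1" by (simp add: measure_def total space_M)
    ultimately show ?thesis using int \<psi>_int by (simp add: f_def \<sigma>_def)
  qed
  define \<Lambda> where "\<Lambda> = {w. \<forall>n. (\<Sum>i<n. f ((g' ^^ i) w)) \<le> 0}"
  have \<Lambda>_borel [measurable]: "\<Lambda> \<in> sets borel"
  proof -
    have [measurable]: "(g' ^^ i) \<in> borel_measurable borel" for i by (rule measurable_compose_n) measurable
    show ?thesis unfolding \<Lambda>_def f_def by measurable
  qed
  have \<Lambda>_pos: "emeasure M \<Lambda> > 0"
  proof -
    have "f \<in> borel_measurable M" unfolding f_def by (intro borel_M) measurable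
    moreover have "\<bar>f w\<bar> \<le> \<sigma> + ln K" for w
      using \<psi>_bnd[of "g' w"] \<sigma> unfolding f_def by (simp add: abs_le_iff)
    ultimately have "emeasure M {w \<in> space M. \<forall>n. (\<Sum>i<n. f ((g' ^^ i) w)) \<le> 0} > 0"
      using f_neg by (intro maximal_inequality[OF _ g'_mp]) unfold_locales
    then show ?thesis by (simp add: \<Lambda>_def space_M)
  qed
  define \<delta> where "\<delta> = r / K"
  have \<delta>: "\<delta> > 0" using r K1 by (simp add: \<delta>_def)
  have contract: "dist ((g' ^^ n) y) ((g' ^^ n) w) \<le> exp (- (real n * \<sigma>)) * dist y w"
    if w: "w \<in> \<Lambda>" and y: "\<pi> y = \<pi> w" "dist y w < \<delta>" for w y n
  proof -
    define S where "S n = (\<Sum>i<n. \<psi> ((g' ^^ Suc i) w))" for n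
    have S_ge: "real n * \<sigma> \<le> S n" for n
    proof -
      have "(\<Sum>i<n. f ((g' ^^ i) w)) \<le> 0" using w by (simp add: \<Lambda>_def)
      then show ?thesis by (simp add: f_def S_def sum_subtractf)
    qed
    have "dist ((g' ^^ n) y) ((g' ^^ n) w) \<le> exp (- S n) * dist y w" for n
    proof (induction n)
      case (Suc n)
      let ?u = "(g' ^^ n) y" and ?v = "(g' ^^ n) w"
      have "\<pi> ?u = \<pi> ?v" using y by (induction n) auto
      have "exp (- S n) \<le> 1" using S_ge[of n] \<sigma> by (simp add: order_trans[rotated])
      then have "dist ?u ?v \<le> dist y w" using Suc.IH by (meson mult_left_le_one_le order_trans zero_le_dist exp_ge_zero)
      then have "dist ?u ?v < \<delta>" using y by linarith
      then have "K * dist ?u ?v < r" using K1 by (simp add: \<delta>_def pos_less_divide_eq mult.commute)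
      then have "dist (g' ?u) (g' ?v) < r" using g'_lip[of ?u ?v] by linarith
      then have "min_dilation r (g' ?v) * dist (g' ?u) (g' ?v) \<le> dist ?u ?v"
        using min_dilation_mult_le[of "g' ?u" "g' ?v" r] \<open>\<pi> ?u = \<pi> ?v\<close> by simp
      also have "\<dots> \<le> exp (- S n) * dist y w" by (rule Suc.IH)
      finally have "exp (\<psi> (g' ?v)) * dist (g' ?u) (g' ?v) \<le> exp (- S n) * dist y w"
        by (simp add: \<psi>_def min_dilation_pos)
      then have "exp (- \<psi> (g' ?v)) * (exp (\<psi> (g' ?v)) * dist (g' ?u) (g' ?v))
          \<le> exp (- \<psi> (g' ?v)) * (exp (- S n) * dist y w)" by (rule mult_left_mono) simp
      then show ?case by (simp add: S_def exp_add[symmetric] mult.assoc[symmetric] algebra_simps)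
    qed (simp add: S_def)
    then have "dist ((g' ^^ n) y) ((g' ^^ n) w) \<le> exp (- S n) * dist y w" .
    also have "\<dots> \<le> exp (- (real n * \<sigma>)) * dist y w"
      using S_ge[of n] by (intro mult_right_mono) auto
    finally show ?thesis .
  qed
  have "(UNIV :: 'a set) \<subseteq> (\<Union>x\<in>UNIV. ball x (\<delta> / 2))"
  proof
    fix x :: 'a
    show "x \<in> (\<Union>x\<in>UNIV. ball x (\<delta> / 2))" using \<delta> by (intro UN_I[of x]) auto
  qed
  then obtain F where "F \<subseteq> (UNIV :: 'a set)" and F: "finite F" "(UNIV :: 'a set) \<subseteq> (\<Union>x\<in>F. ball x (\<delta> / 2))"
    by (rule compactE_image[OF comp, of UNIV "\<lambda>x. ball x (\<delta> / 2)", rotated]) (rule that, assumption+, simp)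
  have "\<exists>x\<in>F. measure M (\<Lambda> \<inter> ball x (\<delta> / 2)) > 0"
  proof (rule ccontr)
    assume "\<not> ?thesis"
    then have "\<Lambda> \<inter> ball x (\<delta> / 2) \<in> null_sets M" if "x \<in> F" for x
      using that by (auto simp: null_sets_def sets_M emeasure_eq_measure not_less intro!: antisym)
    then have "(\<Union>x\<in>F. \<Lambda> \<inter> ball x (\<delta> / 2)) \<in> null_sets M"
      using F by (intro null_sets_UN' countable_finite)
    moreover have "(\<Union>x\<in>F. \<Lambda> \<inter> ball x (\<delta> / 2)) = \<Lambda>" using F by auto
    ultimately show False using \<Lambda>_pos by (simp add: null_sets_def)
  qed
  then obtain x where x: "measure M (\<Lambda> \<inter> ball x (\<delta> / 2)) > 0" by blast
  obtain L where L: "compact L" "L \<subseteq> \<Lambda> \<inter> ball x (\<delta> / 2)" "measure M L > 0"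
    by (rule positive_compact_subset[OF _ x]) auto
  have cont': "continuous_on S (g' ^^ n)" for n S
    using continuous_on_funpow[OF g'_cont] continuous_on_subset by blast
  show thesis
  proof (rule exists_compact_section[of "\<lambda>n. (g' ^^ n) ` L" "measure M L"])
    show "compact ((g' ^^ n) ` L)" for n by (intro compact_continuous_image cont' L)
    show "measure M L \<le> measure M ((g' ^^ n) ` L)" for n
      using emeasure_image_g'_pow[OF compact_borel[OF L(1)], of n] by (simp add: measure_def)
    show "measure M L > 0" by fact
    fix e :: real assume e: "e > 0"
    have "(\<lambda>n. exp (- \<sigma>) ^ n * \<delta>) \<longlonglongrightarrow> 0 * \<delta>"
      by (intro tendsto_mult tendsto_const LIMSEQ_power_zero) (use \<sigma> in simp)
    then have "\<forall>\<^sub>F n in sequentially. exp (- \<sigma>) ^ n * \<delta> < e"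
      by (rule order_tendstoD) (use e in simp)
    then obtain n where n: "exp (- \<sigma>) ^ n * \<delta> < e" unfolding eventually_sequentially by blast
    have "dist u v < e" if uv: "u \<in> (g' ^^ n) ` L" "v \<in> (g' ^^ n) ` L" "\<pi> u = \<pi> v" for u v
    proof -
      obtain y w where yw: "y \<in> L" "w \<in> L" "u = (g' ^^ n) y" "v = (g' ^^ n) w" using uv by blast
      have pp: "\<pi> ((g' ^^ n) z) = (A' ^^ n) (\<pi> z)" for z by (induction n) auto
      have "inj A'" by (metis AA' injI)
      then have "\<pi> y = \<pi> w" using uv(3) yw pp inj_fn injD by metis
      moreover have d: "dist y w < \<delta>"
      proof -
        have "y \<in> ball x (\<delta> / 2)" "w \<in> ball x (\<delta> / 2)" using L(2) yw by blast+
        then show ?thesis using dist_triangle_half_r[of x y \<delta> w] by simp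
      qed
      ultimately have "dist u v \<le> exp (- (real n * \<sigma>)) * dist y w"
        using contract[of w y n] L(2) yw by blast
      also have "exp (- (real n * \<sigma>)) = exp (- \<sigma>) ^ n"
        by (simp add: exp_of_nat_mult[symmetric])
      also have "exp (- \<sigma>) ^ n * dist y w \<le> exp (- \<sigma>) ^ n * \<delta>" using d by (intro mult_left_mono) auto
      finally show ?thesis using n by linarith
    qed
    then show "\<exists>n. \<forall>x\<in>(g' ^^ n) ` L. \<forall>y\<in>(g' ^^ n) ` L. \<pi> x = \<pi> y \<longrightarrow> dist x y < e" by blast
  qed (rule that)
qed

end

section \<open>Simple closed curves and their degrees\<close>

lemma cis_eq_cis_iff: "cis (2 * pi * a) = cis (2 * pi * b) \<longleftrightarrow> a - b \<in> \<int>"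
proof -
  have "cis (2 * pi * a) = cis (2 * pi * b) \<longleftrightarrow> (\<exists>n::int. 2 * pi * a = 2 * pi * b + 2 * pi * n)"
    using sin_cos_eq_iff[of "2 * pi * a" "2 * pi * b"] by (auto simp: complex_eq_iff)
  also have "\<dots> \<longleftrightarrow> (\<exists>n::int. a - b = n)"
  proof -
    have "2 * pi * a = 2 * pi * b + 2 * pi * n \<longleftrightarrow> a - b = n" for n :: real
    proof -
      have "2 * pi * a = 2 * pi * b + 2 * pi * n \<longleftrightarrow> 2 * pi * a = 2 * pi * (b + n)" by (simp add: distrib_left)
      also have "\<dots> \<longleftrightarrow> a = b + n" by (subst mult_cancel_left) auto
      finally show ?thesis by linarith
    qed
    then show ?thesis by blast
  qed
  also have "\<dots> \<longleftrightarrow> a - b \<in> \<int>" by (auto simp: Ints_def)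
  finally show ?thesis .
qed

lemma integer_valued_constant:
  fixes f :: "'a::topological_space \<Rightarrow> real"
  assumes "connected S" "continuous_on S f" "\<And>x. x \<in> S \<Longrightarrow> f x \<in> \<int>" "x \<in> S" "y \<in> S"
  shows "f x = f y"
proof -
  have "f constant_on S"
  proof (rule continuous_discrete_range_constant[OF assms(1,2)])
    fix x assume x: "x \<in> S"
    have "1 \<le> norm (f y - f x)" if "y \<in> S" "f y \<noteq> f x" for y
      using Ints_nonzero_abs_ge1[of "f y - f x"] assms(3)[OF x] assms(3)[OF that(1)] that(2) by auto
    then show "\<exists>e>0. \<forall>y. y \<in> S \<and> f y \<noteq> f x \<longrightarrow> e \<le> norm (f y - f x)"
      by (intro exI[of _ 1]) auto
  qed
  then show ?thesis using assms(4,5) by (auto simp: constant_on_def)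
qed

lemma angle_lift:
  fixes f :: "'v::real_normed_vector \<Rightarrow> complex"
  assumes "continuous_on S f" "convex S" "\<And>x. x \<in> S \<Longrightarrow> norm (f x) = 1"
  shows "\<exists>\<theta>. continuous_on S \<theta> \<and> (\<forall>x\<in>S. f x = cis (2 * pi * \<theta> x))"
proof -
  have nz: "f x \<noteq> 0" if "x \<in> S" for x using assms(3)[OF that] by force
  obtain G where G: "continuous_on S G" "\<And>x. x \<in> S \<Longrightarrow> f x = exp (G x)"
    using continuous_logarithm_on_contractible[OF assms(1) convex_imp_contractible[OF assms(2)] nz] by metis
  have "f x = cis (2 * pi * (Im (G x) / (2 * pi)))" if "x \<in> S" for x
  proof -
    have "exp (Re (G x)) = 1" using assms(3)[OF that] G(2)[OF that] by (simp add: norm_exp_eq_Re)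
    then show ?thesis using G(2)[OF that] by (simp add: exp_eq_polar)
  qed
  moreover have "continuous_on S (\<lambda>x. Im (G x) / (2 * pi))" by (intro continuous_intros G) auto
  ultimately show ?thesis by blast
qed

text \<open>A continuous map from a compact space to a Hausdorff space is a quotient map onto its image.\<close>

lemma continuous_on_compact_image:
  fixes q :: "'a::t2_space \<Rightarrow> 'b::t2_space" and f :: "'b \<Rightarrow> 'c::topological_space"
  assumes K: "compact K" and q: "continuous_on K q" and fq: "continuous_on K (\<lambda>x. f (q x))"
  shows "continuous_on (q ` K) f"
  unfolding continuous_on_closed_invariant
proof (intro allI impI)
  fix B :: "'c set" assume B: "closed B"
  obtain A where A: "closed A" "A \<inter> K = (\<lambda>x. f (q x)) -` B \<inter> K"
    using fq B unfolding continuous_on_closed_invariant by blast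
  have "compact (K \<inter> A)" using K A(1) by (rule compact_Int_closed)
  then have "compact (q ` (K \<inter> A))" using q continuous_on_subset by (blast intro: compact_continuous_image)
  then have "closed (q ` (K \<inter> A))" by (rule compact_imp_closed)
  moreover have "q ` (K \<inter> A) \<inter> q ` K = f -` B \<inter> q ` K"
  proof (intro equalityI subsetI)
    fix z assume "z \<in> q ` (K \<inter> A) \<inter> q ` K"
    then obtain x where "x \<in> K" "x \<in> A" "z = q x" by blast
    then show "z \<in> f -` B \<inter> q ` K" using A(2) by blast
  next
    fix z assume "z \<in> f -` B \<inter> q ` K"
    then obtain x where "x \<in> K" "z = q x" "f (q x) \<in> B" by blast
    then show "z \<in> q ` (K \<inter> A) \<inter> q ` K" using A(2) by blast
  qed
  ultimately show "\<exists>A. closed A \<and> A \<inter> q ` K = f -` B \<inter> q ` K" by blast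
qed

definition loop_param :: "'a::metric_space set \<Rightarrow> (real \<Rightarrow> 'a) \<Rightarrow> bool"
  where "loop_param L c \<longleftrightarrow> continuous_on UNIV c \<and> (\<forall>s t. c s = c t \<longleftrightarrow> s - t \<in> \<int>) \<and> range c = L"

text \<open>The winding number of the circle-valued function \<open>\<xi>\<close> along the closed curve \<open>c\<close>.\<close>

definition wind :: "('a::metric_space \<Rightarrow> complex) \<Rightarrow> (real \<Rightarrow> 'a) \<Rightarrow> int \<Rightarrow> bool"
  where "wind \<xi> c d \<longleftrightarrow> (\<exists>\<theta>. continuous_on UNIV \<theta> \<and> (\<forall>s. \<xi> (c s) = cis (2 * pi * \<theta> s)) \<and>
    (\<forall>s. \<theta> (s + 1) = \<theta> s + of_int d))"

text \<open>Once the winding numbers of \<open>\<xi>\<close> along the fibres are nonzero, their sign orients all fibres consistently.\<close>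

definition positive :: "('a::metric_space \<Rightarrow> complex) \<Rightarrow> 'a set \<Rightarrow> (real \<Rightarrow> 'a) \<Rightarrow> bool"
  where "positive \<xi> L c \<longleftrightarrow> loop_param L c \<and> (\<exists>d>0. wind \<xi> c d)"

lemma shift_int:
  fixes h :: "real \<Rightarrow> real"
  assumes "\<And>s. h (s + 1) = h s + e" shows "h (s + of_int n) = h s + of_int n * e"
proof (induction n arbitrary: s rule: int_induct[where k = 0])
  case (step1 i)
  have "h (s + of_int (i + 1)) = h ((s + of_int i) + 1)" by (simp add: algebra_simps)
  then show ?case using step1 assms[of "s + of_int i"] by (simp add: algebra_simps)
next
  case (step2 i)
  have "h (s + of_int i) = h ((s + of_int (i - 1)) + 1)" by (simp add: algebra_simps)
  then show ?case using step2 assms[of "s + of_int (i - 1)"] by (simp add: algebra_simps)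
qed simp

lemma loop_param_shift: "loop_param L c \<Longrightarrow> c (s + 1) = c s"
  by (simp add: loop_param_def)

lemma loop_param_image: "loop_param L c \<Longrightarrow> c ` {0..1} = L"
proof
  assume c: "loop_param L c"
  show "L \<subseteq> c ` {0..1}"
  proof
    fix x assume "x \<in> L"
    then obtain s where "x = c s" using c by (auto simp: loop_param_def)
    moreover have "c s = c (frac s)" using c by (simp add: loop_param_def frac_def)
    ultimately show "x \<in> c ` {0..1}" using frac_ge_0[of s] frac_lt_1[of s] by (intro image_eqI[of _ _ "frac s"]) auto
  qed
qed (auto simp: loop_param_def)

lemma wind_exists:
  assumes \<xi>: "continuous_on UNIV \<xi>" "\<And>w. norm (\<xi> w) = 1" and c: "loop_param L c"
  shows "\<exists>d. wind \<xi> c d"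
proof -
  have "continuous_on UNIV (\<lambda>s. \<xi> (c s))"
    using c by (intro continuous_on_compose2[OF \<xi>(1)]) (auto simp: loop_param_def)
  then obtain \<theta> where \<theta>: "continuous_on UNIV \<theta>" "\<And>s. \<xi> (c s) = cis (2 * pi * \<theta> s)"
    using angle_lift[of UNIV "\<lambda>s. \<xi> (c s)"] \<xi> by auto
  have int: "\<theta> (s + 1) - \<theta> s \<in> \<int>" for s
    using \<theta>(2)[of s] \<theta>(2)[of "s + 1"] loop_param_shift[OF c, of s] by (simp add: cis_eq_cis_iff[symmetric])
  have "continuous_on UNIV (\<lambda>s. \<theta> (s + 1) - \<theta> s)"
    by (intro continuous_intros continuous_on_compose2[OF \<theta>(1)]) auto
  then have const: "\<theta> (s + 1) - \<theta> s = \<theta> (0 + 1) - \<theta> 0" for s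
    by (rule integer_valued_constant[OF connected_UNIV _ int]) auto
  obtain d where "\<theta> (0 + 1) - \<theta> 0 = of_int d" using int[of 0] by (auto elim: Ints_cases)
  then have "\<theta> (s + 1) = \<theta> s + of_int d" for s using const[of s] by simp
  then show ?thesis using \<theta> unfolding wind_def by blast
qed

lemma wind_unique:
  assumes "wind \<xi> c d" "wind \<xi> c d'" shows "d = d'"
proof -
  obtain \<theta> where \<theta>: "continuous_on UNIV \<theta>" "\<And>s. \<xi> (c s) = cis (2 * pi * \<theta> s)" "\<And>s. \<theta> (s + 1) = \<theta> s + of_int d"
    using assms(1) unfolding wind_def by blast
  obtain \<eta> where \<eta>: "continuous_on UNIV \<eta>" "\<And>s. \<xi> (c s) = cis (2 * pi * \<eta> s)" "\<And>s. \<eta> (s + 1) = \<eta> s + of_int d'"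
    using assms(2) unfolding wind_def by blast
  have "\<theta> 0 - \<eta> 0 = \<theta> (0 + 1) - \<eta> (0 + 1)"
  proof (rule integer_valued_constant[of UNIV "\<lambda>s. \<theta> s - \<eta> s"])
    show "\<theta> s - \<eta> s \<in> \<int>" for s using \<theta>(2)[of s] \<eta>(2)[of s] cis_eq_cis_iff by metis
  qed (auto intro!: continuous_intros \<theta> \<eta>)
  then show ?thesis using \<theta>(3)[of 0] \<eta>(3)[of 0] by simp
qed

lemma wind_compose:
  assumes "wind \<xi> c d" and h: "continuous_on UNIV h" "\<And>s. h (s + 1) = h s + of_int e"
  shows "wind \<xi> (\<lambda>s. c (h s)) (e * d)"
proof -
  obtain \<theta> where \<theta>: "continuous_on UNIV \<theta>" "\<And>s. \<xi> (c s) = cis (2 * pi * \<theta> s)" "\<And>s. \<theta> (s + 1) = \<theta> s + of_int d"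
    using assms(1) unfolding wind_def by blast
  have "continuous_on UNIV (\<lambda>s. \<theta> (h s))" by (intro continuous_on_compose2[OF \<theta>(1) h(1)]) auto
  moreover have "\<theta> (h (s + 1)) = \<theta> (h s) + of_int (e * d)" for s
    using shift_int[of \<theta>, OF \<theta>(3), of "h s" e] h(2) by simp
  ultimately show ?thesis unfolding wind_def using \<theta>(2) by (intro exI[of _ "\<lambda>s. \<theta> (h s)"]) auto
qed

lemma loop_inverse:
  assumes c: "loop_param L c"
  shows "\<exists>E. continuous_on L E \<and> (\<forall>s. E (c s) = cis (2 * pi * s))"
proof -
  define E where "E x = cis (2 * pi * (SOME s. c s = x))" for x
  have E: "E (c s) = cis (2 * pi * s)" for s
  proof -
    have "c (SOME t. c t = c s) = c s" by (rule someI) (rule refl)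
    then show ?thesis using c unfolding E_def cis_eq_cis_iff by (simp add: loop_param_def)
  qed
  have "continuous_on {0..1} c" using c by (auto simp: loop_param_def intro: continuous_on_subset)
  moreover have "continuous_on {0..1} (\<lambda>s. E (c s))" unfolding E by (intro continuous_intros)
  ultimately have "continuous_on (c ` {0..1}) E" by (intro continuous_on_compact_image) auto
  then show ?thesis using E loop_param_image[OF c] by auto
qed

text \<open>The degree of a homeomorphism of the circle, in terms of a lift \<open>h\<close>. By the intermediate value theorem,
degree \<open>0\<close> would make \<open>h\<close> take some value twice within a period, and degree of modulus at least \<open>2\<close> would
make it pass through \<open>h 0\<close> plus or minus \<open>1\<close> in the interior of a period; either contradicts injectivity
modulo \<open>1\<close>.\<close>

lemma injective_shift_degree:
  fixes h :: "real \<Rightarrow> real"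
  assumes h: "continuous_on UNIV h" "\<And>s. h (s + 1) = h s + of_int e"
    and inj: "\<And>s t. h s - h t \<in> \<int> \<Longrightarrow> s - t \<in> \<int>"
  shows "e = 1 \<or> e = - 1" "inj h"
proof -
  have cont: "continuous_on S h" for S using h(1) continuous_on_subset by blast
  have e0: "e \<noteq> 0"
  proof
    assume "e = 0"
    then have h1: "h 1 = h 0" using h(2)[of 0] by simp
    have ne: "h (1/2) \<noteq> h 0"
    proof
      assume "h (1/2) = h 0"
      then have "(1/2 :: real) \<in> \<int>" using inj[of "1/2" 0] by simp
      then show False using Ints_nonzero_abs_less1[of "1/2 :: real"] by simp
    qed
    define m where "m = (h 0 + h (1/2)) / 2"
    have "\<exists>s. 0 \<le> s \<and> s \<le> 1/2 \<and> h s = m"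
    proof (cases "h 0 \<le> h (1/2)")
      case True then show ?thesis by (intro IVT' cont) (auto simp: m_def)
    next
      case False then show ?thesis by (intro IVT2' cont) (auto simp: m_def)
    qed
    then obtain s where s: "0 \<le> s" "s \<le> 1/2" "h s = m" by blast
    have "\<exists>t. 1/2 \<le> t \<and> t \<le> 1 \<and> h t = m"
    proof (cases "h (1/2) \<le> h 1")
      case True then show ?thesis by (intro IVT' cont) (auto simp: m_def h1)
    next
      case False then show ?thesis by (intro IVT2' cont) (auto simp: m_def h1)
    qed
    then obtain t where t: "1/2 \<le> t" "t \<le> 1" "h t = m" by blast
    have m: "m \<noteq> h 0" "m \<noteq> h (1/2)" using ne by (simp_all add: m_def)
    have "s \<noteq> 0" using s(3) m(1) by blast
    moreover have "s \<noteq> 1/2" using s(3) m(2) by blast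
    moreover have "t \<noteq> 1/2" using t(3) m(2) by blast
    moreover have "t \<noteq> 1" using t(3) m(1) h1 by auto
    ultimately
    have "0 < t - s" "t - s < 1" using s t by auto
    moreover have "t - s \<in> \<int>" using s t inj[of t s] by simp
    ultimately show False using Ints_nonzero_abs_less1[of "t - s"] by auto
  qed
  show "inj h"
  proof (rule injI)
    fix s t assume st: "h s = h t"
    then have "s - t \<in> \<int>" using inj[of s t] by simp
    then obtain n where "s - t = of_int n" by (auto elim: Ints_cases)
    then have n: "s = t + of_int n" by simp
    then have "h s = h t + of_int n * of_int e" using shift_int[of h, OF h(2), of t n] by simp
    then show "s = t" using st e0 n by simp
  qed
  show "e = 1 \<or> e = - 1"
  proof (rule ccontr)
    assume "\<not> ?thesis"
    then have e2: "e \<ge> 2 \<or> e \<le> -2" using e0 by linarith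
    define m where "m = h 0 + sgn (of_int e)"
    have h1: "h 1 = h 0 + of_int e" using h(2)[of 0] by simp
    have "\<exists>s. 0 \<le> s \<and> s \<le> 1 \<and> h s = m"
    proof (cases "e \<ge> 2")
      case True then show ?thesis by (intro IVT' cont) (auto simp: m_def h1)
    next
      case False
      then have "e \<le> - 2" using e2 by simp
      then show ?thesis by (intro IVT2' cont) (auto simp: m_def h1)
    qed
    then obtain s where s: "0 \<le> s" "s \<le> 1" "h s = m" by blast
    have "h s - h 0 \<in> \<int>" using s by (simp add: m_def sgn_if)
    then have "s - 0 \<in> \<int>" by (rule inj)
    moreover have "s \<noteq> 0" "s \<noteq> 1" using s e2 h1 by (auto simp: m_def sgn_if)
    ultimately show False using s Ints_nonzero_abs_less1[of s] by auto
  qed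
qed

text \<open>Two parametrizations of one circle differ by a homeomorphism of the circle, which lifts to the line.\<close>

lemma loop_reparam:
  assumes c: "loop_param L c" and c': "loop_param L c'"
  obtains h e where "continuous_on UNIV h" "\<And>s. c' s = c (h s)" "\<And>s. h (s + 1) = h s + of_int e"
    "e = 1 \<or> e = - 1" "inj h"
proof -
  obtain E where E: "continuous_on L E" "\<And>s. E (c s) = cis (2 * pi * s)"
    using loop_inverse[OF c] by blast
  have L: "c' s \<in> L" for s using c' by (auto simp: loop_param_def)
  have "continuous_on UNIV (\<lambda>s. E (c' s))"
    using c' L by (intro continuous_on_compose2[OF E(1)]) (auto simp: loop_param_def)
  moreover have E1: "norm (E x) = 1" if xL: "x \<in> L" for x
  proof -
    obtain s where "x = c s" using c xL by (auto simp: loop_param_def)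
    then show ?thesis by (simp add: E)
  qed
  ultimately obtain h where h: "continuous_on UNIV h" "\<And>s. E (c' s) = cis (2 * pi * h s)"
    using angle_lift[of UNIV "\<lambda>s. E (c' s)"] L by auto
  have c'c: "c' s = c (h s)" for s
  proof -
    obtain u where u: "c' s = c u" using c L[of s] by (auto simp: loop_param_def)
    then have "cis (2 * pi * u) = cis (2 * pi * h s)" using h(2)[of s] E(2)[of u] by simp
    then show ?thesis using u c by (simp add: cis_eq_cis_iff loop_param_def)
  qed
  have int: "h (s + 1) - h s \<in> \<int>" for s
    using h(2)[of s] h(2)[of "s + 1"] loop_param_shift[OF c', of s] by (simp add: cis_eq_cis_iff[symmetric])
  have "continuous_on UNIV (\<lambda>s. h (s + 1) - h s)"
    by (intro continuous_intros continuous_on_compose2[OF h(1)]) auto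
  then have const: "h (s + 1) - h s = h (0 + 1) - h 0" for s
    by (rule integer_valued_constant[OF connected_UNIV _ int]) auto
  obtain e where "h (0 + 1) - h 0 = of_int e" using int[of 0] by (auto elim: Ints_cases)
  then have e: "h (s + 1) = h s + of_int e" for s using const[of s] by simp
  have inj: "s - t \<in> \<int>" if "h s - h t \<in> \<int>" for s t
  proof -
    have "c' s = c' t" using that c c'c[of s] c'c[of t] by (simp add: loop_param_def)
    then show ?thesis using c' by (simp add: loop_param_def)
  qed
  show thesis
    by (rule that[OF h(1) c'c e]) (use injective_shift_degree[OF h(1) e inj] in auto)
qed

lemma wind_pm:
  assumes "loop_param L c" "loop_param L c'" "wind \<xi> c d" "wind \<xi> c' d'"
  shows "d' = d \<or> d' = - d"
proof -
  obtain h e where h: "continuous_on UNIV h" "\<And>s. c' s = c (h s)" "\<And>s. h (s + 1) = h s + of_int e"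
    "e = 1 \<or> e = - 1" by (rule loop_reparam[OF assms(1,2)]) (rule that)
  have "wind \<xi> c' (e * d)" using wind_compose[OF assms(3) h(1,3)] ext[of c' "\<lambda>s. c (h s)", OF h(2)] by simp
  then have "d' = e * d" using wind_unique assms(4) by blast
  then show ?thesis using h(4) by auto
qed

lemma positive_reparam:
  assumes "positive \<xi> L c" "positive \<xi> L c'"
  obtains h where "strict_mono h" "\<And>s. h (s + 1) = h s + 1" "\<And>s. c' s = c (h s)"
proof -
  obtain d d' where c: "loop_param L c" "loop_param L c'" and d: "d > 0" "wind \<xi> c d" "d' > 0" "wind \<xi> c' d'"
    using assms unfolding positive_def by blast
  obtain h e where h: "continuous_on UNIV h" "\<And>s. c' s = c (h s)" "\<And>s. h (s + 1) = h s + of_int e"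
    "e = 1 \<or> e = - 1" "inj h" by (rule loop_reparam[OF c]) (rule that)
  have "wind \<xi> c' (e * d)" using wind_compose[OF d(2) h(1,3)] ext[of c' "\<lambda>s. c (h s)", OF h(2)] by simp
  then have "d' = e * d" using wind_unique d(4) by blast
  then have e: "e = 1" using d h(4) by auto
  have "strict_mono_on UNIV h \<or> strict_antimono_on UNIV h"
    using injective_eq_monotone_map[OF _ h(1)] h(5) is_interval_univ by blast
  moreover have "\<not> strict_antimono_on UNIV h"
  proof
    assume "strict_antimono_on UNIV h"
    then have "h 1 < h 0" by (rule monotone_onD) auto
    then show False using h(3)[of 0] e by simp
  qed
  ultimately have "strict_mono h" by blast
  then show thesis using that[of h] h e by simp
qed

lemma loop_param_reverse: "loop_param L c \<Longrightarrow> loop_param L (\<lambda>s. c (- s))"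
proof -
  assume c: "loop_param L c"
  have "continuous_on UNIV (\<lambda>s. c (- s))"
  proof (rule continuous_on_compose2[of UNIV c])
    show "continuous_on UNIV c" using c by (simp add: loop_param_def)
  qed (auto intro: continuous_on_minus)
  moreover have "c (- s) = c (- t) \<longleftrightarrow> s - t \<in> \<int>" for s t
  proof -
    have "c (- s) = c (- t) \<longleftrightarrow> - s - - t \<in> \<int>" using c by (simp add: loop_param_def)
    also have "- s - - t = - (s - t)" by simp
    finally show ?thesis by (simp only: minus_in_Ints_iff)
  qed
  moreover have "range (\<lambda>s. c (- s)) = range c"
  proof (intro equalityI subsetI)
    fix x assume "x \<in> range c"
    then obtain s where "x = c s" by blast
    then have "x = c (- (- s))" by simp
    then show "x \<in> range (\<lambda>s. c (- s))" by (rule range_eqI)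
  qed auto
  ultimately show ?thesis using c unfolding loop_param_def by auto
qed

lemma positive_exists:
  assumes c: "loop_param L c" "wind \<xi> c d" "d \<noteq> 0"
  shows "\<exists>c'. positive \<xi> L c'"
proof (cases "d > 0")
  case False
  have "wind \<xi> (\<lambda>s. c (- s)) (- 1 * d)" by (rule wind_compose[OF c(2)]) (auto intro!: continuous_intros)
  then show ?thesis using loop_param_reverse[OF c(1)] False c(3) unfolding positive_def
    by (intro exI[of _ "\<lambda>s. c (- s)"]) force
qed (use c in \<open>auto simp: positive_def\<close>)

text \<open>Composing with \<open>g\<close> changes \<open>\<xi>\<close> along the curve by the angle \<open>\<delta>\<close>, a real function on the whole space
and hence periodic along the curve; so the winding number is unchanged.\<close>

lemma positive_image:
  assumes p: "positive \<xi> L c" and g: "continuous_on UNIV g" "inj g"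
    and \<delta>: "continuous_on UNIV \<delta>" "\<And>w. \<xi> (g w) = \<xi> w * cis (2 * pi * \<delta> w)"
  shows "positive \<xi> (g ` L) (\<lambda>s. g (c s))"
proof -
  obtain d where c: "loop_param L c" and d: "d > 0" "wind \<xi> c d" using p unfolding positive_def by blast
  have cc: "continuous_on UNIV c" using c by (simp add: loop_param_def)
  have "loop_param (g ` L) (\<lambda>s. g (c s))"
    using c g(2) continuous_on_compose2[OF g(1) cc] by (auto simp: loop_param_def inj_eq)
  moreover obtain \<theta> where \<theta>: "continuous_on UNIV \<theta>" "\<And>s. \<xi> (c s) = cis (2 * pi * \<theta> s)" "\<And>s. \<theta> (s + 1) = \<theta> s + of_int d"
    using d(2) unfolding wind_def by blast
  have "wind \<xi> (\<lambda>s. g (c s)) d"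
    unfolding wind_def
  proof (intro exI[of _ "\<lambda>s. \<theta> s + \<delta> (c s)"] conjI allI)
    show "continuous_on UNIV (\<lambda>s. \<theta> s + \<delta> (c s))"
      by (intro continuous_intros \<theta> continuous_on_compose2[OF \<delta>(1) cc]) auto
    show "\<xi> (g (c s)) = cis (2 * pi * (\<theta> s + \<delta> (c s)))" for s
      by (simp add: \<delta>(2) \<theta>(2) cis_mult distrib_left)
    show "\<theta> (s + 1) + \<delta> (c (s + 1)) = \<theta> s + \<delta> (c s) + of_int d" for s
      by (simp add: \<theta>(3) loop_param_shift[OF c])
  qed
  ultimately show ?thesis using d unfolding positive_def by blast
qed

section \<open>Orientation of the fibres\<close>

lemma loop_param_in: "loop_param L c \<Longrightarrow> c s \<in> L"
  unfolding loop_param_def by blast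

text \<open>Parametrizations of all fibres near one fibre, depending continuously on the base point \<open>y\<close>, read in the
universal cover of the base, together with a joint lift \<open>\<Theta>\<close> of the angle of \<open>\<xi>\<close>. That the lift exists
over a ball times a line is the reason for using the cover.\<close>

definition local_family ::
    "('a::metric_space \<Rightarrow> 2 torus) \<Rightarrow> ('a \<Rightarrow> complex) \<Rightarrow> real ^ 2 \<Rightarrow> real \<Rightarrow>
     ((real ^ 2) \<times> real \<Rightarrow> 'a) \<Rightarrow> ((real ^ 2) \<times> real \<Rightarrow> real) \<Rightarrow> int \<Rightarrow> bool"
  where "local_family \<pi> \<xi> x0 r c \<Theta> d \<longleftrightarrow> r > 0 \<and>
    continuous_on (ball x0 r \<times> UNIV) c \<and> continuous_on (ball x0 r \<times> UNIV) \<Theta> \<and>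
    (\<forall>y\<in>ball x0 r. loop_param (\<pi> -` {abs_torus y}) (\<lambda>s. c (y, s)) \<and>
      (\<forall>s. \<xi> (c (y, s)) = cis (2 * pi * \<Theta> (y, s)) \<and> \<Theta> (y, s + 1) = \<Theta> (y, s) + of_int d))"

lemma local_family_exists:
  fixes \<pi> :: "'a::metric_space \<Rightarrow> 2 torus"
  assumes fib: "fibration \<pi>" and c0: "loop_param (\<pi> -` {abs_torus x0}) c0"
    and \<xi>: "continuous_on UNIV \<xi>" "\<And>w. norm (\<xi> w) = 1"
  shows "\<exists>r c \<Theta> d. local_family \<pi> \<xi> x0 r c \<Theta> d"
proof -
  obtain V h k where V: "open V" "abs_torus x0 \<in> V"
    and hk: "homeomorphism (\<pi> -` V) (V \<times> (\<pi> -` {abs_torus x0})) h k"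
    and fst_h: "\<And>w. w \<in> \<pi> -` V \<Longrightarrow> fst (h w) = \<pi> w"
    using fib[unfolded fibration_def, THEN conjunct2, THEN conjunct2, rule_format, of "abs_torus x0"] by auto
  have "open (abs_torus -` V)" using V(1) by (simp add: open_torus_def)
  from this[unfolded open_contains_ball, rule_format, of x0] V(2)
  obtain r where r: "r > 0" "ball x0 r \<subseteq> abs_torus -` V" by auto
  define B where "B = ball x0 r \<times> (UNIV :: real set)"
  define c where "c z = k (abs_torus (fst z), c0 (snd z))" for z
  have c0': "continuous_on UNIV c0" "\<And>s t. c0 s = c0 t \<longleftrightarrow> s - t \<in> \<int>" "range c0 = \<pi> -` {abs_torus x0}"
    using c0 by (auto simp: loop_param_def)
  have inT: "(abs_torus (fst z), c0 (snd z)) \<in> V \<times> (\<pi> -` {abs_torus x0})" if "z \<in> B" for z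
  proof -
    have "fst z \<in> abs_torus -` V" using r that by (auto simp: B_def)
    moreover have "c0 (snd z) \<in> \<pi> -` {abs_torus x0}" using c0'(3) by blast
    ultimately show ?thesis by simp
  qed
  have c_cont: "continuous_on B c"
    unfolding c_def
  proof (rule continuous_on_compose2[of "V \<times> (\<pi> -` {abs_torus x0})" k])
    show "continuous_on (V \<times> (\<pi> -` {abs_torus x0})) k" using hk by (simp add: homeomorphism_def)
    have "continuous_on B (\<lambda>z. c0 (snd z))"
      by (rule continuous_on_compose2[OF c0'(1)]) (auto intro: continuous_on_snd continuous_on_id)
    then show "continuous_on B (\<lambda>z. (abs_torus (fst z), c0 (snd z)))"
      by (intro continuous_on_Pair continuous_on_abs_torus continuous_on_fst continuous_on_id)
  qed (use inT in auto)
  have loop: "loop_param (\<pi> -` {abs_torus y}) (\<lambda>s. c (y, s))" if y: "y \<in> ball x0 r" for y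
    unfolding loop_param_def
  proof (intro conjI allI)
    show "continuous_on UNIV (\<lambda>s. c (y, s))"
      by (rule continuous_on_compose2[OF c_cont]) (use y in \<open>auto simp: B_def intro!: continuous_intros\<close>)
    have T: "(abs_torus y, c0 s) \<in> V \<times> (\<pi> -` {abs_torus x0})" for s
      using inT[of "(y, s)"] y by (simp add: B_def)
    have hkT: "h (k q) = q" if "q \<in> V \<times> (\<pi> -` {abs_torus x0})" for q
      using hk that unfolding homeomorphism_def by blast
    show "c (y, s) = c (y, t) \<longleftrightarrow> s - t \<in> \<int>" for s t
    proof
      assume "c (y, s) = c (y, t)"
      then have "h (k (abs_torus y, c0 s)) = h (k (abs_torus y, c0 t))" by (simp add: c_def)
      then have "c0 s = c0 t" by (simp add: hkT[OF T])
      then show "s - t \<in> \<int>" using c0'(2) by simp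
    next
      assume "s - t \<in> \<int>"
      then show "c (y, s) = c (y, t)" using c0'(2)[of s t] by (simp add: c_def)
    qed
    show "range (\<lambda>s. c (y, s)) = \<pi> -` {abs_torus y}"
    proof (intro equalityI subsetI)
      fix w assume "w \<in> range (\<lambda>s. c (y, s))"
      then obtain s where s: "w = k (abs_torus y, c0 s)" by (auto simp: c_def)
      have "w \<in> \<pi> -` V" using hk T[of s] unfolding s homeomorphism_def by blast
      then have "\<pi> w = fst (h w)" by (simp add: fst_h)
      then show "w \<in> \<pi> -` {abs_torus y}" by (simp add: s hkT[OF T])
    next
      fix w assume w: "w \<in> \<pi> -` {abs_torus y}"
      then have wV: "w \<in> \<pi> -` V" using T by auto
      then have hw: "h w \<in> V \<times> (\<pi> -` {abs_torus x0})" "k (h w) = w"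
        using hk by (auto simp: homeomorphism_def)
      then have "snd (h w) \<in> range c0" using c0'(3) by auto
      then obtain s where "snd (h w) = c0 s" by blast
      then have "h w = (abs_torus y, c0 s)" using fst_h[OF wV] w by (simp add: prod_eq_iff)
      then have "w = c (y, s)" using hw(2) by (simp add: c_def)
      then show "w \<in> range (\<lambda>s. c (y, s))" by blast
    qed
  qed
  have "continuous_on B (\<lambda>z. \<xi> (c z))" by (rule continuous_on_compose2[OF \<xi>(1) c_cont]) simp
  moreover have convB: "convex B" unfolding B_def by (intro convex_Times) auto
  ultimately obtain \<Theta> where \<Theta>: "continuous_on B \<Theta>" "\<And>z. z \<in> B \<Longrightarrow> \<xi> (c z) = cis (2 * pi * \<Theta> z)"
    using angle_lift[of B "\<lambda>z. \<xi> (c z)"] \<xi> by blast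
  define D where "D z = \<Theta> (fst z, snd z + 1) - \<Theta> z" for z
  have D_int: "D z \<in> \<int>" if z: "z \<in> B" for z
  proof -
    have z1: "(fst z, snd z + 1) \<in> B" using z by (auto simp: B_def)
    have "c (fst z, snd z + 1) = c z" using loop_param_shift[OF loop, of "fst z" "snd z"] z by (auto simp: B_def)
    then show ?thesis using \<Theta>(2)[OF z] \<Theta>(2)[OF z1] by (simp add: D_def cis_eq_cis_iff[symmetric])
  qed
  have D_cont: "continuous_on B D"
    unfolding D_def
    by (intro continuous_intros \<Theta>(1) continuous_on_compose2[OF \<Theta>(1)]) (auto simp: B_def)
  have x0B: "(x0, 0) \<in> B" using r by (simp add: B_def)
  have D_const: "D z = D (x0, 0)" if "z \<in> B" for z
    by (rule integer_valued_constant[OF convex_connected[OF convB] D_cont D_int that x0B])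
  obtain d where d: "D (x0, 0) = of_int d" using D_int[OF x0B] by (auto elim: Ints_cases)
  have "\<Theta> (y, s + 1) = \<Theta> (y, s) + of_int d" if "y \<in> ball x0 r" for y s
    using D_const[of "(y, s)"] that d by (simp add: B_def D_def)
  then have "local_family \<pi> \<xi> x0 r c \<Theta> d"
    unfolding local_family_def using r c_cont \<Theta> loop by (auto simp: B_def)
  then show ?thesis by blast
qed

lemma local_family_wind:
  assumes f: "local_family \<pi> \<xi> x0 r c \<Theta> d" and y: "y \<in> ball x0 r"
  shows "wind \<xi> (\<lambda>s. c (y, s)) d"
  unfolding wind_def
proof (intro exI[of _ "\<lambda>s. \<Theta> (y, s)"] conjI allI)
  have "continuous_on (ball x0 r \<times> UNIV) \<Theta>" using f by (simp add: local_family_def)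
  then show "continuous_on UNIV (\<lambda>s. \<Theta> (y, s))"
    by (rule continuous_on_compose2) (use y in \<open>auto intro!: continuous_intros\<close>)
qed (use f y in \<open>auto simp: local_family_def\<close>)

lemma local_family_loop:
  "local_family \<pi> \<xi> x0 r c \<Theta> d \<Longrightarrow> y \<in> ball x0 r \<Longrightarrow> loop_param (\<pi> -` {abs_torus y}) (\<lambda>s. c (y, s))"
  by (simp add: local_family_def)

text \<open>The modulus of the winding number does not depend on the parametrization and is constant in a local family. The base is
connected.\<close>

lemma winding_dichotomy:
  fixes \<pi> :: "'a::metric_space \<Rightarrow> 2 torus"
  assumes fib: "fibration \<pi>" and loops: "\<And>p. \<exists>c. loop_param (\<pi> -` {p}) c"
    and \<xi>: "continuous_on UNIV \<xi>" "\<And>w. norm (\<xi> w) = 1"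
  shows "(\<forall>p. \<exists>c. positive \<xi> (\<pi> -` {p}) c) \<or> (\<forall>p c. loop_param (\<pi> -` {p}) c \<longrightarrow> wind \<xi> c 0)"
proof -
  define Z where "Z = {p. \<exists>c. loop_param (\<pi> -` {p}) c \<and> wind \<xi> c 0}"
  have Z_iff: "p \<in> Z \<longleftrightarrow> d = 0" if c: "loop_param (\<pi> -` {p}) c" "wind \<xi> c d" for p c d
  proof
    assume "p \<in> Z"
    then obtain c' where c': "loop_param (\<pi> -` {p}) c'" "wind \<xi> c' 0" by (auto simp: Z_def)
    show "d = 0" using wind_pm[OF c'(1) c(1) c'(2) c(2)] by simp
  qed (use c in \<open>auto simp: Z_def\<close>)
  have loc: "\<exists>U. open U \<and> p \<in> U \<and> (U \<subseteq> Z \<or> U \<subseteq> - Z)" for p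
  proof -
    define x0 where "x0 = rep_torus p"
    obtain c0 where "loop_param (\<pi> -` {abs_torus x0}) c0" using loops by blast
    then obtain r c \<Theta> d where f: "local_family \<pi> \<xi> x0 r c \<Theta> d"
      using local_family_exists[OF fib _ \<xi>] by blast
    have *: "abs_torus y \<in> Z \<longleftrightarrow> d = 0" if "y \<in> ball x0 r" for y
      by (rule Z_iff[OF local_family_loop[OF f that] local_family_wind[OF f that]])
    have "r > 0" using f by (simp add: local_family_def)
    then have "p \<in> abs_torus ` ball x0 r" by (intro image_eqI[of _ _ x0]) (auto simp: x0_def)
    moreover have "open (abs_torus ` ball x0 r)" by (intro open_image_abs_torus open_ball)
    moreover have "abs_torus ` ball x0 r \<subseteq> Z \<or> abs_torus ` ball x0 r \<subseteq> - Z"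
      by (cases "d = 0") (use * in auto)
    ultimately show ?thesis by blast
  qed
  have "open Z" "open (- Z)"
    unfolding open_subopen[of Z] open_subopen[of "- Z"] using loc by (meson ComplD Compl_iff subset_iff)+
  then have "Z = {} \<or> Z = UNIV"
    using connected_UNIV_torus connected_clopen[of "UNIV :: 2 torus set"] by (auto simp: closed_open)
  then show ?thesis
  proof
    assume Z: "Z = {}"
    have "\<exists>c. positive \<xi> (\<pi> -` {p}) c" for p
    proof -
      obtain c where c: "loop_param (\<pi> -` {p}) c" using loops by blast
      obtain d where d: "wind \<xi> c d" using wind_exists[OF \<xi> c] by blast
      then have "d \<noteq> 0" using Z_iff[OF c d] Z by simp
      then show ?thesis using positive_exists[OF c d] by blast
    qed
    then show ?thesis by blast
  next
    assume Z: "Z = UNIV"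
    have "wind \<xi> c 0" if c: "loop_param (\<pi> -` {p}) c" for p c
    proof -
      obtain d where d: "wind \<xi> c d" using wind_exists[OF \<xi> c] by blast
      then show ?thesis using Z_iff[OF c d] Z by simp
    qed
    then show ?thesis by blast
  qed
qed

lemma continuous_on_fibre_Sup:
  fixes \<Theta> :: "'a::metric_space \<times> real \<Rightarrow> real"
  assumes C: "compact C" and \<Theta>: "continuous_on (C \<times> {0..1}) \<Theta>"
  shows "continuous_on C (\<lambda>y. Sup ((\<lambda>s. \<Theta> (y, s)) ` {0..1}))"
  unfolding continuous_on_iff
proof (intro ballI allI impI)
  fix y and e :: real assume y: "y \<in> C" and e: "e > 0"
  have "uniformly_continuous_on (C \<times> {0..1}) \<Theta>"
    by (rule compact_uniformly_continuous[OF \<Theta>]) (intro compact_Times C compact_Icc)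
  then obtain d where d: "d > 0" "\<And>z z'. z \<in> C \<times> {0..1} \<Longrightarrow> z' \<in> C \<times> {0..1} \<Longrightarrow> dist z' z < d \<Longrightarrow> dist (\<Theta> z') (\<Theta> z) < e / 2"
    unfolding uniformly_continuous_on_def using e by (metis half_gt_zero)
  have bdd: "bdd_above ((\<lambda>s. \<Theta> (v, s)) ` {0..1})" if "v \<in> C" for v
  proof -
    have "continuous_on {0..1} (\<lambda>s. \<Theta> (v, s))"
      by (rule continuous_on_compose2[OF \<Theta>]) (use that in \<open>auto intro!: continuous_intros\<close>)
    then show ?thesis by (intro bounded_imp_bdd_above compact_imp_bounded compact_continuous_image) auto
  qed
  have le: "Sup ((\<lambda>s. \<Theta> (u, s)) ` {0..1}) \<le> Sup ((\<lambda>s. \<Theta> (v, s)) ` {0..1}) + e / 2"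
    if uv: "u \<in> C" "v \<in> C" "dist u v < d" for u v
  proof (rule cSup_least)
    fix x assume "x \<in> (\<lambda>s. \<Theta> (u, s)) ` {0..1}"
    then obtain s where s: "s \<in> {0..1}" "x = \<Theta> (u, s)" by blast
    have "dist (\<Theta> (u, s)) (\<Theta> (v, s)) < e / 2"
      by (rule d(2)) (use uv s in \<open>auto simp: dist_Pair_Pair\<close>)
    moreover have "\<Theta> (v, s) \<le> Sup ((\<lambda>s. \<Theta> (v, s)) ` {0..1})" by (rule cSup_upper) (use s bdd uv in auto)
    ultimately show "x \<le> Sup ((\<lambda>s. \<Theta> (v, s)) ` {0..1}) + e / 2" using s(2) unfolding dist_real_def by linarith
  qed simp
  have "dist (Sup ((\<lambda>s. \<Theta> (v, s)) ` {0..1})) (Sup ((\<lambda>s. \<Theta> (y, s)) ` {0..1})) < e" if "v \<in> C" "dist v y < d" for v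
    using le[of v y] le[of y v] that y e unfolding dist_real_def by (simp add: dist_commute)
  then show "\<exists>d>0. \<forall>v\<in>C. dist v y < d \<longrightarrow> dist (Sup ((\<lambda>s. \<Theta> (v, s)) ` {0..1})) (Sup ((\<lambda>s. \<Theta> (y, s)) ` {0..1})) < e"
    using d(1) by blast
qed

lemma continuous_on_torus_iff: "continuous_on UNIV f \<longleftrightarrow> continuous_on UNIV (\<lambda>x. f (abs_torus x))"
  for f :: "'n::finite torus \<Rightarrow> 'b::topological_space"
proof
  assume "continuous_on UNIV (\<lambda>x. f (abs_torus x))"
  then have "open ((\<lambda>x. f (abs_torus x)) -` B)" if "open B" for B
    using that by (simp add: continuous_on_open_vimage)
  then show "continuous_on UNIV f"
    by (simp add: continuous_on_open_vimage open_torus_def vimage_def)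
qed (rule continuous_on_compose2[OF _ continuous_abs_torus], auto)

text \<open>If all winding numbers vanish, the angle of \<open>\<xi>\<close> has a real lift on each fibre, unique up to an integer. Subtracting
its maximum \<open>m\<close> over the fibre gives a canonical real function \<open>\<rho>\<close>, and the class of \<open>m\<close> modulo \<open>1\<close> is a
function \<open>\<tau>\<close> on the base. Continuity of both is checked in local families.\<close>

lemma zero_winding_factors:
  fixes \<pi> :: "'a::metric_space \<Rightarrow> 2 torus"
  assumes fib: "fibration \<pi>" and loops: "\<And>p. \<exists>c. loop_param (\<pi> -` {p}) c"
    and \<xi>: "continuous_on UNIV \<xi>" "\<And>w. norm (\<xi> w) = 1"
    and zero: "\<And>p c. loop_param (\<pi> -` {p}) c \<Longrightarrow> wind \<xi> c 0"
  shows "\<exists>\<rho> \<tau>. continuous_on UNIV \<rho> \<and> continuous_on UNIV \<tau> \<and> (\<forall>p. norm (\<tau> p) = 1) \<and>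
    (\<forall>w. \<xi> w = cis (2 * pi * \<rho> w) * \<tau> (\<pi> w))"
proof -
  have "\<exists>\<phi>. continuous_on (\<pi> -` {p}) \<phi> \<and> (\<forall>w\<in>\<pi> -` {p}. \<xi> w = cis (2 * pi * \<phi> w))" for p
  proof -
    obtain c where c: "loop_param (\<pi> -` {p}) c" using loops by blast
    obtain \<theta> where \<theta>: "continuous_on UNIV \<theta>" "\<And>s. \<xi> (c s) = cis (2 * pi * \<theta> s)" "\<And>s. \<theta> (s + 1) = \<theta> s + of_int 0"
      using zero[OF c] unfolding wind_def by blast
    define \<phi> where "\<phi> w = \<theta> (SOME s. c s = w)" for w
    have \<phi>: "\<phi> (c s) = \<theta> s" for s
    proof -
      define t where "t = (SOME t. c t = c s)"
      have "c t = c s" unfolding t_def by (rule someI) (rule refl)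
      then obtain n where "t - s = of_int n" using c by (auto simp: loop_param_def elim: Ints_cases)
      then have "t = s + of_int n" by simp
      then have "\<theta> t = \<theta> s" using shift_int[of \<theta>, OF \<theta>(3), of s n] by simp
      then show ?thesis by (simp add: \<phi>_def t_def)
    qed
    have "continuous_on (c ` {0..1}) \<phi>"
    proof (rule continuous_on_compact_image)
      show "continuous_on {0..1} c" using c by (auto simp: loop_param_def intro: continuous_on_subset)
      show "continuous_on {0..1} (\<lambda>s. \<phi> (c s))" unfolding \<phi> using \<theta>(1) continuous_on_subset by blast
    qed simp
    then have "continuous_on (\<pi> -` {p}) \<phi>" using loop_param_image[OF c] by simp
    moreover have "\<xi> w = cis (2 * pi * \<phi> w)" if w: "w \<in> \<pi> -` {p}" for w
    proof -
      have "w \<in> range c" using c w by (simp add: loop_param_def)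
      then obtain s where "w = c s" by blast
      then show ?thesis using \<phi> \<theta>(2) by simp
    qed
    ultimately show ?thesis by blast
  qed
  then obtain \<phi> where \<phi>: "\<And>p. continuous_on (\<pi> -` {p}) (\<phi> p)"
    "\<And>p w. w \<in> \<pi> -` {p} \<Longrightarrow> \<xi> w = cis (2 * pi * \<phi> p w)" by metis
  define m where "m p = Sup (\<phi> p ` (\<pi> -` {p}))" for p
  define \<rho> where "\<rho> w = \<phi> (\<pi> w) w - m (\<pi> w)" for w
  define \<tau> where "\<tau> p = cis (2 * pi * m p)" for p
  have loc: "\<exists>r>0. continuous_on (\<pi> -` (abs_torus ` cball x0 r)) \<rho> \<and> continuous_on (cball x0 r) (\<lambda>y. \<tau> (abs_torus y))" for x0
  proof -
    obtain c0 where "loop_param (\<pi> -` {abs_torus x0}) c0" using loops by blast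
    then obtain r c \<Theta> d where f: "local_family \<pi> \<xi> x0 r c \<Theta> d"
      using local_family_exists[OF fib _ \<xi>] by blast
    have r: "r > 0" using f by (simp add: local_family_def)
    have "wind \<xi> (\<lambda>s. c (x0, s)) 0" by (rule zero[OF local_family_loop[OF f]]) (use r in simp)
    moreover have "wind \<xi> (\<lambda>s. c (x0, s)) d" by (rule local_family_wind[OF f]) (use r in simp)
    ultimately have d: "d = 0" using wind_unique by blast
    define C where "C = cball x0 (r / 2)"
    have CB: "C \<subseteq> ball x0 r" using r by (auto simp: C_def)
    have cont\<Theta>: "continuous_on (C \<times> {0..1}) \<Theta>" and contc: "continuous_on (C \<times> {0..1}) c"
      using f CB unfolding local_family_def by (auto intro: continuous_on_subset)
    define \<mu> where "\<mu> y = Sup ((\<lambda>s. \<Theta> (y, s)) ` {0..1})" for y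
    have \<mu>_cont: "continuous_on C \<mu>"
      unfolding \<mu>_def by (rule continuous_on_fibre_Sup[OF _ cont\<Theta>]) (simp add: C_def)
    have key: "\<exists>n\<in>\<int>. m (abs_torus y) = \<mu> y + n \<and> (\<forall>s. \<phi> (abs_torus y) (c (y, s)) = \<Theta> (y, s) + n)" if y: "y \<in> C" for y
    proof -
      have yB: "y \<in> ball x0 r" using y CB by blast
      note loop = local_family_loop[OF f yB]
      have \<Theta>y: "continuous_on UNIV (\<lambda>s. \<Theta> (y, s))"
      proof -
        have "continuous_on (ball x0 r \<times> UNIV) \<Theta>" using f by (simp add: local_family_def)
        then show ?thesis by (rule continuous_on_compose2) (use yB in \<open>auto intro!: continuous_intros\<close>)
      qed
      have in_fibre: "c (y, s) \<in> \<pi> -` {abs_torus y}" for s by (rule loop_param_in[OF loop])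
      have "continuous_on UNIV (\<lambda>s. \<phi> (abs_torus y) (c (y, s)))"
        by (rule continuous_on_compose2[OF \<phi>(1)[of "abs_torus y"]]) (use loop in \<open>auto simp: loop_param_def\<close>)
      then have ct: "continuous_on UNIV (\<lambda>s. \<phi> (abs_torus y) (c (y, s)) - \<Theta> (y, s))"
        by (intro continuous_on_diff \<Theta>y)
      have int: "\<phi> (abs_torus y) (c (y, s)) - \<Theta> (y, s) \<in> \<int>" for s
        using \<phi>(2)[OF in_fibre, of s] f yB unfolding local_family_def by (metis cis_eq_cis_iff)
      define n where "n = \<phi> (abs_torus y) (c (y, 0)) - \<Theta> (y, 0)"
      have "\<phi> (abs_torus y) (c (y, s)) - \<Theta> (y, s) = n" for s
        unfolding n_def by (rule integer_valued_constant[OF connected_UNIV ct int]) auto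
      then have eq: "\<phi> (abs_torus y) (c (y, s)) = \<Theta> (y, s) + n" for s by (simp add: algebra_simps)
      have "\<phi> (abs_torus y) ` (\<pi> -` {abs_torus y}) = \<phi> (abs_torus y) ` (\<lambda>s. c (y, s)) ` {0..1}"
        using loop_param_image[OF loop] by simp
      also have "\<dots> = (\<lambda>x. x + n) ` (\<lambda>s. \<Theta> (y, s)) ` {0..1}"
        by (simp add: image_image eq)
      finally have "m (abs_torus y) = Sup ((\<lambda>x. x + n) ` (\<lambda>s. \<Theta> (y, s)) ` {0..1})" by (simp add: m_def)
      also have "\<dots> = \<mu> y + n"
      proof -
        have "bdd_above ((\<lambda>s. \<Theta> (y, s)) ` {0..1})"
          using \<Theta>y by (intro bounded_imp_bdd_above compact_imp_bounded compact_continuous_image) (auto intro: continuous_on_subset)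
        then show ?thesis
          unfolding \<mu>_def by (intro continuous_at_Sup_mono[symmetric]) (auto simp: mono_def intro!: continuous_intros)
      qed
      finally show ?thesis using eq int[of 0] unfolding n_def[symmetric] by blast
    qed
    have "continuous_on (c ` (C \<times> {0..1})) \<rho>"
    proof (rule continuous_on_compact_image)
      show "compact (C \<times> {0..1::real})" unfolding C_def by (intro compact_Times) auto
      have "\<rho> (c z) = \<Theta> z - \<mu> (fst z)" if z: "z \<in> C \<times> {0..1}" for z
      proof -
        obtain y s where z': "z = (y, s)" "y \<in> C" using z by auto
        have "c (y, s) \<in> \<pi> -` {abs_torus y}"
          using loop_param_in[OF local_family_loop[OF f, of y]] z' CB by blast
        then have "\<pi> (c (y, s)) = abs_torus y" by simp
        then show ?thesis using key[OF z'(2)] by (auto simp: \<rho>_def z'(1))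
      qed
      moreover have "continuous_on (C \<times> {0..1}) (\<lambda>z. \<Theta> z - \<mu> (fst z))"
        by (intro continuous_on_diff cont\<Theta> continuous_on_compose2[OF \<mu>_cont]) (auto intro: continuous_on_fst continuous_on_id)
      ultimately show "continuous_on (C \<times> {0..1}) (\<lambda>z. \<rho> (c z))" by (simp cong: continuous_on_cong)
    qed (rule contc)
    moreover have "\<pi> -` (abs_torus ` C) = c ` (C \<times> {0..1})"
    proof (intro equalityI subsetI)
      fix w assume "w \<in> \<pi> -` (abs_torus ` C)"
      then obtain y where y: "y \<in> C" "w \<in> \<pi> -` {abs_torus y}" by auto
      then have "w \<in> (\<lambda>s. c (y, s)) ` {0..1}"
        using loop_param_image[OF local_family_loop[OF f, of y]] CB by blast
      then show "w \<in> c ` (C \<times> {0..1})" using y by auto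
    next
      fix w assume "w \<in> c ` (C \<times> {0..1})"
      then obtain y s where ys: "y \<in> C" "w = c (y, s)" by auto
      then have "w \<in> \<pi> -` {abs_torus y}"
        using loop_param_in[OF local_family_loop[OF f, of y]] CB by blast
      then show "w \<in> \<pi> -` (abs_torus ` C)" using ys by auto
    qed
    ultimately have "continuous_on (\<pi> -` (abs_torus ` C)) \<rho>" by simp
    moreover have "continuous_on C (\<lambda>y. \<tau> (abs_torus y))"
    proof -
      have "\<tau> (abs_torus y) = cis (2 * pi * \<mu> y)" if y: "y \<in> C" for y
        using key[OF y] unfolding \<tau>_def cis_eq_cis_iff by auto
      moreover have "continuous_on C (\<lambda>y. cis (2 * pi * \<mu> y))" by (intro continuous_intros \<mu>_cont)
      ultimately show ?thesis by (simp cong: continuous_on_cong)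
    qed
    ultimately show ?thesis using r unfolding C_def by (intro exI[of _ "r / 2"]) simp
  qed
  have \<pi>_cont: "continuous_on UNIV \<pi>" using fib by (simp add: fibration_def)
  have "isCont \<rho> w" for w
  proof -
    define x0 where "x0 = rep_torus (\<pi> w)"
    obtain r where r: "r > 0" "continuous_on (\<pi> -` (abs_torus ` cball x0 r)) \<rho>" using loc by blast
    have "open (\<pi> -` (abs_torus ` ball x0 r))"
      using \<pi>_cont by (simp add: continuous_on_open_vimage open_image_abs_torus)
    moreover have "\<pi> -` (abs_torus ` ball x0 r) \<subseteq> \<pi> -` (abs_torus ` cball x0 r)" by auto
    moreover have "w \<in> \<pi> -` (abs_torus ` ball x0 r)"
      using r by (auto intro!: image_eqI[of _ _ x0] simp: x0_def)
    ultimately have "w \<in> interior (\<pi> -` (abs_torus ` cball x0 r))" by (meson interiorI)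
    then show ?thesis using r continuous_on_interior by blast
  qed
  then have "continuous_on UNIV \<rho>" by (simp add: continuous_at_imp_continuous_on)
  moreover have "isCont (\<lambda>y. \<tau> (abs_torus y)) x0" for x0
  proof -
    obtain r where r: "r > 0" "continuous_on (cball x0 r) (\<lambda>y. \<tau> (abs_torus y))" using loc by blast
    then show ?thesis using continuous_on_interior[OF r(2), of x0] by simp
  qed
  then have "continuous_on UNIV \<tau>"
    unfolding continuous_on_torus_iff by (simp add: continuous_at_imp_continuous_on)
  moreover have "\<xi> w = cis (2 * pi * \<rho> w) * \<tau> (\<pi> w)" for w
    using \<phi>(2)[of w "\<pi> w"] by (simp add: \<rho>_def \<tau>_def cis_mult algebra_simps)
  moreover have "norm (\<tau> p) = 1" for p by (simp add: \<tau>_def)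
  ultimately show ?thesis by blast
qed

definition third :: "3 torus \<Rightarrow> complex"
  where "third w = cis (2 * pi * rep_torus w $ 3)"

lemma third_abs: "third (abs_torus x) = cis (2 * pi * x $ 3)"
  unfolding third_def cis_eq_cis_iff by (rule rep_abs_diff)

lemma norm_third: "norm (third w) = 1" by (simp add: third_def)

lemma continuous_third: "continuous_on UNIV third"
  unfolding continuous_on_torus_iff third_abs by (intro continuous_intros)

text \<open>The third coordinate winds once around the circle \<open>t \<mapsto> (0, 0, t)\<close>.\<close>

lemma third_has_no_lift:
  assumes R: "continuous_on UNIV R" shows "\<exists>w. third w \<noteq> cis (2 * pi * R w)"
proof (rule ccontr)
  assume "\<not> ?thesis"
  then have eq: "third w = cis (2 * pi * R w)" for w by blast
  define e :: "real \<Rightarrow> real ^ 3" where "e t = t *\<^sub>R axis 3 1" for t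
  have e3: "e t $ 3 = t" for t by (simp add: e_def axis_def)
  have e_cont: "continuous_on UNIV e"
    unfolding e_def by (intro continuous_intros)
  define f where "f t = t - R (abs_torus (e t))" for t
  have int: "f t \<in> \<int>" for t
    using eq[of "abs_torus (e t)"] unfolding third_abs e3 f_def cis_eq_cis_iff .
  have "continuous_on UNIV f"
    unfolding f_def by (intro continuous_intros continuous_on_compose2[OF R] e_cont) auto
  then have "f 1 = f 0" by (rule integer_valued_constant[OF connected_UNIV _ int]) auto
  moreover have "abs_torus (e 1) = abs_torus (e 0)"
    unfolding abs_torus_eq_iff by (auto simp: e_def axis_def)
  ultimately show False by (simp add: f_def)
qed

definition mat2 :: "real ^ 2 ^ 2"
  where "mat2 = vector [vector [2, 1], vector [1, 1]]"

lemma mat2_Ints: "mat2 $ i $ j \<in> \<int>"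
proof -
  have "\<forall>i j. mat2 $ i $ j \<in> \<int>" unfolding mat2_def forall_2 by simp
  then show ?thesis by blast
qed

lemma A2_abs: "A2 (abs_torus y) = abs_torus (mat2 *v y)"
  using toral_map_abs_torus[OF mat2_Ints] by (simp add: A2_def mat2_def)

lemma mat2_mult: "(mat2 *v y) $ 1 = 2 * y $ 1 + y $ 2" "(mat2 *v y) $ 2 = y $ 1 + y $ 2"
  by (simp_all add: mat2_def matrix_vector_mult_def sum_2)

lemma Cayley_Hamilton_mat2: "mat2 *v (mat2 *v y) + y = mat2 *v y + mat2 *v y + mat2 *v y"
  unfolding vec_eq_iff forall_2 by (simp add: mat2_mult)

lemma mat2_Ints_vec: "\<forall>i. e $ i \<in> \<int> \<Longrightarrow> \<forall>i. (mat2 *v e) $ i \<in> \<int>"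
  unfolding forall_2 by (auto simp: mat2_mult)

text \<open>Suppose some winding number is zero; then all are, and the third coordinate is, up to a real function, pulled
back from a circle-valued \<open>\<tau>\<close> on the base. Let \<open>u\<close> be a lift of \<open>\<tau>\<close> to the plane. Its increments along integer vectors are additive, so by
Cayley-Hamilton, \<open>A\<^sup>2 - 3 A + 1 = 0\<close>, the function \<open>U\<close> is periodic. On the other hand \<open>g\<close> preserves
the third coordinate up to a real function, so the same combination of the third coordinate composed with \<open>g\<^sup>2\<close>,
\<open>g\<close> and the identity is, up to real functions, \<open>1 - 3 + 1 = -1\<close> times that coordinate. Hence the third coordinate itself
has a real lift, contrary to \<open>third_has_no_lift\<close>.\<close>

theorem fibres_positive:
  fixes \<pi> :: "3 torus \<Rightarrow> 2 torus"
  assumes fib: "fibration \<pi>" and loops: "\<And>p. \<exists>c. loop_param (\<pi> -` {p}) c"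
    and g: "continuous_on UNIV g" and equiv: "\<And>w. \<pi> (g w) = A2 (\<pi> w)"
    and \<delta>: "continuous_on UNIV \<delta>" "\<And>w. third (g w) = third w * cis (2 * pi * \<delta> w)"
  shows "\<exists>c. positive third (\<pi> -` {p}) c"
proof (rule ccontr)
  assume "\<not> ?thesis"
  then have "\<And>p c. loop_param (\<pi> -` {p}) c \<Longrightarrow> wind third c 0"
    using winding_dichotomy[OF fib loops continuous_third norm_third] by blast
  then obtain \<rho> \<tau> where \<rho>: "continuous_on UNIV \<rho>" and \<tau>: "continuous_on UNIV \<tau>" "\<And>p. norm (\<tau> p) = 1"
    and eq: "\<And>w. third w = cis (2 * pi * \<rho> w) * \<tau> (\<pi> w)"
    using zero_winding_factors[OF fib loops continuous_third norm_third] by blast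
  have "continuous_on UNIV (\<lambda>y. \<tau> (abs_torus y))" using \<tau>(1) continuous_on_torus_iff by blast
  then obtain u where u: "continuous_on UNIV u" "\<And>y. \<tau> (abs_torus y) = cis (2 * pi * u y)"
    using angle_lift[of UNIV "\<lambda>y. \<tau> (abs_torus y)"] \<tau>(2) by auto
  define N where "N e = u e - u 0" for e :: "real ^ 2"
  have N: "u (y + e) = u y + N e" if e: "\<forall>i. e $ i \<in> \<int>" for y e
  proof -
    have int: "u (y + e) - u y \<in> \<int>" for y
      using u(2)[of y] u(2)[of "y + e"] by (simp add: cis_eq_cis_iff[symmetric] abs_torus_add_Ints[OF e])
    have "continuous_on UNIV (\<lambda>y. u (y + e) - u y)"
      by (intro continuous_intros u(1) continuous_on_compose2[OF u(1)]) auto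
    then have "u (y + e) - u y = u (0 + e) - u 0"
      by (rule integer_valued_constant[OF connected_UNIV _ int]) auto
    then show ?thesis by (simp add: N_def)
  qed
  have N_add: "N (e + f) = N e + N f" if "\<forall>i. f $ i \<in> \<int>" for e f
    using N[OF that, of e] by (simp add: N_def)
  let ?A = "\<lambda>y. mat2 *v y"
  define U where "U y = u (?A (?A y)) - 3 * u (?A y) + u y" for y
  have A_cont: "continuous_on UNIV ?A" by (intro linear_continuous_on matrix_vector_mul_bounded_linear)
  have uA: "continuous_on UNIV (\<lambda>y. u (?A y))" by (rule continuous_on_compose2[OF u(1) A_cont]) simp
  have uAA: "continuous_on UNIV (\<lambda>y. u (?A (?A y)))"
    by (rule continuous_on_compose2[OF uA A_cont]) simp
  have U_cont: "continuous_on UNIV U" unfolding U_def by (intro continuous_intros uA uAA u(1))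
  have U_per: "U (y + e) = U y" if e: "\<forall>i. e $ i \<in> \<int>" for y e
  proof -
    have e1: "\<forall>i. ?A e $ i \<in> \<int>" and e2: "\<forall>i. ?A (?A e) $ i \<in> \<int>"
      using mat2_Ints_vec e by blast+
    have "N (?A (?A e)) + N e = N (?A (?A e) + e)" using N_add[OF e] by simp
    also have "\<dots> = N (?A e) + N (?A e) + N (?A e)"
      unfolding Cayley_Hamilton_mat2 by (simp only: N_add[OF e1])
    finally have "N (?A (?A e)) + N e = 3 * N (?A e)" by simp
    then show ?thesis
      unfolding U_def matrix_vector_right_distrib N[OF e] N[OF e1] N[OF e2] by simp
  qed
  define \<sigma> where "\<sigma> p = U (rep_torus p)" for p
  have \<sigma>: "\<sigma> (abs_torus y) = U y" for y
  proof -
    define e where "e = rep_torus (abs_torus y) - y"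
    have "\<forall>i. e $ i \<in> \<int>" using rep_abs_diff[of y] by (simp add: e_def)
    from U_per[OF this, of y] show ?thesis by (simp add: \<sigma>_def e_def)
  qed
  have \<sigma>_cont: "continuous_on UNIV \<sigma>" unfolding continuous_on_torus_iff \<sigma> by (rule U_cont)
  have \<pi>_cont: "continuous_on UNIV \<pi>" using fib by (simp add: fibration_def)
  define R where "R w = \<delta> (g w) - 2 * \<delta> w - (\<rho> (g (g w)) - 3 * \<rho> (g w) + \<rho> w) - \<sigma> (\<pi> w)" for w
  have "third w = cis (2 * pi * R w)" for w
  proof -
    obtain y where y: "\<pi> w = abs_torus y" by (metis abs_rep_torus)
    obtain a where a: "third w = cis (2 * pi * a)" unfolding third_def by blast
    have p1: "\<pi> (g w) = abs_torus (?A y)" by (simp add: equiv y A2_abs)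
    have p2: "\<pi> (g (g w)) = abs_torus (?A (?A y))" by (simp only: equiv[of "g w"] p1 A2_abs)
    have t1: "third (g w) = cis (2 * pi * (a + \<delta> w))" by (simp add: \<delta>(2) a cis_mult distrib_left)
    have t2: "third (g (g w)) = cis (2 * pi * (a + \<delta> w + \<delta> (g w)))" by (simp add: \<delta>(2) a cis_mult distrib_left add.assoc)
    have "third w = cis (2 * pi * (\<rho> w + u y))" by (simp add: eq y u(2) cis_mult distrib_left)
    then have i0: "a - (\<rho> w + u y) \<in> \<int>" unfolding a cis_eq_cis_iff .
    have "third (g w) = cis (2 * pi * (\<rho> (g w) + u (?A y)))"
      by (simp add: eq p1 u(2) cis_mult distrib_left del: equiv)
    then have i1: "(a + \<delta> w) - (\<rho> (g w) + u (?A y)) \<in> \<int>" unfolding t1 cis_eq_cis_iff .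
    have "third (g (g w)) = cis (2 * pi * (\<rho> (g (g w)) + u (?A (?A y))))"
      by (simp add: eq p2 u(2) cis_mult distrib_left del: equiv)
    then have i2: "(a + \<delta> w + \<delta> (g w)) - (\<rho> (g (g w)) + u (?A (?A y))) \<in> \<int>" unfolding t2 cis_eq_cis_iff .
    have "3 * ((a + \<delta> w) - (\<rho> (g w) + u (?A y))) - ((a + \<delta> w + \<delta> (g w)) - (\<rho> (g (g w)) + u (?A (?A y))))
        - (a - (\<rho> w + u y)) \<in> \<int>"
      by (intro Ints_diff Ints_mult Ints_numeral i0 i1 i2)
    also have "3 * ((a + \<delta> w) - (\<rho> (g w) + u (?A y))) - ((a + \<delta> w + \<delta> (g w)) - (\<rho> (g (g w)) + u (?A (?A y))))
        - (a - (\<rho> w + u y)) = a - R w"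
      by (simp add: R_def y \<sigma> U_def algebra_simps)
    finally show ?thesis unfolding a cis_eq_cis_iff .
  qed
  moreover have "continuous_on UNIV R"
  proof -
    have "continuous_on UNIV (\<lambda>w. g (g w))" by (rule continuous_on_compose2[OF g g]) simp
    then show ?thesis
      unfolding R_def
      by (intro continuous_intros \<delta>(1) \<rho> continuous_on_compose2[OF \<delta>(1) g] continuous_on_compose2[OF \<rho> g]
        continuous_on_compose2[OF \<rho>, of UNIV "\<lambda>w. g (g w)"] continuous_on_compose2[OF \<sigma>_cont \<pi>_cont]) auto
  qed
  ultimately show False using third_has_no_lift by blast
qed

text \<open>The cyclic order of the fibres: \<open>y\<close> lies on the positively oriented arc from \<open>b\<close> to \<open>w\<close>. The arc contains
\<open>b\<close> but not \<open>w\<close>, so that counting points on it numbers them from \<open>0\<close>.\<close>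

definition cyclic_arcs :: "('a::metric_space \<Rightarrow> 2 torus) \<Rightarrow> ('a \<Rightarrow> complex) \<Rightarrow> ('a \<times> 'a \<times> 'a) set"
  where "cyclic_arcs \<pi> \<xi> = {(c s, c t, c u) | p c s t u. positive \<xi> (\<pi> -` {p}) c \<and> s \<le> t \<and> t < u \<and> u < s + 1}"

lemma local_family_reverse:
  assumes f: "local_family \<pi> \<xi> x0 r c \<Theta> d"
  shows "local_family \<pi> \<xi> x0 r (\<lambda>z. c (fst z, - snd z)) (\<lambda>z. \<Theta> (fst z, - snd z)) (- d)"
proof -
  have cont: "continuous_on (ball x0 r \<times> UNIV) c" "continuous_on (ball x0 r \<times> UNIV) \<Theta>"
    using f by (auto simp: local_family_def)
  have m: "continuous_on (ball x0 r \<times> UNIV) (\<lambda>z :: (real ^ 2) \<times> real. (fst z, - snd z))" by (intro continuous_intros)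
  have "continuous_on (ball x0 r \<times> UNIV) (\<lambda>z. c (fst z, - snd z))"
    by (rule continuous_on_compose2[OF cont(1) m]) auto
  moreover have "continuous_on (ball x0 r \<times> UNIV) (\<lambda>z. \<Theta> (fst z, - snd z))"
    by (rule continuous_on_compose2[OF cont(2) m]) auto
  moreover have "loop_param (\<pi> -` {abs_torus y}) (\<lambda>s. c (y, - s))" if "y \<in> ball x0 r" for y
    by (rule loop_param_reverse[OF local_family_loop[OF f that]])
  moreover have "\<Theta> (y, - (s + 1)) = \<Theta> (y, - s) + of_int (- d)" if "y \<in> ball x0 r" for y s
  proof -
    have "\<Theta> (y, (- s - 1) + 1) = \<Theta> (y, - s - 1) + of_int d" using f that unfolding local_family_def by blast
    then show ?thesis by simp
  qed
  ultimately show ?thesis using f unfolding local_family_def by simp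
qed

text \<open>Over a local family the relation is the continuous image of a set of parameters that is a countable union
of compact sets; finitely many local families cover the base.\<close>

lemma cyclic_arcs_borel:
  fixes \<pi> :: "'a::metric_space \<Rightarrow> 2 torus"
  assumes fib: "fibration \<pi>" and pos: "\<And>p. \<exists>c. positive \<xi> (\<pi> -` {p}) c"
    and \<xi>: "continuous_on UNIV \<xi>" "\<And>w. norm (\<xi> w) = 1"
  shows "cyclic_arcs \<pi> \<xi> \<in> sets borel"
proof -
  have "\<exists>r c \<Theta> d. d > 0 \<and> local_family \<pi> \<xi> x0 r c \<Theta> d" for x0
  proof -
    obtain c0 d0 where c0: "loop_param (\<pi> -` {abs_torus x0}) c0" "wind \<xi> c0 d0" "d0 > 0"
      using pos unfolding positive_def by blast
    obtain r c \<Theta> d where f: "local_family \<pi> \<xi> x0 r c \<Theta> d"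
      using local_family_exists[OF fib c0(1) \<xi>] by blast
    have x0: "x0 \<in> ball x0 r" using f by (simp add: local_family_def)
    have "d = d0 \<or> d = - d0"
      by (rule wind_pm[OF c0(1) local_family_loop[OF f x0] c0(2) local_family_wind[OF f x0]])
    then show ?thesis
    proof
      assume "d = d0" then show ?thesis using f c0(3) by blast
    next
      assume "d = - d0"
      then have "- d > 0" using c0(3) by simp
      then show ?thesis using local_family_reverse[OF f] by blast
    qed
  qed
  then obtain r c \<Theta> d where d: "\<And>x0. d x0 > 0" and f: "\<And>x0. local_family \<pi> \<xi> x0 (r x0) (c x0) (\<Theta> x0) (d x0)"
    by metis
  have r: "r x0 > 0" for x0 using f[of x0] by (simp add: local_family_def)
  have posf: "positive \<xi> (\<pi> -` {abs_torus y}) (\<lambda>s. c x0 (y, s))" if "y \<in> ball x0 (r x0)" for y x0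
    using local_family_loop[OF f that] local_family_wind[OF f that] d unfolding positive_def by blast
  define V where "V x0 = abs_torus ` ball x0 (r x0)" for x0
  have "\<exists>F. finite F \<and> (UNIV :: 2 torus set) \<subseteq> (\<Union>x0\<in>F. V x0)"
  proof (rule compactE_image[OF compact_UNIV_torus, of UNIV V])
    show "open (V x0)" for x0 unfolding V_def by (intro open_image_abs_torus open_ball)
    show "(UNIV :: 2 torus set) \<subseteq> (\<Union>x0. V x0)"
    proof
      fix p :: "2 torus"
      have "p \<in> V (rep_torus p)" unfolding V_def by (rule image_eqI[of _ _ "rep_torus p"]) (use r in auto)
      then show "p \<in> (\<Union>x0. V x0)" by blast
    qed
    fix F assume "finite F" "(UNIV :: 2 torus set) \<subseteq> (\<Union>x0\<in>F. V x0)"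
    then show "\<exists>F. finite F \<and> (UNIV :: 2 torus set) \<subseteq> (\<Union>x0\<in>F. V x0)" by (intro exI conjI)
  qed
  then obtain F where F: "finite F" "(UNIV :: 2 torus set) \<subseteq> (\<Union>x0\<in>F. V x0)" by blast
  define B where "B x0 m = cball x0 (r x0 - 1 / Suc m) \<times> {- real m..real m} \<times> {- real m..real m + 1} \<times> {- real m..real m + 1}" for x0 m
  define S where "S x0 m = B x0 m \<inter> {z. fst (snd z) \<le> fst (snd (snd z)) \<and>
    fst (snd (snd z)) + 1 / Suc m \<le> snd (snd (snd z)) \<and> snd (snd (snd z)) \<le> fst (snd z) + 1 - 1 / Suc m}" for x0 m
  have S_compact: "compact (S x0 m)" for x0 m
    unfolding S_def B_def
    by (intro compact_Int_closed compact_Times compact_cball compact_Icc closed_Collect_conj closed_Collect_le continuous_intros)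
  have S_iff: "(y, s, t, u) \<in> S x0 m \<longleftrightarrow> dist x0 y \<le> r x0 - 1 / Suc m \<and> \<bar>s\<bar> \<le> m \<and> s \<le> t \<and> t + 1 / Suc m \<le> u \<and> u \<le> s + 1 - 1 / Suc m"
    for y s t u x0 m
  proof -
    have "1 / real (Suc m) > 0" by simp
    note e = this
    show ?thesis unfolding S_def B_def
      by (auto simp: abs_le_iff simp del: of_nat_Suc) (use e in linarith)+
  qed
  define \<Phi> where "\<Phi> x0 z = (c x0 (fst z, fst (snd z)), c x0 (fst z, fst (snd (snd z))), c x0 (fst z, snd (snd (snd z))))" for x0 z
  have "continuous_on (S x0 m) (\<Phi> x0)" for x0 m
  proof -
    have cc: "continuous_on (ball x0 (r x0) \<times> UNIV) (c x0)" using f by (simp add: local_family_def)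
    have fst_in: "fst z \<in> ball x0 (r x0)" if "z \<in> S x0 m" for z
    proof -
      have e: "0 < 1 / real (Suc m)" by simp
      obtain y s t u where z: "z = (y, s, t, u)" by (cases z) auto
      have "dist x0 y < r x0" using that[unfolded z S_iff] e by linarith
      then show ?thesis using z by simp
    qed
    show ?thesis
      unfolding \<Phi>_def
      by (intro continuous_on_Pair; rule continuous_on_compose2[OF cc]; (intro continuous_intros)?) (use fst_in in auto)
  qed
  then have "compact (\<Phi> x0 ` S x0 m)" for x0 m by (intro compact_continuous_image S_compact)
  then have "\<Phi> x0 ` S x0 m \<in> sets borel" for x0 m by (intro borel_closed compact_imp_closed)
  then have b: "(\<Union>m. \<Phi> x0 ` S x0 m) \<in> sets borel" for x0 by (intro sets.countable_UN) auto
  have borel: "(\<Union>x0\<in>F. \<Union>m. \<Phi> x0 ` S x0 m) \<in> sets borel"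
    by (rule sets.finite_UN[OF F(1)]) (rule b)
  have "cyclic_arcs \<pi> \<xi> = (\<Union>x0\<in>F. \<Union>m. \<Phi> x0 ` S x0 m)"
  proof (intro equalityI subsetI)
    fix q assume "q \<in> cyclic_arcs \<pi> \<xi>"
    then obtain p c' s t u where q: "q = (c' s, c' t, c' u)" and c': "positive \<xi> (\<pi> -` {p}) c'"
      and ord: "s \<le> t" "t < u" "u < s + 1" unfolding cyclic_arcs_def by blast
    obtain x0 where x0: "x0 \<in> F" "p \<in> V x0" using F(2) by blast
    then obtain y where y: "y \<in> ball x0 (r x0)" "p = abs_torus y" unfolding V_def by blast
    obtain h where h: "strict_mono h" "\<And>s. h (s + 1) = h s + 1" "\<And>s. c' s = c x0 (y, h s)"
      using positive_reparam[OF posf[OF y(1)] c'[unfolded y(2)]] by blast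
    have ord': "h s \<le> h t" "h t < h u" "h u < h s + 1"
      using ord h(1) h(2)[of s] by (metis strict_mono_less_eq, metis strict_mono_less, metis strict_mono_less)
    \<comment> \<open>The margin in the strict inequalities, which decides the index of the compact set.\<close>
    define e where "e = min (r x0 - dist x0 y) (min (h u - h t) (h s + 1 - h u))"
    have "e > 0" using y ord' by (simp add: e_def)
    then obtain m1 where m1: "1 / Suc m1 < e" using nat_approx_posE by blast
    obtain m2 :: nat where m2: "\<bar>h s\<bar> \<le> m2" using real_arch_simple by blast
    define m where "m = max m1 m2"
    have "1 / real (Suc m) \<le> 1 / real (Suc m1)" by (intro divide_left_mono) (auto simp: m_def)
    then have me: "1 / Suc m < e" using m1 by linarith
    have "\<bar>h s\<bar> \<le> m" using m2 by (simp add: m_def)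
    moreover have "1 / Suc m < r x0 - dist x0 y" "1 / Suc m < h u - h t" "1 / Suc m < h s + 1 - h u"
      using me by (simp_all add: e_def)
    ultimately have "(y, h s, h t, h u) \<in> S x0 m" unfolding S_iff using ord'(1) by (intro conjI) linarith+
    moreover have "q = \<Phi> x0 (y, h s, h t, h u)" by (simp add: \<Phi>_def q h(3))
    ultimately show "q \<in> (\<Union>x0\<in>F. \<Union>m. \<Phi> x0 ` S x0 m)" using x0(1) by blast
  next
    fix q assume "q \<in> (\<Union>x0\<in>F. \<Union>m. \<Phi> x0 ` S x0 m)"
    then obtain x0 m y s t u where S: "(y, s, t, u) \<in> S x0 m" and q: "q = (c x0 (y, s), c x0 (y, t), c x0 (y, u))"
      by (auto simp: \<Phi>_def)
    have m: "0 < 1 / real (Suc m)" by simp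
    have "dist x0 y < r x0" "s \<le> t" "t < u" "u < s + 1" using S m unfolding S_iff by linarith+
    then show "q \<in> cyclic_arcs \<pi> \<xi>" unfolding cyclic_arcs_def using posf[of y x0] q
      by (intro CollectI exI[of _ "abs_torus y"] exI[of _ "\<lambda>s. c x0 (y, s)"] exI[of _ s] exI[of _ t] exI[of _ u]) auto
  qed
  then show ?thesis using borel by simp
qed

section \<open>Toral automorphisms preserve Haar measure\<close>

definition unit_cube :: "(real ^ 'n) set"
  where "unit_cube = {x. \<forall>i. x $ i \<in> {0..<1}}"

definition int_vecs :: "(real ^ 'n) set"
  where "int_vecs = {m. \<forall>i. m $ i \<in> \<int>}"

lemma unit_cube_borel [measurable]: "(unit_cube :: (real ^ 'n) set) \<in> sets borel"
proof -
  have "(unit_cube :: (real ^ 'n) set) = (\<Inter>i\<in>UNIV. {x :: real ^ 'n. 0 \<le> x $ i} \<inter> {x. x $ i < 1})"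
    by (auto simp: unit_cube_def)
  moreover have "\<dots> \<in> sets borel"
    by (intro sets.finite_INT sets.Int borel_closed borel_open closed_Collect_le open_Collect_less continuous_intros) auto
  ultimately show ?thesis by simp
qed

lemma bounded_unit_cube: "bounded (unit_cube :: (real ^ 'n) set)"
proof (rule bounded_subset[OF bounded_cbox])
  show "unit_cube \<subseteq> cbox 0 (1 :: real ^ 'n)" by (auto simp: unit_cube_def mem_box_cart less_imp_le)
qed

lemma countable_int_vecs: "countable (int_vecs :: (real ^ 'n) set)"
proof -
  have "int_vecs \<subseteq> range (\<lambda>f :: 'n \<Rightarrow> int. \<chi> i. real_of_int (f i))"
  proof
    fix m :: "real ^ 'n" assume "m \<in> int_vecs"
    then have "m = (\<chi> i. real_of_int \<lfloor>m $ i\<rfloor>)" by (auto simp: int_vecs_def vec_eq_iff elim: Ints_cases)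
    then show "m \<in> range (\<lambda>f :: 'n \<Rightarrow> int. \<chi> i. real_of_int (f i))"
      by (rule range_eqI[of _ _ "\<lambda>i. \<lfloor>m $ i\<rfloor>"])
  qed
  moreover have "countable (UNIV :: ('n \<Rightarrow> int) set)"
  proof -
    have "countable (PiE (UNIV :: 'n set) (\<lambda>_. UNIV :: int set))" by (rule countable_PiE) auto
    then show ?thesis by (simp add: PiE_UNIV_domain)
  qed
  ultimately show ?thesis by (meson countable_image countable_subset)
qed

lemma unit_cube_translate:
  fixes x :: "real ^ 'n"
  shows "\<exists>m\<in>int_vecs. m + x \<in> unit_cube \<and> (\<forall>m'\<in>int_vecs. m' + x \<in> unit_cube \<longrightarrow> m' = m)"
proof (intro bexI conjI ballI impI)
  let ?m = "(\<chi> i. - of_int \<lfloor>x $ i\<rfloor>) :: real ^ 'n"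
  show "?m \<in> int_vecs" by (simp add: int_vecs_def)
  show "?m + x \<in> unit_cube" by (auto simp: unit_cube_def) linarith+
  fix m' :: "real ^ 'n" assume m': "m' \<in> int_vecs" "m' + x \<in> unit_cube"
  show "m' = ?m"
    unfolding vec_eq_iff
  proof
    fix i
    obtain n where n: "m' $ i = of_int n" using m'(1) by (auto simp: int_vecs_def elim: Ints_cases)
    have "0 \<le> of_int n + x $ i" "of_int n + x $ i < 1" using m'(2) n by (auto simp: unit_cube_def) (metis add.commute vector_add_component)+
    then have "\<lfloor>x $ i\<rfloor> = - n" by linarith
    then show "m' $ i = ?m $ i" using n by simp
  qed
qed

lemma sets_torus_haar: "sets torus_haar = sets borel" and space_torus_haar: "space torus_haar = UNIV"
  by (simp_all add: torus_haar_def)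

lemma measurable_torus_haar: "f \<in> measurable borel N \<Longrightarrow> f \<in> measurable torus_haar N"
  using measurable_cong_sets[OF sets_torus_haar refl] by blast

lemma emeasure_torus_haar:
  assumes "E \<in> sets borel"
  shows "emeasure torus_haar E = emeasure lborel (unit_cube \<inter> abs_torus -` E)"
proof -
  have abs_m: "abs_torus \<in> borel_measurable borel" by (rule borel_measurable_continuous_onI[OF continuous_abs_torus])
  have "abs_torus \<in> measurable (restrict_space lborel unit_cube) borel"
    by (rule measurable_restrict_space1) (use abs_m in simp)
  then have "emeasure torus_haar E = emeasure (restrict_space lborel unit_cube) (abs_torus -` E \<inter> unit_cube)"
    unfolding torus_haar_def unit_cube_def[symmetric]
    by (subst emeasure_distr) (use assms in \<open>auto simp: space_restrict_space\<close>)
  also have "\<dots> = emeasure lborel (abs_torus -` E \<inter> unit_cube)"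
    by (rule emeasure_restrict_space) auto
  finally show ?thesis by (simp add: Int_commute)
qed

lemma emeasure_lborel_translate:
  fixes S :: "(real ^ 'n) set"
  assumes "S \<in> sets borel" shows "emeasure lborel ((\<lambda>x. m + x) -` S) = emeasure lborel S"
proof -
  have "emeasure (distr lborel borel (\<lambda>x. m + x)) S = emeasure lborel ((\<lambda>x. m + x) -` S)"
    using assms by (subst emeasure_distr) auto
  then show ?thesis by (simp add: lborel_distr_plus)
qed

text \<open>Cut \<open>D\<close> along the translates of the unit cube and move the pieces into the cube. They tile it because
\<open>D\<close> is a fundamental domain, and translation changes neither Lebesgue measure nor the periodic set
\<open>P\<close>.\<close>

lemma fundamental_domain_emeasure:
  fixes D P :: "(real ^ 'n) set"
  assumes D [measurable]: "D \<in> sets borel" and P [measurable]: "P \<in> sets borel"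
    and per: "\<And>m x. m \<in> int_vecs \<Longrightarrow> m + x \<in> P \<longleftrightarrow> x \<in> P"
    and ex: "\<And>x. \<exists>m\<in>int_vecs. m + x \<in> D"
    and uniq: "\<And>x m m'. m \<in> int_vecs \<Longrightarrow> m' \<in> int_vecs \<Longrightarrow> m + x \<in> D \<Longrightarrow> m' + x \<in> D \<Longrightarrow> m = m'"
  shows "emeasure lborel (D \<inter> P) = emeasure lborel (unit_cube \<inter> P)"
proof -
  have tr [measurable]: "(\<lambda>x. m + x) -` S \<in> sets borel" if "S \<in> sets borel" for m and S :: "(real ^ 'n) set"
  proof -
    have "(\<lambda>x. m + x) \<in> borel_measurable borel" by measurable
    from measurable_sets[OF this that] show ?thesis by simp
  qed
  have neg: "m \<in> int_vecs \<Longrightarrow> - m \<in> int_vecs" for m :: "real ^ 'n" by (simp add: int_vecs_def)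
  have "emeasure lborel (D \<inter> P) = emeasure lborel (\<Union>m\<in>int_vecs. D \<inter> P \<inter> (\<lambda>x. - m + x) -` unit_cube)"
  proof (rule arg_cong[of _ _ "emeasure lborel"], intro equalityI subsetI)
    fix x assume x: "x \<in> D \<inter> P"
    obtain m where m: "m \<in> int_vecs" "m + x \<in> unit_cube" using unit_cube_translate[of x] by blast
    then show "x \<in> (\<Union>m\<in>int_vecs. D \<inter> P \<inter> (\<lambda>x. - m + x) -` unit_cube)"
      using x neg by (intro UN_I[of "- m"]) auto
  qed auto
  also have "\<dots> = (\<integral>\<^sup>+m. emeasure lborel (D \<inter> P \<inter> (\<lambda>x. - m + x) -` unit_cube) \<partial>count_space int_vecs)"
  proof (rule emeasure_UN_countable)
    show "disjoint_family_on (\<lambda>m. D \<inter> P \<inter> (\<lambda>x. - m + x) -` unit_cube) int_vecs"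
      unfolding disjoint_family_on_def
    proof (intro ballI impI equalityI subsetI)
      fix m m' :: "real ^ 'n" and x assume m: "m \<in> int_vecs" "m' \<in> int_vecs" "m \<noteq> m'"
        and x: "x \<in> (D \<inter> P \<inter> (\<lambda>x. - m + x) -` unit_cube) \<inter> (D \<inter> P \<inter> (\<lambda>x. - m' + x) -` unit_cube)"
      obtain n where n: "\<And>m'. m' \<in> int_vecs \<Longrightarrow> m' + x \<in> unit_cube \<Longrightarrow> m' = n"
        using unit_cube_translate[of x] by blast
      have "- m = n" "- m' = n" using n[of "- m"] n[of "- m'"] neg m x by auto
      then have "m = m'" by (metis minus_minus)
      then show "x \<in> {}" using m(3) by simp
    qed simp
  qed (auto simp: countable_int_vecs)
  also have "\<dots> = (\<integral>\<^sup>+m. emeasure lborel (unit_cube \<inter> P \<inter> (\<lambda>x. m + x) -` D) \<partial>count_space int_vecs)"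
  proof (rule nn_integral_cong)
    fix m :: "real ^ 'n" assume "m \<in> space (count_space int_vecs)"
    then have m: "m \<in> int_vecs" by simp
    have "(\<lambda>x. m + x) -` (D \<inter> P \<inter> (\<lambda>x. - m + x) -` unit_cube) = unit_cube \<inter> P \<inter> (\<lambda>x. m + x) -` D"
      using per[OF m] by auto
    then show "emeasure lborel (D \<inter> P \<inter> (\<lambda>x. - m + x) -` unit_cube) = emeasure lborel (unit_cube \<inter> P \<inter> (\<lambda>x. m + x) -` D)"
      using emeasure_lborel_translate[of "D \<inter> P \<inter> (\<lambda>x. - m + x) -` unit_cube" m] by simp
  qed
  also have "\<dots> = emeasure lborel (\<Union>m\<in>int_vecs. unit_cube \<inter> P \<inter> (\<lambda>x. m + x) -` D)"
  proof (rule emeasure_UN_countable[symmetric])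
    show "disjoint_family_on (\<lambda>m. unit_cube \<inter> P \<inter> (\<lambda>x. m + x) -` D) int_vecs"
      unfolding disjoint_family_on_def using uniq by fastforce
  qed (auto simp: countable_int_vecs)
  also have "(\<Union>m\<in>int_vecs. unit_cube \<inter> P \<inter> (\<lambda>x. m + x) -` D) = unit_cube \<inter> P" using ex by auto
  finally show ?thesis .
qed

lemma emeasure_linear_image_det1:
  fixes A :: "real ^ ('n::{finite,wellorder}) ^ ('n::{finite,wellorder})"
  assumes S: "S \<in> sets borel" "bounded S" and AS: "(\<lambda>x. A *v x) ` S \<in> sets borel" and det: "\<bar>det A\<bar> = 1"
  shows "emeasure lborel ((\<lambda>x. A *v x) ` S) = emeasure lborel S"
proof -
  have lS: "S \<in> lmeasurable" by (rule bounded_set_imp_lmeasurable) (use S in auto)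
  have lin: "linear ((*v) A)" by simp
  have lA: "(*v) A ` S \<in> lmeasurable" by (rule measurable_linear_image[OF lin lS])
  have m: "measure lebesgue ((*v) A ` S) = measure lebesgue S"
    using measure_linear_image[OF lin lS] det by simp
  have "emeasure lebesgue ((*v) A ` S) = emeasure lebesgue S"
    using m lS lA by (simp add: emeasure_eq_measure2)
  then show ?thesis using S AS by simp
qed

lemma abs_torus_int_vecs: "m \<in> int_vecs \<Longrightarrow> abs_torus (m + x) = abs_torus x"
  using abs_torus_add_Ints[of m x] by (simp add: int_vecs_def add.commute)

lemma toral_map_inverse:
  assumes "\<And>i j. A $ i $ j \<in> \<int>" "\<And>i j. B $ i $ j \<in> \<int>" "\<And>x. A *v (B *v x) = x"
  shows "toral_map A (toral_map B w) = w"
proof -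
  obtain x where "w = abs_torus x" by (metis abs_rep_torus)
  then show ?thesis using assms by (simp add: toral_map_abs_torus)
qed

lemma continuous_toral_map:
  assumes "\<And>i j. A $ i $ j \<in> \<int>" shows "continuous_on UNIV (toral_map A)"
  unfolding continuous_on_torus_iff toral_map_abs_torus[OF assms]
  by (intro continuous_on_abs_torus linear_continuous_on matrix_vector_mul_bounded_linear)

text \<open>A linear map of determinant \<open>\<plusminus>1\<close> carries the unit cube to a set of the same measure, which is again a
fundamental domain of the lattice because the matrix is invertible over the integers.\<close>

lemma toral_map_preserves_haar:
  fixes A B :: "real ^ ('n::{finite,wellorder}) ^ ('n::{finite,wellorder})"
  assumes A: "\<And>i j. A $ i $ j \<in> \<int>" and B: "\<And>i j. B $ i $ j \<in> \<int>"
    and AB: "\<And>x. A *v (B *v x) = x" and BA: "\<And>x. B *v (A *v x) = x" and det: "\<bar>det A\<bar> = 1"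
  shows "distr torus_haar borel (toral_map A) = torus_haar"
proof (rule measure_eqI)
  fix E assume "E \<in> sets (distr torus_haar borel (toral_map A))"
  then have E: "E \<in> sets borel" by simp
  have mA: "toral_map A \<in> borel_measurable borel" by (rule borel_measurable_continuous_onI[OF continuous_toral_map[OF A]])
  have AE: "toral_map A -` E \<in> sets borel" using measurable_sets[OF mA E] by simp
  have abs_m: "abs_torus \<in> borel_measurable borel" by (rule borel_measurable_continuous_onI[OF continuous_abs_torus])
  define P where "P = abs_torus -` E"
  have P [measurable]: "P \<in> sets borel" using measurable_sets[OF abs_m E] by (simp add: P_def)
  have Bm: "(\<lambda>x. B *v x) \<in> borel_measurable borel" "(\<lambda>x. A *v x) \<in> borel_measurable borel"
    by (intro borel_measurable_continuous_onI linear_continuous_on matrix_vector_mul_bounded_linear)+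
  have imA: "(\<lambda>x. A *v x) ` S = (\<lambda>x. B *v x) -` S" for S
  proof (intro equalityI subsetI)
    fix y assume "y \<in> (\<lambda>x. B *v x) -` S"
    then have "B *v y \<in> S" by simp
    then show "y \<in> (\<lambda>x. A *v x) ` S" by (rule image_eqI[rotated]) (simp add: AB)
  qed (auto simp: BA)
  have AP: "(\<lambda>x. A *v x) -` P \<in> sets borel" using measurable_sets[OF Bm(2) P] by simp
  define D where "D = (\<lambda>x. A *v x) ` unit_cube"
  have D: "D \<in> sets borel" unfolding D_def imA using measurable_sets[OF Bm(1) unit_cube_borel] by simp
  have intA: "A *v m \<in> int_vecs" if "m \<in> int_vecs" for m
    using that A unfolding int_vecs_def matrix_vector_mult_def by (auto intro!: Ints_sum Ints_mult)
  have intB: "B *v m \<in> int_vecs" if "m \<in> int_vecs" for m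
    using that B unfolding int_vecs_def matrix_vector_mult_def by (auto intro!: Ints_sum Ints_mult)
  have "emeasure (distr torus_haar borel (toral_map A)) E = emeasure torus_haar (toral_map A -` E)"
    using emeasure_distr[OF measurable_torus_haar[OF mA] E] by (simp add: space_torus_haar)
  also have "\<dots> = emeasure lborel (unit_cube \<inter> (\<lambda>x. A *v x) -` P)"
    unfolding emeasure_torus_haar[OF AE] P_def
    by (simp add: vimage_def toral_map_abs_torus[OF A])
  also have "\<dots> = emeasure lborel ((\<lambda>x. A *v x) ` (unit_cube \<inter> (\<lambda>x. A *v x) -` P))"
  proof (rule emeasure_linear_image_det1[symmetric, OF _ _ _ det])
    show S: "unit_cube \<inter> (\<lambda>x. A *v x) -` P \<in> sets borel" using AP by simp
    show "bounded (unit_cube \<inter> (\<lambda>x. A *v x) -` P)" by (rule bounded_subset[OF bounded_unit_cube]) auto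
    show "(\<lambda>x. A *v x) ` (unit_cube \<inter> (\<lambda>x. A *v x) -` P) \<in> sets borel"
      unfolding imA using measurable_sets[OF Bm(1) S] by simp
  qed
  also have "(\<lambda>x. A *v x) ` (unit_cube \<inter> (\<lambda>x. A *v x) -` P) = D \<inter> P" by (auto simp: D_def)
  also have "emeasure lborel (D \<inter> P) = emeasure lborel (unit_cube \<inter> P)"
  proof (rule fundamental_domain_emeasure[OF D P])
    show "m + x \<in> P \<longleftrightarrow> x \<in> P" if "m \<in> int_vecs" for m x by (simp add: P_def abs_torus_int_vecs[OF that])
    have D_iff: "y \<in> D \<longleftrightarrow> B *v y \<in> unit_cube" for y unfolding D_def imA by simp
    show "\<exists>m\<in>int_vecs. m + x \<in> D" for x
    proof -
      obtain n where n: "n \<in> int_vecs" "n + B *v x \<in> unit_cube" using unit_cube_translate[of "B *v x"] by blast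
      then have "B *v (A *v n + x) \<in> unit_cube" by (simp add: matrix_vector_right_distrib BA)
      then show ?thesis using intA[OF n(1)] D_iff by blast
    qed
    fix x m m' assume m: "m \<in> int_vecs" "m' \<in> int_vecs" "m + x \<in> D" "m' + x \<in> D"
    obtain n where n: "\<And>m'. m' \<in> int_vecs \<Longrightarrow> m' + B *v x \<in> unit_cube \<Longrightarrow> m' = n"
      using unit_cube_translate[of "B *v x"] by blast
    have "B *v m = n" "B *v m' = n"
      using n[OF intB[OF m(1)]] n[OF intB[OF m(2)]] m(3,4) by (auto simp: D_iff matrix_vector_right_distrib)
    then show "m = m'" by (metis AB)
  qed
  also have "\<dots> = emeasure torus_haar E" by (simp add: emeasure_torus_haar[OF E] P_def)
  finally show "emeasure (distr torus_haar borel (toral_map A)) E = emeasure torus_haar E" .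
qed (simp add: torus_haar_def)

lemma torus_C2_toral_map:
  assumes "\<And>i j. A $ i $ j \<in> \<int>" shows "torus_C2 (toral_map A)"
  unfolding torus_C2_def
proof
  fix x
  have d: "((\<lambda>x. A *v x) has_derivative blinfun_apply (Blinfun ((*v) A))) (at y)" for y
    by (simp add: bounded_linear_Blinfun_apply matrix_vector_mul_bounded_linear bounded_linear_imp_has_derivative)
  have "C1_on UNIV (\<lambda>_. Blinfun ((*v) A))"
    unfolding C1_on_def by (intro exI[of _ "\<lambda>_. 0"]) (auto simp: zero_blinfun.rep_eq)
  then have "C2_on UNIV ((*v) A)"
    unfolding C2_on_def using d by (intro exI[of _ "\<lambda>_. Blinfun ((*v) A)"]) auto
  then show "\<exists>S F. open S \<and> x \<in> S \<and> C2_on S F \<and> (\<forall>y\<in>S. abs_torus (F y) = toral_map A (abs_torus y))"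
    by (intro exI[of _ UNIV] exI[of _ "(*v) A"]) (simp add: toral_map_abs_torus[OF assms])
qed

lemma torus_C2_continuous: "torus_C2 f \<Longrightarrow> continuous_on UNIV f"
  using torus_C2_Lipschitz lipschitz_on_continuous_on by blast

section \<open>The neighbourhood of the automorphism\<close>

definition mat3 :: "real ^ 3 ^ 3"
  where "mat3 = vector [vector [2, 1, 0], vector [1, 1, 0], vector [0, 0, 1]]"

definition mat3' :: "real ^ 3 ^ 3"
  where "mat3' = vector [vector [1, - 1, 0], vector [- 1, 2, 0], vector [0, 0, 1]]"

definition mat2' :: "real ^ 2 ^ 2"
  where "mat2' = vector [vector [1, - 1], vector [- 1, 2]]"

lemma mat_Ints: "mat3 $ i $ j \<in> \<int>" "mat3' $ i $ j \<in> \<int>" "mat2' $ i' $ j' \<in> \<int>"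
proof -
  have "\<forall>i j. mat3 $ i $ j \<in> \<int>" unfolding mat3_def forall_3 by simp
  then show "mat3 $ i $ j \<in> \<int>" by blast
  have "\<forall>i j. mat3' $ i $ j \<in> \<int>" unfolding mat3'_def forall_3 by simp
  then show "mat3' $ i $ j \<in> \<int>" by blast
  have "\<forall>i j. mat2' $ i $ j \<in> \<int>" unfolding mat2'_def forall_2 by simp
  then show "mat2' $ i' $ j' \<in> \<int>" by blast
qed

lemma mat3_mult: "(mat3 *v y) $ 1 = 2 * y $ 1 + y $ 2" "(mat3 *v y) $ 2 = y $ 1 + y $ 2" "(mat3 *v y) $ 3 = y $ 3"
  by (simp_all add: mat3_def matrix_vector_mult_def sum_3)

lemma mat3'_mult: "(mat3' *v y) $ 1 = y $ 1 - y $ 2" "(mat3' *v y) $ 2 = 2 * y $ 2 - y $ 1" "(mat3' *v y) $ 3 = y $ 3"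
  by (simp_all add: mat3'_def matrix_vector_mult_def sum_3)

lemma mat2'_mult: "(mat2' *v y) $ 1 = y $ 1 - y $ 2" "(mat2' *v y) $ 2 = 2 * y $ 2 - y $ 1"
  by (simp_all add: mat2'_def matrix_vector_mult_def sum_2)

lemma mat_inverse: "mat3 *v (mat3' *v x) = x" "mat3' *v (mat3 *v x) = x" "mat2 *v (mat2' *v y) = y" "mat2' *v (mat2 *v y) = y"
  by (simp_all add: vec_eq_iff forall_3 forall_2 mat3_mult mat3'_mult mat2_mult mat2'_mult)

lemma det_mat3: "det mat3 = 1"
  by (simp add: det_3 mat3_def)

lemma A3_toral: "A3 = toral_map mat3" by (simp add: A3_def mat3_def fun_eq_iff)

lemma A2_toral: "A2 = toral_map mat2" by (simp add: A2_def mat2_def fun_eq_iff)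

lemma A3_Diff2: "A3 \<in> Diff2_mu"
proof -
  have i1: "toral_map mat3 (toral_map mat3' w) = w" and i2: "toral_map mat3' (toral_map mat3 w) = w" for w
    using toral_map_inverse[of mat3 mat3'] toral_map_inverse[of mat3' mat3] mat_Ints mat_inverse by auto
  have "bij A3" unfolding A3_toral by (rule o_bij[of "toral_map mat3'"]) (auto simp: fun_eq_iff i1 i2)
  moreover have "inv_into UNIV A3 = toral_map mat3'"
    unfolding A3_toral by (rule inv_unique_comp) (auto simp: fun_eq_iff i1 i2)
  moreover have "distr torus_haar borel A3 = torus_haar"
    unfolding A3_toral by (rule toral_map_preserves_haar[of mat3 mat3']) (auto simp: mat_Ints mat_inverse det_mat3)
  ultimately show ?thesis
    unfolding Diff2_mu_def using torus_C2_toral_map[of mat3] torus_C2_toral_map[of mat3'] mat_Ints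
    by (simp add: A3_toral)
qed

text \<open>A \<open>C\<^sup>0\<close> bound suffices: displacements below \<open>1/4\<close> have a preferred real lift. The bound \<open>r\<close> is uniform in \<open>w\<close> and strict, which makes the condition open.\<close>

definition A3_nbhd :: "(3 torus \<Rightarrow> 3 torus) set"
  where "A3_nbhd = {g \<in> Diff2_mu. \<exists>r<1/4. \<forall>w. dist (A3 w) (g w) \<le> r}"

lemma A3_in_nbhd: "A3 \<in> A3_nbhd"
  unfolding A3_nbhd_def using A3_Diff2 by (auto intro!: exI[of _ 0])

lemma C1_close_dist: "C1_close e g h \<Longrightarrow> dist (g w) (h w) < e"
  unfolding C1_close_def dist_norm by (metis dist_abs_torus_le order_le_less_trans)

lemma C1_open_nbhd: "C1_open A3_nbhd"
  unfolding C1_open_def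
proof (intro conjI ballI)
  fix g assume "g \<in> A3_nbhd"
  then obtain r where g: "g \<in> Diff2_mu" and r: "r < 1/4" "\<And>w. dist (A3 w) (g w) \<le> r"
    unfolding A3_nbhd_def by blast
  define e where "e = (1/4 - r) / 2"
  have e: "e > 0" "r + e < 1/4" using r by (auto simp: e_def field_simps)
  have "h \<in> A3_nbhd" if h: "h \<in> Diff2_mu" "C1_close e g h" for h
  proof -
    have "dist (A3 w) (h w) \<le> r + e" for w
      using dist_triangle[of "A3 w" "h w" "g w"] r(2)[of w] C1_close_dist[OF h(2), of w] by linarith
    then show ?thesis unfolding A3_nbhd_def using h e by blast
  qed
  then show "\<exists>e>0. \<forall>h\<in>Diff2_mu. C1_close e g h \<longrightarrow> h \<in> A3_nbhd" using e by blast
qed (auto simp: A3_nbhd_def)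

text \<open>The automorphism fixes the third coordinate, so \<open>g\<close> moves it by an angle of less than a quarter turn, on which the
principal logarithm is continuous.\<close>

lemma third_displacement:
  assumes g: "continuous_on UNIV g" and near: "\<And>w. dist (A3 w) (g w) < 1/4"
  shows "\<exists>\<delta>. continuous_on UNIV \<delta> \<and> (\<forall>w. third (g w) = third w * cis (2 * pi * \<delta> w))"
proof -
  define z where "z w = third (g w) * cnj (third w)" for w
  have z_cont: "continuous_on UNIV z"
    unfolding z_def
    by (intro continuous_intros continuous_on_compose2[OF continuous_third g] continuous_third) auto
  have z: "norm (z w) = 1" "0 < Re (z w)" for w
  proof -
    define x where "x = rep_torus w"
    have x: "w = abs_torus x" by (simp add: x_def)
    obtain y where y: "abs_torus y = g w" "dist (abs_torus (mat3 *v x)) (g w) = norm (mat3 *v x - y)"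
      by (rule lift_at_distance)
    have "A3 w = abs_torus (mat3 *v x)" by (simp add: A3_toral x toral_map_abs_torus[OF mat_Ints(1)])
    then have "norm (mat3 *v x - y) < 1/4" using near[of w] y(2) by simp
    then have "\<bar>x $ 3 - y $ 3\<bar> < 1/4"
      using component_le_norm_cart[of "mat3 *v x - y" 3] by (simp add: mat3_mult)
    then have t: "\<bar>y $ 3 - x $ 3\<bar> < 1/4" by linarith
    have "third (g w) = cis (2 * pi * y $ 3)" "third w = cis (2 * pi * x $ 3)"
      using third_abs[of y] third_abs[of x] y(1) x by simp_all
    then have "z w = cis (2 * pi * y $ 3) * cis (- (2 * pi * x $ 3))"
      by (simp add: z_def cis_cnj)
    also have "\<dots> = cis (2 * pi * (y $ 3 - x $ 3))" by (simp add: cis_mult algebra_simps)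
    finally have zw: "z w = cis (2 * pi * (y $ 3 - x $ 3))" .
    show "norm (z w) = 1" by (simp add: zw)
    have "2 * pi * (- 1/4) < 2 * pi * (y $ 3 - x $ 3)" "2 * pi * (y $ 3 - x $ 3) < 2 * pi * (1/4)"
      using t by (intro mult_strict_left_mono; simp add: abs_less_iff; linarith)+
    then have "- (pi / 2) < 2 * pi * (y $ 3 - x $ 3)" "2 * pi * (y $ 3 - x $ 3) < pi / 2" by simp_all
    then show "0 < Re (z w)" unfolding zw by (simp add: cos_gt_zero_pi)
  qed
  define \<delta> where "\<delta> w = Im (Ln (z w)) / (2 * pi)" for w
  have "continuous_on UNIV (\<lambda>w. Ln (z w))"
    by (rule continuous_on_Ln'[OF z_cont]) (use z(2) in \<open>auto simp: complex_nonpos_Reals_iff not_le\<close>)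
  then have "continuous_on UNIV \<delta>"
    unfolding \<delta>_def by (intro continuous_on_divide continuous_on_Im continuous_on_const) auto
  moreover have "third (g w) = third w * cis (2 * pi * \<delta> w)" for w
  proof -
    have nz: "z w \<noteq> 0" using z(1)[of w] by force
    have "z w = exp (Ln (z w))" using nz by simp
    moreover have "Re (Ln (z w)) = 0" using nz z(1)[of w] by simp
    ultimately have "z w = cis (2 * pi * \<delta> w)" by (simp add: \<delta>_def exp_eq_polar)
    moreover have "third w * z w = third (g w)"
    proof -
      have "third w * cnj (third w) = 1" using norm_third[of w] by (simp add: complex_norm_square[symmetric])
      then show ?thesis by (simp add: z_def mult.left_commute)
    qed
    ultimately show ?thesis by simp
  qed
  ultimately show ?thesis by blast
qed

section \<open>Labels in cyclic order\<close>

text \<open>The output of \<open>finite_sections\<close> together with an invariant orientation of the fibres: \<open>Pos p\<close> holds of the positive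
parametrizations of the fibre over \<open>p\<close>, and \<open>R\<close> is the resulting cyclic order.\<close>

locale labelled_sections = skew_factor M \<pi> g g' A A'
  for M :: "'a::{second_countable_topology, complete_space} measure"
    and \<pi> :: "'a \<Rightarrow> 'b::{second_countable_topology, metric_space}" and g g' A A' +
  fixes Pos :: "'b \<Rightarrow> (real \<Rightarrow> 'a) \<Rightarrow> bool" and k :: nat and X :: "'a set" and T :: "'b set"
    and S :: "nat \<Rightarrow> 'a set" and R :: "('a \<times> 'a \<times> 'a) set"
  assumes Pos_ex: "\<exists>c. Pos p c"
    and Pos_loop: "Pos p c \<Longrightarrow> c s = c t \<longleftrightarrow> s - t \<in> \<int>" and Pos_range: "Pos p c \<Longrightarrow> range c = \<pi> -` {p}"
    and Pos_reparam: "Pos p c \<Longrightarrow> Pos p c' \<Longrightarrow>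
      \<exists>h. strict_mono h \<and> (\<forall>s::real. h (s + 1) = h s + 1) \<and> (\<forall>s. c' s = c (h s))"
    and Pos_g: "Pos p c \<Longrightarrow> Pos (A p) (\<lambda>s. g (c s))"
    and R_def: "R = {(c s, c t, c u) | p c s t u. Pos p c \<and> s \<le> t \<and> t < u \<and> u < s + 1}"
    and R_borel: "R \<in> sets borel"
    and k: "1 \<le> k" and X_borel [measurable]: "X \<in> sets borel" and T_borel [measurable]: "T \<in> sets borel"
    and X_full: "emeasure M (- X) = 0" and T_full: "emeasure \<nu> (- T) = 0"
    and XT: "\<pi> ` X \<subseteq> T" and T_A: "A ` T \<subseteq> T" and X_g: "g ` X \<subseteq> X"
    and card_fibre: "p \<in> T \<Longrightarrow> card (X \<inter> \<pi> -` {p}) = k"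
    and image_borel: "W \<in> sets borel \<Longrightarrow> W \<subseteq> X \<Longrightarrow> \<pi> ` W \<in> sets borel"
    and S_borel [measurable]: "S i \<in> sets borel" and S_inj: "inj_on \<pi> (S i)" and X_S: "X = (\<Union>i. S i)"
    and S_disj: "disjoint_family S"
    and uniform: "W \<in> sets borel \<Longrightarrow> W \<subseteq> X \<Longrightarrow> inj_on \<pi> W \<Longrightarrow> of_nat k * emeasure M W = emeasure \<nu> (\<pi> ` W)"
begin

definition F :: "'b \<Rightarrow> 'a set" where "F p = X \<inter> \<pi> -` {p}"

lemma F_finite: "p \<in> T \<Longrightarrow> finite (F p)"
  using card_fibre[of p] k by (auto simp: F_def intro: card_ge_0_finite)

lemma F_card: "p \<in> T \<Longrightarrow> card (F p) = k"
  using card_fibre by (simp add: F_def)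

lemma g_F: "p \<in> T \<Longrightarrow> g ` F p = F (A p)"
proof (rule card_subset_eq)
  assume p: "p \<in> T"
  then have Ap: "A p \<in> T" using T_A by blast
  show "finite (F (A p))" by (rule F_finite[OF Ap])
  show "g ` F p \<subseteq> F (A p)" using X_g by (auto simp: F_def)
  have "inj_on g (F p)" by (metis g'g inj_onI)
  then show "card (g ` F p) = card (F (A p))" using F_card[OF p] F_card[OF Ap] by (simp add: card_image)
qed

lemma section_exists:
  assumes Z: "Z \<in> sets borel" "Z \<subseteq> X" "inj_on \<pi> Z"
  shows "\<exists>s\<in>borel_measurable borel. \<forall>z\<in>Z. s (\<pi> z) = z"
proof -
  define s where "s p = (if p \<in> \<pi> ` Z then the_inv_into Z \<pi> p else undefined)" for p
  have sz: "s (\<pi> z) = z" if "z \<in> Z" for z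
    using that Z by (simp add: s_def the_inv_into_f_f)
  have "s \<in> borel_measurable borel"
  proof (rule measurableI)
    fix W :: "'a set" assume W: "W \<in> sets borel"
    have "s -` W = \<pi> ` (W \<inter> Z) \<union> (if undefined \<in> W then - \<pi> ` Z else {})"
    proof (intro equalityI subsetI)
      fix p assume p: "p \<in> s -` W"
      show "p \<in> \<pi> ` (W \<inter> Z) \<union> (if undefined \<in> W then - \<pi> ` Z else {})"
      proof (cases "p \<in> \<pi> ` Z")
        case True
        then obtain z where "z \<in> Z" "p = \<pi> z" by blast
        then show ?thesis using p sz by auto
      next
        case False
        then show ?thesis using p by (auto simp: s_def)
      qed
    next
      fix p assume p: "p \<in> \<pi> ` (W \<inter> Z) \<union> (if undefined \<in> W then - \<pi> ` Z else {})"
      show "p \<in> s -` W"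
      proof (cases "p \<in> \<pi> ` Z")
        case True
        then have "p \<in> \<pi> ` (W \<inter> Z)" using p by (auto split: if_splits)
        then show ?thesis using sz by auto
      next
        case False
        then show ?thesis using p by (auto simp: s_def split: if_splits)
      qed
    qed
    moreover have "\<pi> ` (W \<inter> Z) \<in> sets borel" using W Z by (intro image_borel) auto
    moreover have "- \<pi> ` Z \<in> sets borel" using Z by (intro borel_comp image_borel) auto
    ultimately show "s -` W \<inter> space borel \<in> sets borel" by auto
  qed simp
  then show ?thesis using sz by blast
qed

text \<open>One point in each fibre of \<open>X\<close>: the one in the section of least index.\<close>

definition base_set :: "'a set"
  where "base_set = (\<Union>i. S i - \<pi> -` (\<Union>j\<in>{..<i}. \<pi> ` S j))"

lemma S_sub: "S i \<subseteq> X" using X_S by blast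

lemma base_set_borel [measurable]: "base_set \<in> sets borel"
proof -
  have [measurable]: "\<pi> ` S j \<in> sets borel" for j by (rule image_borel[OF S_borel S_sub])
  have "(\<Union>j\<in>{..<i}. \<pi> ` S j) \<in> sets borel" for i by (intro sets.finite_UN) auto
  then have "\<pi> -` (\<Union>j\<in>{..<i}. \<pi> ` S j) \<in> sets borel" for i by (rule vimage_\<pi>)
  then show ?thesis unfolding base_set_def by (intro sets.countable_UN) auto
qed

lemma base_set_sub: "base_set \<subseteq> X" using S_sub by (auto simp: base_set_def)

lemma base_set_iff: "x \<in> base_set \<longleftrightarrow> (\<exists>i. x \<in> S i \<and> (\<forall>j<i. \<pi> x \<notin> \<pi> ` S j))"
  by (auto simp: base_set_def)

lemma base_set_inj: "inj_on \<pi> base_set"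
proof (rule inj_onI)
  fix x y assume xy: "x \<in> base_set" "y \<in> base_set" and eq: "\<pi> x = \<pi> y"
  obtain i where x: "x \<in> S i" "\<And>j. j < i \<Longrightarrow> \<pi> x \<notin> \<pi> ` S j" using xy(1) base_set_iff by auto
  obtain j where y: "y \<in> S j" "\<And>i. i < j \<Longrightarrow> \<pi> y \<notin> \<pi> ` S i" using xy(2) base_set_iff by auto
  have "\<pi> x \<in> \<pi> ` S i" "\<pi> y \<in> \<pi> ` S j" using x(1) y(1) by simp_all
  then have "\<not> i < j" "\<not> j < i" using x(2)[of j] y(2)[of i] eq by auto
  then have "i = j" by simp
  then show "x = y" using x(1) y(1) eq S_inj[of i] by (simp add: inj_on_eq_iff)
qed

lemma base_ex:
  assumes p: "p \<in> T" obtains b where "b \<in> base_set" "\<pi> b = p"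
proof -
  have "F p \<noteq> {}" using F_card[OF p] k by auto
  then obtain x where x0: "x \<in> X" "\<pi> x = p" unfolding F_def by blast
  then obtain i0 where x: "x \<in> S i0" "\<pi> x = p" using X_S by blast
  define i where "i = (LEAST i. p \<in> \<pi> ` S i)"
  have "p \<in> \<pi> ` S i" unfolding i_def by (rule LeastI[of _ i0]) (use x in blast)
  then obtain b where b: "b \<in> S i" "\<pi> b = p" by blast
  moreover have "p \<notin> \<pi> ` S j" if "j < i" for j using not_less_Least[of j "\<lambda>i. p \<in> \<pi> ` S i"] that by (simp add: i_def)
  ultimately have "b \<in> base_set" unfolding base_set_iff by blast
  then show thesis using that b by blast
qed

definition base :: "'b \<Rightarrow> 'a"
  where "base = (SOME s. s \<in> borel_measurable borel \<and> (\<forall>z\<in>base_set. s (\<pi> z) = z))"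

lemma base_measurable [measurable]: "base \<in> borel_measurable borel" and base_eq: "z \<in> base_set \<Longrightarrow> base (\<pi> z) = z"
proof -
  have "\<exists>s. s \<in> borel_measurable borel \<and> (\<forall>z\<in>base_set. s (\<pi> z) = z)"
    using section_exists[OF base_set_borel base_set_sub base_set_inj] by blast
  from someI_ex[OF this] show "base \<in> borel_measurable borel" "z \<in> base_set \<Longrightarrow> base (\<pi> z) = z"
    unfolding base_def by blast+
qed

lemma base_in: "p \<in> T \<Longrightarrow> base p \<in> F p"
  using base_ex base_eq base_set_sub by (metis F_def IntI subsetD vimage_singleton_eq)

text \<open>The position of \<open>w\<close> among the points of \<open>X\<close> in its fibre, counted in the positive direction from the base point.\<close>

definition idx :: "'a \<Rightarrow> nat"
  where "idx w = card {y \<in> F (\<pi> w). (base (\<pi> w), y, w) \<in> R}"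

text \<open>Counting along a parametrization of the fibre is additive in the interval and gives \<open>k\<close> over a full period. This turns statements about
the cyclic order into arithmetic modulo \<open>k\<close>.\<close>

definition cnt :: "(real \<Rightarrow> 'a) \<Rightarrow> 'b \<Rightarrow> real \<Rightarrow> real \<Rightarrow> nat"
  where "cnt c p a b = card {t. a \<le> t \<and> t < b \<and> c t \<in> F p}"

lemma inj_on_period: "Pos p c \<Longrightarrow> inj_on c {a..<a + 1}"
proof (rule inj_onI)
  fix s t assume c: "Pos p c" and st: "s \<in> {a..<a + 1}" "t \<in> {a..<a + 1}" "c s = c t"
  then have "s - t \<in> \<int>" using Pos_loop by blast
  moreover have "\<bar>s - t\<bar> < 1" using st by auto
  ultimately show "s = t" using Ints_nonzero_abs_less1[of "s - t"] by auto
qed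

lemma period_rep:
  assumes c: "Pos p c" and w: "\<pi> w = p"
  obtains u where "a \<le> u" "u < a + 1" "w = c u"
proof -
  have "w \<in> range c" using Pos_range[OF c] w by simp
  then obtain v where v: "w = c v" by blast
  define u where "u = a + frac (v - a)"
  have "v - u \<in> \<int>" by (simp add: u_def frac_def)
  then have "w = c u" using v Pos_loop[OF c] by simp
  then show thesis using that[of u] frac_ge_0[of "v - a"] frac_lt_1[of "v - a"] by (simp add: u_def)
qed

lemma cnt_period:
  assumes c: "Pos p c" and p: "p \<in> T"
  shows "cnt c p a (a + 1) = k" "finite {t. a \<le> t \<and> t < a + 1 \<and> c t \<in> F p}"
proof -
  have "bij_betw c {t. a \<le> t \<and> t < a + 1 \<and> c t \<in> F p} (F p)"
    unfolding bij_betw_def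
  proof
    show "inj_on c {t. a \<le> t \<and> t < a + 1 \<and> c t \<in> F p}"
      by (rule inj_on_subset[OF inj_on_period[OF c, of a]]) auto
    show "c ` {t. a \<le> t \<and> t < a + 1 \<and> c t \<in> F p} = F p"
    proof (intro equalityI subsetI)
      fix w assume w: "w \<in> F p"
      then have "\<pi> w = p" by (simp add: F_def)
      then obtain u where "a \<le> u" "u < a + 1" "w = c u" by (rule period_rep[OF c])
      then show "w \<in> c ` {t. a \<le> t \<and> t < a + 1 \<and> c t \<in> F p}" using w by blast
    qed auto
  qed
  then show "cnt c p a (a + 1) = k" "finite {t. a \<le> t \<and> t < a + 1 \<and> c t \<in> F p}"
    unfolding cnt_def using F_card[OF p] F_finite[OF p] by (simp_all add: bij_betw_same_card bij_betw_finite)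
qed

lemma cnt_finite:
  assumes c: "Pos p c" and p: "p \<in> T"
  shows "finite {t. a \<le> t \<and> t < b \<and> c t \<in> F p}"
proof -
  obtain n :: nat where n: "b - a < real n" using reals_Archimedean2 by blast
  have "{t. a \<le> t \<and> t < b \<and> c t \<in> F p} \<subseteq> (\<Union>i\<in>{..<n}. {t. a + real i \<le> t \<and> t < a + real i + 1 \<and> c t \<in> F p})"
  proof
    fix t assume t: "t \<in> {t. a \<le> t \<and> t < b \<and> c t \<in> F p}"
    define i where "i = nat \<lfloor>t - a\<rfloor>"
    have i: "real i = of_int \<lfloor>t - a\<rfloor>" using t by (simp add: i_def)
    have "real i \<le> t - a" "t - a < real i + 1" unfolding i by linarith+
    moreover have "i < n"
    proof -
      have "real i < real n" using calculation t n by auto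
      then show ?thesis by simp
    qed
    ultimately show "t \<in> (\<Union>i\<in>{..<n}. {t. a + real i \<le> t \<and> t < a + real i + 1 \<and> c t \<in> F p})"
      using t by (intro UN_I[of i]) auto
  qed
  moreover have "finite (\<Union>i\<in>{..<n}. {t. a + real i \<le> t \<and> t < a + real i + 1 \<and> c t \<in> F p})"
    by (intro finite_UN_I cnt_period(2)[OF c p] finite_lessThan)
  ultimately show ?thesis by (rule finite_subset)
qed

lemma cnt_add:
  assumes c: "Pos p c" and p: "p \<in> T" and ab: "a \<le> b" "b \<le> d"
  shows "cnt c p a d = cnt c p a b + cnt c p b d"
proof -
  have "{t. a \<le> t \<and> t < d \<and> c t \<in> F p} = {t. a \<le> t \<and> t < b \<and> c t \<in> F p} \<union> {t. b \<le> t \<and> t < d \<and> c t \<in> F p}"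
    using ab by auto
  then show ?thesis
    unfolding cnt_def by (simp add: card_Un_disjoint[OF cnt_finite[OF c p] cnt_finite[OF c p]] disjoint_iff)
qed

lemma idx_cnt:
  assumes c: "Pos p c" and b: "base p = c a" and u: "a \<le> u" "u < a + 1"
  shows "idx (c u) = cnt c p a u"
proof -
  have pu: "\<pi> (c u) = p" for u using Pos_range[OF c] by auto
  have "{y \<in> F p. (base p, y, c u) \<in> R} = c ` {t. a \<le> t \<and> t < u \<and> c t \<in> F p}"
  proof (intro equalityI subsetI)
    fix y assume "y \<in> {y \<in> F p. (base p, y, c u) \<in> R}"
    then have y: "y \<in> F p" "(base p, y, c u) \<in> R" by auto
    then obtain q c' s t v where R: "c a = c' s" "y = c' t" "c u = c' v" "Pos q c'" "s \<le> t" "t < v" "v < s + 1"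
      using b unfolding R_def by auto
    have "q = p" using Pos_range[OF R(4)] pu[of a] R(1) by (metis rangeI vimage_singleton_eq)
    then obtain h where h: "strict_mono h" "\<And>s. h (s + 1) = h s + 1" "\<And>s. c' s = c (h s)"
      using Pos_reparam[OF c, of c'] R(4) by blast
    have "a - h s \<in> \<int>" using R(1) h(3) Pos_loop[OF c] by metis
    \<comment> \<open>The reparametrization may be off by an integral number of periods, which \<open>n\<close> removes.\<close>
    define n where "n = a - h s"
    have n: "n \<in> \<int>" using \<open>a - h s \<in> \<int>\<close> by (simp add: n_def)
    have cn: "c (x + n) = c x" for x using Pos_loop[OF c, of "x + n" x] n by simp
    have ord: "h s \<le> h t" "h t < h v" "h v < h s + 1"
      using R(5-7) h(1) h(2)[of s] by (metis strict_mono_less_eq, metis strict_mono_less, metis strict_mono_less)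
    have "c (h v + n) = c u" using R(3) h(3) cn by simp
    moreover have "h v + n \<in> {a..<a + 1}" "u \<in> {a..<a + 1}" using ord u by (auto simp: n_def)
    ultimately have "h v + n = u" using inj_on_period[OF c, of a] by (simp add: inj_on_eq_iff)
    moreover have "c (h t + n) = y" using R(2) h(3) cn by simp
    moreover have "a \<le> h t + n" "h t + n < h v + n" using ord by (auto simp: n_def)
    ultimately show "y \<in> c ` {t. a \<le> t \<and> t < u \<and> c t \<in> F p}"
      using y(1) by (intro image_eqI[of _ _ "h t + n"]) auto
  next
    fix y assume "y \<in> c ` {t. a \<le> t \<and> t < u \<and> c t \<in> F p}"
    then obtain t where t: "a \<le> t" "t < u" "y = c t" "c t \<in> F p" by blast
    then have "(base p, y, c u) \<in> R"
      unfolding R_def using c b u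
      by (intro CollectI exI[of _ p] exI[of _ c] exI[of _ a] exI[of _ t] exI[of _ u]) auto
    then show "y \<in> {y \<in> F p. (base p, y, c u) \<in> R}" using t by simp
  qed
  moreover have "inj_on c {t. a \<le> t \<and> t < u \<and> c t \<in> F p}"
    by (rule inj_on_subset[OF inj_on_period[OF c, of a]]) (use u in auto)
  ultimately show ?thesis unfolding idx_def cnt_def pu by (simp add: card_image)
qed

lemma base_position:
  assumes c: "Pos p c" and p: "p \<in> T"
  obtains a where "x - 1 < a" "a \<le> x" "base p = c a"
proof -
  have "\<pi> (base p) = p" using base_in[OF p] by (simp add: F_def)
  then obtain u where u: "- x \<le> - u" "- u < - x + 1" "base p = c u"
  proof (rule period_rep[OF c, of _ "x - 1"])
    fix v assume v: "x - 1 \<le> v" "v < x - 1 + 1" "base p = c v"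
    show thesis
    proof (cases "v = x - 1")
      case True
      have "c x = c v" using Pos_loop[OF c, of x v] True by simp
      then show thesis using that[of x] v by simp
    next
      case False
      then show thesis using that[of v] v by simp
    qed
  qed
  then show thesis using that[of u] by simp
qed

lemma idx_less: "w \<in> X \<Longrightarrow> idx w < k"
proof -
  assume w: "w \<in> X"
  define p where "p = \<pi> w"
  have p: "p \<in> T" using w XT by (auto simp: p_def)
  obtain c where c: "Pos p c" using Pos_ex by blast
  obtain a where a: "base p = c a" by (rule base_position[OF c p]) blast
  obtain u where u: "a \<le> u" "u < a + 1" "w = c u" using period_rep[OF c p_def[symmetric]] by blast
  have "u \<in> {t. u \<le> t \<and> t < a + 1 \<and> c t \<in> F p}" using u w by (simp add: F_def p_def)
  then have "cnt c p u (a + 1) > 0" unfolding cnt_def using cnt_finite[OF c p] by (auto simp: card_gt_0_iff)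
  moreover have "cnt c p a u + cnt c p u (a + 1) = k"
    using cnt_add[OF c p u(1), of "a + 1"] cnt_period(1)[OF c p] u by simp
  ultimately show ?thesis using idx_cnt[OF c a u(1,2)] u(3) by simp
qed

lemma idx_inj: "p \<in> T \<Longrightarrow> inj_on idx (F p)"
proof (rule inj_onI)
  fix w w' assume p: "p \<in> T" and w: "w \<in> F p" "w' \<in> F p" and eq: "idx w = idx w'"
  obtain c where c: "Pos p c" using Pos_ex by blast
  obtain a where a: "base p = c a" by (rule base_position[OF c p]) blast
  obtain u where u: "a \<le> u" "u < a + 1" "w = c u" using period_rep[OF c, of w a] w by (auto simp: F_def)
  obtain u' where u': "a \<le> u'" "u' < a + 1" "w' = c u'" using period_rep[OF c, of w' a] w by (auto simp: F_def)
  have lt: "cnt c p a x < cnt c p a y" if "a \<le> x" "x < y" "c x \<in> F p" for x y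
  proof -
    have "x \<in> {t. x \<le> t \<and> t < y \<and> c t \<in> F p}" using that by simp
    then have "cnt c p x y > 0" unfolding cnt_def using cnt_finite[OF c p] by (auto simp: card_gt_0_iff)
    then show ?thesis using cnt_add[OF c p that(1), of y] that(2) by simp
  qed
  have "cnt c p a u = cnt c p a u'" using eq idx_cnt[OF c a u(1,2)] idx_cnt[OF c a u'(1,2)] u(3) u'(3) by simp
  then have "u = u'" using lt[of u u'] lt[of u' u] u u' w by (cases u u' rule: linorder_cases) auto
  then show "w = w'" using u u' by simp
qed

lemma idx_bij: "p \<in> T \<Longrightarrow> bij_betw idx (F p) {..<k}"
proof -
  assume p: "p \<in> T"
  have "idx ` F p \<subseteq> {..<k}" using idx_less by (auto simp: F_def)
  moreover have "card (idx ` F p) = card {..<k}" using card_image[OF idx_inj[OF p]] F_card[OF p] by simp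
  ultimately have "idx ` F p = {..<k}" by (intro card_subset_eq) auto
  then show ?thesis using idx_inj[OF p] by (simp add: bij_betw_def)
qed

definition shift :: "'b \<Rightarrow> nat"
  where "shift p = idx (g (base p))"

text \<open>The map \<open>g\<close> carries positive parametrizations to positive ones, so in the image fibre the points are counted in the same order, only from another base
point. Moving the base point back adds the constant number of points passed, and a point that is thereby pushed beyond a full
period loses \<open>k\<close>.\<close>

lemma idx_g:
  assumes w: "w \<in> X" shows "idx (g w) = (shift (\<pi> w) + idx w) mod k"
proof -
  define p where "p = \<pi> w"
  have p: "p \<in> T" using w XT by (auto simp: p_def)
  have Ap: "A p \<in> T" using p T_A by blast
  obtain c where c: "Pos p c" using Pos_ex by blast
  obtain a where a: "base p = c a" by (rule base_position[OF c p]) blast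
  obtain u where u: "a \<le> u" "u < a + 1" "w = c u" using period_rep[OF c p_def[symmetric]] by blast
  define c' where "c' s = g (c s)" for s
  have c': "Pos (A p) c'" unfolding c'_def by (rule Pos_g[OF c])
  have cnt': "cnt c' (A p) x y = cnt c p x y" for x y
  proof -
    have "c' t \<in> F (A p) \<longleftrightarrow> c t \<in> F p" for t
    proof
      assume "c' t \<in> F (A p)"
      then obtain v where "v \<in> F p" "g (c t) = g v" using g_F[OF p] by (auto simp: c'_def)
      then show "c t \<in> F p" by (metis g'g)
    qed (use g_F[OF p] in \<open>auto simp: c'_def\<close>)
    then show ?thesis by (simp add: cnt_def)
  qed
  obtain b where b: "a - 1 < b" "b \<le> a" "base (A p) = c' b" by (rule base_position[OF c' Ap])
  have "shift p = cnt c p b a"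
    using idx_cnt[OF c' b(3), of a] b by (simp add: shift_def a c'_def cnt'[unfolded c'_def])
  moreover have "idx w = cnt c p a u" using idx_cnt[OF c a u(1,2)] u(3) by simp
  ultimately have sum: "shift p + idx w = cnt c p b u" using cnt_add[OF c p b(2) u(1)] by simp
  have less: "idx (g w) < k" using w X_g by (intro idx_less) auto
  show ?thesis
  proof (cases "u < b + 1")
    case True
    have "idx (g w) = cnt c p b u"
      using idx_cnt[OF c' b(3), of u] b u True by (simp add: c'_def cnt'[unfolded c'_def])
    then show ?thesis using sum less by (simp add: p_def)
  next
    case False
    have "c' (u - 1) = c' u" using Pos_loop[OF c', of "u - 1" u] by simp
    then have "idx (g w) = cnt c p b (u - 1)"
      using idx_cnt[OF c' b(3), of "u - 1"] b u False by (simp add: c'_def cnt'[unfolded c'_def])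
    moreover have "cnt c p b u = cnt c p b (u - 1) + cnt c p (u - 1) u"
      using False by (intro cnt_add[OF c p]) auto
    moreover have "cnt c p (u - 1) u = k" using cnt_period(1)[OF c p, of "u - 1"] by simp
    ultimately show ?thesis using sum less by (simp add: p_def)
  qed
qed

end

context labelled_sections
begin

definition Z :: "nat \<Rightarrow> 'a set" where "Z j = {w \<in> X. idx w = j}"

text \<open>The position of \<open>w\<close> is the number of indices \<open>i\<close> for which the point of \<open>S i\<close> in the fibre of \<open>w\<close> lies on the arc from the base point
to \<open>w\<close>. For each \<open>i\<close> this is a Borel condition, and there are countably many finite sets of indices.\<close>

lemma Z_borel [measurable]: "Z j \<in> sets borel"
proof -
  have "\<exists>s\<in>borel_measurable borel. \<forall>z\<in>S i. s (\<pi> z) = z" for i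
    by (rule section_exists[OF S_borel S_sub S_inj])
  then obtain s where s [measurable]: "\<And>i. s i \<in> borel_measurable borel" and s_eq: "\<And>i z. z \<in> S i \<Longrightarrow> s i (\<pi> z) = z"
    by metis
  have [measurable]: "\<pi> ` S i \<in> sets borel" for i by (rule image_borel[OF S_borel S_sub])
  define G where "G i = X \<inter> \<pi> -` (\<pi> ` S i) \<inter> (\<lambda>w. (base (\<pi> w), s i (\<pi> w), w)) -` R" for i
  have G [measurable]: "G i \<in> sets borel" for i
  proof -
    have m: "(\<lambda>w. (base (\<pi> w), s i (\<pi> w), w)) \<in> borel_measurable borel"
      by (intro borel_measurable_Pair measurable_compose[OF \<pi>_borel base_measurable]
        measurable_compose[OF \<pi>_borel s]) simp
    have "(\<lambda>w. (base (\<pi> w), s i (\<pi> w), w)) -` R \<in> sets borel"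
      using measurable_sets[OF m R_borel] by simp
    then show ?thesis unfolding G_def by (intro sets.Int X_borel vimage_\<pi>) auto
  qed
  have idx_G: "idx w = card {i. w \<in> G i}" "finite {i. w \<in> G i}" if w: "w \<in> X" for w
  proof -
    have p: "\<pi> w \<in> T" using w XT by auto
    have "bij_betw (\<lambda>i. s i (\<pi> w)) {i. w \<in> G i} {y \<in> F (\<pi> w). (base (\<pi> w), y, w) \<in> R}"
    proof (rule bij_betwI')
      have in_S: "s i (\<pi> w) \<in> S i" "\<pi> (s i (\<pi> w)) = \<pi> w" if "i \<in> {i. w \<in> G i}" for i
      proof -
        have "\<pi> w \<in> \<pi> ` S i" using that by (simp add: G_def)
        then obtain z where z: "z \<in> S i" "\<pi> w = \<pi> z" by blast
        then show "s i (\<pi> w) \<in> S i" "\<pi> (s i (\<pi> w)) = \<pi> w" using s_eq[OF z(1)] by simp_all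
      qed
      { fix i j assume ij: "i \<in> {i. w \<in> G i}" "j \<in> {i. w \<in> G i}"
        show "s i (\<pi> w) = s j (\<pi> w) \<longleftrightarrow> i = j"
        proof
          assume "s i (\<pi> w) = s j (\<pi> w)"
          then have "s i (\<pi> w) \<in> S i \<inter> S j" using in_S[OF ij(1)] in_S[OF ij(2)] by simp
          then show "i = j" using S_disj unfolding disjoint_family_on_def by blast
        qed simp }
      { fix i assume i: "i \<in> {i. w \<in> G i}"
        have "s i (\<pi> w) \<in> X" using in_S[OF i] S_sub by blast
        then show "s i (\<pi> w) \<in> {y \<in> F (\<pi> w). (base (\<pi> w), y, w) \<in> R}"
          using in_S[OF i] i by (simp add: F_def G_def) }
      { fix y assume y: "y \<in> {y \<in> F (\<pi> w). (base (\<pi> w), y, w) \<in> R}"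
        then have "y \<in> X" "\<pi> y = \<pi> w" by (auto simp: F_def)
        then obtain i where i: "y \<in> S i" using X_S by blast
        have "s i (\<pi> w) = y" using s_eq[OF i] \<open>\<pi> y = \<pi> w\<close> by simp
        moreover have "\<pi> w \<in> \<pi> ` S i" using i \<open>\<pi> y = \<pi> w\<close> by (metis image_eqI)
        ultimately show "\<exists>i\<in>{i. w \<in> G i}. y = s i (\<pi> w)" using y w by (auto simp: G_def intro!: exI[of _ i]) }
    qed
    moreover have "finite {y \<in> F (\<pi> w). (base (\<pi> w), y, w) \<in> R}" using F_finite[OF p] by simp
    ultimately show "idx w = card {i. w \<in> G i}" "finite {i. w \<in> G i}"
      unfolding idx_def by (simp_all add: bij_betw_same_card bij_betw_finite)
  qed
  define N where "N = {I :: nat set. finite I \<and> card I = j}"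
  have cN: "countable N"
    by (rule countable_subset[OF _ countable_Collect_finite]) (auto simp: N_def)
  have "{w \<in> X. {i. w \<in> G i} = I} \<in> sets borel" for I
  proof -
    define H where "H i = (if i \<in> I then G i else - G i)" for i
    have "H i \<in> sets borel" for i by (simp add: H_def borel_comp)
    then have "(\<Inter>i. H i) \<in> sets borel" by (intro sets.countable_INT) auto
    moreover have "{w \<in> X. {i. w \<in> G i} = I} = X \<inter> (\<Inter>i. H i)"
      unfolding H_def by (auto split: if_splits)
    ultimately show ?thesis by auto
  qed
  then have "(\<Union>I\<in>N. {w \<in> X. {i. w \<in> G i} = I}) \<in> sets borel"
    using cN by (intro sets.countable_UN') auto
  moreover have "Z j = (\<Union>I\<in>N. {w \<in> X. {i. w \<in> G i} = I})"
    using idx_G by (auto simp: Z_def N_def)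
  ultimately show ?thesis by simp
qed

lemma Z_sub: "Z j \<subseteq> X" by (auto simp: Z_def)

lemma Z_inj: "inj_on \<pi> (Z j)"
proof (rule inj_onI)
  fix x y assume xy: "x \<in> Z j" "y \<in> Z j" "\<pi> x = \<pi> y"
  then have "\<pi> x \<in> T" "x \<in> F (\<pi> x)" "y \<in> F (\<pi> x)" "idx x = idx y" using XT by (auto simp: Z_def F_def)
  then show "x = y" using idx_inj[of "\<pi> x"] by (simp add: inj_on_eq_iff)
qed

lemma Z_onto: "j < k \<Longrightarrow> p \<in> T \<Longrightarrow> \<exists>z\<in>Z j. \<pi> z = p"
proof -
  assume j: "j < k" and p: "p \<in> T"
  then have "j \<in> idx ` F p" using idx_bij[OF p] by (simp add: bij_betw_def)
  then show ?thesis by (auto simp: Z_def F_def)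
qed

definition sec :: "nat \<Rightarrow> 'b \<Rightarrow> 'a"
  where "sec j = (SOME s. s \<in> borel_measurable borel \<and> (\<forall>z\<in>Z j. s (\<pi> z) = z))"

lemma sec_measurable [measurable]: "sec j \<in> borel_measurable borel" and sec_eq: "z \<in> Z j \<Longrightarrow> sec j (\<pi> z) = z"
proof -
  have "\<exists>s. s \<in> borel_measurable borel \<and> (\<forall>z\<in>Z j. s (\<pi> z) = z)"
    using section_exists[OF Z_borel Z_sub Z_inj] by blast
  from someI_ex[OF this] show "sec j \<in> borel_measurable borel" "z \<in> Z j \<Longrightarrow> sec j (\<pi> z) = z"
    unfolding sec_def by blast+
qed

lemma sec_in: "j < k \<Longrightarrow> p \<in> T \<Longrightarrow> sec j p \<in> Z j \<and> \<pi> (sec j p) = p"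
  using Z_onto sec_eq by metis

abbreviation C :: "int set" where "C \<equiv> carrier (integer_mod_group k)"

lemma C_eq: "C = {0..<int k}" using k by (simp add: carrier_integer_mod_group)

abbreviation N :: "('b \<times> int) measure" where "N \<equiv> point_extension_measure k \<nu>"

text \<open>The value off \<open>T\<close>, a null set, is arbitrary in the group.\<close>

definition \<phi> :: "'b \<Rightarrow> int"
  where "\<phi> p = (if p \<in> T then int (shift p) else 0)"

abbreviation h :: "'b \<times> int \<Rightarrow> 'b \<times> int" where "h \<equiv> point_extension k A \<phi>"

definition \<Phi> :: "'a \<Rightarrow> 'b \<times> int" where "\<Phi> w = (\<pi> w, int (idx w))"

definition \<Psi> :: "'b \<times> int \<Rightarrow> 'a" where "\<Psi> q = sec (nat (snd q)) (fst q)"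

lemma sets_N: "sets N = sets (borel \<Otimes>\<^sub>M count_space C)"
  unfolding point_extension_measure_def
  by (rule sets_pair_measure_cong) (simp_all add: sets_\<nu> sets_uniform_count_measure_count_space)

lemma space_N: "space N = UNIV \<times> C"
  using sets_eq_imp_space_eq[OF sets_N] by (simp add: space_pair_measure)

lemma shift_in: "p \<in> T \<Longrightarrow> shift p < k"
  unfolding shift_def using base_in X_g by (intro idx_less) (auto simp: F_def)

lemma \<phi>_in: "\<phi> p \<in> C"
  using shift_in[of p] k by (auto simp: \<phi>_def C_eq)

lemma \<phi>_measurable: "\<phi> \<in> measurable borel (count_space C)"
proof (rule measurable_count_space_eq_countable[THEN iffD2])
  show "countable C" unfolding C_eq by simp
  show "\<phi> \<in> space borel \<rightarrow> C \<and> (\<forall>a\<in>C. \<phi> -` {a} \<inter> space borel \<in> sets borel)"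
  proof (intro conjI ballI)
    fix a assume "a \<in> C"
    have m: "(\<lambda>p. g (base p)) \<in> borel_measurable borel"
      by (rule measurable_compose[OF base_measurable meas(1)])
    have gb: "(\<lambda>p. g (base p)) -` Z (nat a) \<in> sets borel"
      using measurable_sets[OF m Z_borel] by simp
    have gX: "g (base p) \<in> X" if "p \<in> T" for p using base_in[OF that] X_g by (auto simp: F_def)
    have "\<phi> -` {a} = (T \<inter> (\<lambda>p. g (base p)) -` Z (nat a)) \<union> (if a = 0 then - T else {})"
      using gX \<open>a \<in> C\<close> unfolding C_eq by (auto simp: \<phi>_def shift_def Z_def split: if_splits)
    then show "\<phi> -` {a} \<inter> space borel \<in> sets borel" using gb by auto
  qed (use \<phi>_in in auto)
qed

lemma h_eq: "h (p, j) = (A p, (\<phi> p + j) mod int k)"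
  by (simp add: point_extension_def group_extension_def)

lemma h_measurable: "h \<in> measurable N N"
proof -
  have 1: "(\<lambda>q. A (fst q)) \<in> measurable (borel \<Otimes>\<^sub>M count_space C) borel" by measurable
  have 2: "(\<lambda>q. (\<phi> (fst q) + snd q) mod int k) \<in> measurable (borel \<Otimes>\<^sub>M count_space C) (count_space C)"
  proof -
    have a: "(\<lambda>q. \<phi> (fst q)) \<in> measurable (borel \<Otimes>\<^sub>M count_space C) (count_space C)"
      by (rule measurable_compose[OF measurable_fst \<phi>_measurable])
    have b: "snd \<in> measurable (borel \<Otimes>\<^sub>M count_space C) (count_space C)" by (rule measurable_snd)
    have cC: "countable C" by (simp add: C_eq)
    have f: "(\<lambda>j. (i + j) mod int k) \<in> measurable (count_space C) (count_space C)" for i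
      using k by (simp add: C_eq)
    have "(\<lambda>q. (\<lambda>i q. (i + snd q) mod int k) (\<phi> (fst q)) q) \<in> measurable (borel \<Otimes>\<^sub>M count_space C) (count_space C)"
      by (rule measurable_compose_countable'[OF _ a cC]) (rule measurable_compose[OF b f])
    then show ?thesis by simp
  qed
  have "(\<lambda>q. (A (fst q), (\<phi> (fst q) + snd q) mod int k)) \<in> measurable (borel \<Otimes>\<^sub>M count_space C) (borel \<Otimes>\<^sub>M count_space C)"
    by (rule measurable_Pair[OF 1 2])
  moreover have "h = (\<lambda>q. (A (fst q), (\<phi> (fst q) + snd q) mod int k))"
    using h_eq by (auto simp: fun_eq_iff)
  ultimately show ?thesis using measurable_cong_sets[OF sets_N sets_N] by simp
qed

lemma slice_borel: "B \<in> sets N \<Longrightarrow> j \<in> C \<Longrightarrow> {p. (p, j) \<in> B} \<in> sets borel"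
proof -
  assume B: "B \<in> sets N" and j: "j \<in> C"
  have "(\<lambda>p. (p, j)) \<in> measurable borel (borel \<Otimes>\<^sub>M count_space C)" using j by (intro measurable_Pair2') simp
  from measurable_sets[OF this, of B] show ?thesis using B sets_N by (simp add: vimage_def)
qed

lemma slices: "B \<in> sets N \<Longrightarrow> B = (\<Union>j\<in>C. {p. (p, j) \<in> B} \<times> {j})"
  using sets.sets_into_space[of B N] by (auto simp: space_N)

lemma emeasure_slice:
  assumes "E \<in> sets borel" "j \<in> C"
  shows "of_nat k * emeasure N (E \<times> {j}) = emeasure \<nu> E"
proof -
  define U where "U = uniform_count_measure C"
  have fC: "finite C" by (simp add: C_eq)
  have cC: "card C = k" by (simp add: C_eq)
  have U1: "emeasure U C = 1"
    unfolding U_def using emeasure_uniform_count_measure[OF fC, of C] cC k by simp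
  interpret U: finite_measure U
    by standard (use U1 in \<open>simp add: U_def space_uniform_count_measure\<close>)
  have "emeasure N (E \<times> {j}) = emeasure \<nu> E * emeasure U {j}"
    unfolding point_extension_measure_def U_def[symmetric]
    by (rule U.emeasure_pair_measure_Times) (use assms in \<open>auto simp: sets_\<nu> U_def sets_uniform_count_measure\<close>)
  also have "emeasure U {j} = ennreal (1 / k)"
    unfolding U_def using emeasure_uniform_count_measure[OF fC, of "{j}"] assms(2) cC by simp
  finally have "of_nat k * emeasure N (E \<times> {j}) = (of_nat k * ennreal (1 / k)) * emeasure \<nu> E"
    by (simp add: mult_ac)
  also have "of_nat k * ennreal (1 / k) = 1"
    using k by (simp add: ennreal_of_nat_eq_real_of_nat ennreal_mult[symmetric])
  finally show ?thesis by simp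
qed

lemma of_nat_k_cancel: "of_nat k * x = of_nat k * y \<Longrightarrow> x = y" for x y :: ennreal
proof -
  assume eq: "of_nat k * x = of_nat k * y"
  have 1: "ennreal (1 / k) * of_nat k = 1"
    using k by (simp add: ennreal_of_nat_eq_real_of_nat ennreal_mult[symmetric])
  have "ennreal (1 / k) * (of_nat k * x) = ennreal (1 / k) * (of_nat k * y)" using eq by simp
  then show ?thesis by (simp only: mult.assoc[symmetric] 1 mult_1)
qed

lemma \<Phi>_pre: "B \<in> sets N \<Longrightarrow> {w \<in> X. \<Phi> w \<in> B} = (\<Union>j\<in>C. Z (nat j) \<inter> \<pi> -` {p. (p, j) \<in> B})"
proof (intro equalityI subsetI)
  fix w assume w: "w \<in> {w \<in> X. \<Phi> w \<in> B}"
  then have "int (idx w) \<in> C" using idx_less by (simp add: C_eq)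
  then show "w \<in> (\<Union>j\<in>C. Z (nat j) \<inter> \<pi> -` {p. (p, j) \<in> B})"
    by (rule UN_I) (use w in \<open>simp add: Z_def \<Phi>_def\<close>)
qed (auto simp: Z_def \<Phi>_def C_eq)

lemma \<Phi>_pre_borel: "B \<in> sets N \<Longrightarrow> {w \<in> X. \<Phi> w \<in> B} \<in> sets borel"
  unfolding \<Phi>_pre by (intro sets.finite_UN sets.Int Z_borel vimage_\<pi> slice_borel) (auto simp: C_eq)

text \<open>On each label class \<open>Z j\<close> the projection is injective, so \<open>uniform\<close> compares both sides slice by slice.\<close>

lemma emeasure_\<Phi>:
  assumes B: "B \<in> sets N" shows "emeasure M {w \<in> X. \<Phi> w \<in> B} = emeasure N B"
proof -
  define E where "E j = {p. (p, j) \<in> B}" for j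
  have E: "E j \<in> sets borel" if "j \<in> C" for j unfolding E_def by (rule slice_borel[OF B that])
  have fC: "finite C" by (simp add: C_eq)
  have eq: "emeasure M (Z (nat j) \<inter> \<pi> -` E j) = emeasure N (E j \<times> {j})" if j: "j \<in> C" for j
  proof (rule of_nat_k_cancel)
    have "of_nat k * emeasure M (Z (nat j) \<inter> \<pi> -` E j) = emeasure \<nu> (\<pi> ` (Z (nat j) \<inter> \<pi> -` E j))"
    proof (rule uniform)
      show "Z (nat j) \<inter> \<pi> -` E j \<in> sets borel" using E[OF j] by simp
      show "Z (nat j) \<inter> \<pi> -` E j \<subseteq> X" using Z_sub by blast
      show "inj_on \<pi> (Z (nat j) \<inter> \<pi> -` E j)" by (rule inj_on_subset[OF Z_inj]) auto
    qed
    also have "\<pi> ` (Z (nat j) \<inter> \<pi> -` E j) = E j \<inter> T"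
    proof (intro equalityI subsetI)
      fix p assume "p \<in> \<pi> ` (Z (nat j) \<inter> \<pi> -` E j)"
      then show "p \<in> E j \<inter> T" using Z_sub XT by auto
    next
      fix p assume p: "p \<in> E j \<inter> T"
      have "nat j < k" using j by (auto simp: C_eq)
      then obtain z where "z \<in> Z (nat j)" "\<pi> z = p" using Z_onto p by blast
      then show "p \<in> \<pi> ` (Z (nat j) \<inter> \<pi> -` E j)" using p by force
    qed
    also have "emeasure \<nu> (E j \<inter> T) = emeasure \<nu> (E j)"
    proof (rule emeasure_eq_AE)
      have "- T \<in> null_sets \<nu>" using T_full by (auto simp: null_sets_def sets_\<nu>)
      then have "AE p in \<nu>. p \<notin> - T" by (rule AE_not_in)
      then show "AE p in \<nu>. p \<in> E j \<inter> T \<longleftrightarrow> p \<in> E j" by eventually_elim auto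
    qed (use E[OF j] in \<open>auto simp: sets_\<nu>\<close>)
    also have "\<dots> = of_nat k * emeasure N (E j \<times> {j})" using emeasure_slice[OF E[OF j] j] by simp
    finally show "of_nat k * emeasure M (Z (nat j) \<inter> \<pi> -` E j) = of_nat k * emeasure N (E j \<times> {j})" .
  qed
  have "emeasure M {w \<in> X. \<Phi> w \<in> B} = emeasure M (\<Union>j\<in>C. Z (nat j) \<inter> \<pi> -` E j)"
    using \<Phi>_pre[OF B] by (simp add: E_def)
  also have "\<dots> = (\<Sum>j\<in>C. emeasure M (Z (nat j) \<inter> \<pi> -` E j))"
  proof (rule sum_emeasure[symmetric])
    show "disjoint_family_on (\<lambda>j. Z (nat j) \<inter> \<pi> -` E j) C"
      by (auto simp: disjoint_family_on_def Z_def C_eq)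
  qed (use E fC in \<open>auto simp: sets_M\<close>)
  also have "\<dots> = (\<Sum>j\<in>C. emeasure N (E j \<times> {j}))" using eq by simp
  also have "\<dots> = emeasure N (\<Union>j\<in>C. E j \<times> {j})"
  proof (rule sum_emeasure)
    have "E j \<times> {j} \<in> sets (borel \<Otimes>\<^sub>M count_space C)" if "j \<in> C" for j
      using E[OF that] that by (intro pair_measureI) auto
    then show "(\<lambda>j. E j \<times> {j}) ` C \<subseteq> sets N" using sets_N by auto
  qed (use fC in \<open>auto simp: disjoint_family_on_def\<close>)
  also have "(\<Union>j\<in>C. E j \<times> {j}) = B" using slices[OF B] by (simp add: E_def)
  finally show ?thesis .
qed

lemma \<Phi>_g: "w \<in> X \<Longrightarrow> \<Phi> (g w) = h (\<Phi> w)"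
proof -
  assume w: "w \<in> X"
  then have "\<pi> w \<in> T" using XT by blast
  then show ?thesis using idx_g[OF w] by (simp add: \<Phi>_def h_eq \<phi>_def zmod_int)
qed

lemma X_AE: "AE w in M. w \<in> X"
  using AE_not_in[of "- X" M] X_full by (auto simp: null_sets_def sets_M)

lemma h_mp: "mp_map N h"
proof -
  have "distr N N h = N"
  proof (rule measure_eqI)
    fix B assume "B \<in> sets (distr N N h)"
    then have B: "B \<in> sets N" by simp
    have hB: "h -` B \<inter> space N \<in> sets N" by (rule measurable_sets[OF h_measurable B])
    have "emeasure (distr N N h) B = emeasure M {w \<in> X. \<Phi> w \<in> h -` B \<inter> space N}"
      using emeasure_distr[OF h_measurable B] emeasure_\<Phi>[OF hB] by simp
    also have "\<dots> = emeasure M (g -` {w \<in> X. \<Phi> w \<in> B})"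
    proof (rule emeasure_eq_AE)
      show "AE w in M. w \<in> {w \<in> X. \<Phi> w \<in> h -` B \<inter> space N} \<longleftrightarrow> w \<in> g -` {w \<in> X. \<Phi> w \<in> B}"
        using X_AE
      proof eventually_elim
        case (elim w)
        have "\<Phi> w \<in> space N" using idx_less[OF elim] by (simp add: space_N \<Phi>_def C_eq)
        moreover have "g w \<in> X" using elim X_g by blast
        ultimately show ?case using elim \<Phi>_g[OF elim] by simp
      qed
      show "{w \<in> X. \<Phi> w \<in> h -` B \<inter> space N} \<in> sets M" using \<Phi>_pre_borel[OF hB] by (simp add: sets_M)
      show "g -` {w \<in> X. \<Phi> w \<in> B} \<in> sets M"
        using measurable_sets[OF meas(1) \<Phi>_pre_borel[OF B]] by (simp add: sets_M)
    qed
    also have "\<dots> = emeasure N B" using emeasure_vimage_g[OF \<Phi>_pre_borel[OF B]] emeasure_\<Phi>[OF B] by simp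
    finally show "emeasure (distr N N h) B = emeasure N B" .
  qed simp
  then show ?thesis using h_measurable by (simp add: mp_map_def)
qed

text \<open>Invariant sets of the extension pull back under \<open>\<Phi>\<close> to almost invariant sets of \<open>g\<close>.\<close>

lemma h_ergodic: "ergodic N h"
  unfolding ergodic_def
proof (intro conjI ballI impI h_mp)
  fix E assume E: "E \<in> sets N" and inv: "h -` E \<inter> space N = E"
  define E' where "E' = {w \<in> X. \<Phi> w \<in> E}"
  have E': "E' \<in> sets borel" unfolding E'_def by (rule \<Phi>_pre_borel[OF E])
  have "AE w in M. w \<in> E' \<longleftrightarrow> g w \<in> E'"
    using X_AE
  proof eventually_elim
    case (elim w)
    have "\<Phi> w \<in> space N" using idx_less[OF elim] by (simp add: space_N \<Phi>_def C_eq)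
    then have "\<Phi> w \<in> E \<longleftrightarrow> h (\<Phi> w) \<in> E" using inv by blast
    moreover have "g w \<in> X" using elim X_g by blast
    ultimately show ?case using elim \<Phi>_g[OF elim] by (simp add: E'_def)
  qed
  from almost_invariant_set[OF E' this]
  show "emeasure N E = 0 \<or> emeasure N (space N - E) = 0"
  proof
    assume "AE w in M. w \<notin> E'"
    then have "emeasure M E' = 0"
      using AE_iff_measurable[of E' M "\<lambda>w. w \<notin> E'"] E' by (auto simp: space_M sets_M)
    then show ?thesis using emeasure_\<Phi>[OF E] by (simp add: E'_def)
  next
    assume "AE w in M. w \<in> E'"
    have cE: "space N - E \<in> sets N" using E by blast
    have "AE w in M. w \<notin> {w \<in> X. \<Phi> w \<in> space N - E}"
      using \<open>AE w in M. w \<in> E'\<close> by eventually_elim (simp add: E'_def)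
    then have "emeasure M {w \<in> X. \<Phi> w \<in> space N - E} = 0"
      using AE_iff_measurable[of "{w \<in> X. \<Phi> w \<in> space N - E}" M "\<lambda>w. w \<notin> {w \<in> X. \<Phi> w \<in> space N - E}"]
        \<Phi>_pre_borel[OF cE] by (auto simp: space_M sets_M)
    then show ?thesis using emeasure_\<Phi>[OF cE] by simp
  qed
qed

lemma isomorphic: "mp_isomorphic M g N h"
proof -
  define Y where "Y = T \<times> C"
  have YN: "Y \<in> sets N" unfolding sets_N Y_def by (intro pair_measureI) auto
  have XM: "X \<in> sets M" by (simp add: sets_M)
  have \<Phi>Y: "\<Phi> w \<in> Y" if "w \<in> X" for w
    using that XT idx_less[OF that] by (auto simp: \<Phi>_def Y_def C_eq)
  have \<Psi>X: "\<Psi> q \<in> X" "\<Phi> (\<Psi> q) = q" if q: "q \<in> Y" for q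
  proof -
    obtain p j where pj: "q = (p, j)" "p \<in> T" "j \<in> C" using q by (auto simp: Y_def)
    have "nat j < k" using pj(3) by (auto simp: C_eq)
    from sec_in[OF this pj(2)] show "\<Psi> q \<in> X" "\<Phi> (\<Psi> q) = q"
      using pj by (auto simp: \<Psi>_def \<Phi>_def Z_def C_eq)
  qed
  have \<Psi>\<Phi>: "\<Psi> (\<Phi> w) = w" if "w \<in> X" for w
    using sec_eq[of w "idx w"] that by (simp add: \<Psi>_def \<Phi>_def Z_def)
  have XI: "X \<inter> space M \<in> sets M" using XM by blast
  have YI: "Y \<inter> space N \<in> sets N" using YN by blast
  have spX: "space (restrict_space M X) = X" by (simp add: space_restrict_space space_M)
  have spY: "space (restrict_space N Y) = Y"
    using sets.sets_into_space[OF YN] by (auto simp: space_restrict_space)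
  have \<Phi>_meas: "\<Phi> \<in> measurable (restrict_space M X) (restrict_space N Y)"
  proof (rule measurableI)
    fix B assume "B \<in> sets (restrict_space N Y)"
    then have "B \<in> sets N" by (simp add: sets_restrict_space_iff[OF YI])
    from \<Phi>_pre_borel[OF this] have "{w \<in> X. \<Phi> w \<in> B} \<in> sets (restrict_space M X)"
      by (auto simp: sets_restrict_space_iff[OF XI] sets_M)
    moreover have "\<Phi> -` B \<inter> X = {w \<in> X. \<Phi> w \<in> B}" by auto
    ultimately show "\<Phi> -` B \<inter> space (restrict_space M X) \<in> sets (restrict_space M X)"
      by (simp add: spX)
  qed (use \<Phi>Y in \<open>simp add: spX spY\<close>)
  have \<Psi>_meas: "\<Psi> \<in> measurable (restrict_space N Y) (restrict_space M X)"
  proof (rule measurableI)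
    fix W assume "W \<in> sets (restrict_space M X)"
    then have W: "W \<in> sets borel" by (auto simp: sets_restrict_space_iff[OF XI] sets_M)
    have "\<Psi> -` W \<inter> Y = (\<Union>j\<in>C. (T \<inter> sec (nat j) -` W) \<times> {j})"
      by (auto simp: Y_def \<Psi>_def)
    also have "\<dots> \<in> sets (borel \<Otimes>\<^sub>M count_space C)"
    proof (intro sets.finite_UN pair_measureI)
      show "T \<inter> sec (nat j) -` W \<in> sets borel" for j
        using measurable_sets[OF sec_measurable W] by auto
    qed (auto simp: C_eq)
    finally have "\<Psi> -` W \<inter> Y \<in> sets N" by (simp add: sets_N)
    then show "\<Psi> -` W \<inter> space (restrict_space N Y) \<in> sets (restrict_space N Y)"
      unfolding spY by (simp add: sets_restrict_space_iff[OF YI])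
  qed (use \<Psi>X in \<open>simp add: spX spY\<close>)
  have "distr (restrict_space M X) (restrict_space N Y) \<Phi> = restrict_space N Y"
  proof (rule measure_eqI)
    fix B assume "B \<in> sets (distr (restrict_space M X) (restrict_space N Y) \<Phi>)"
    then have Br: "B \<in> sets (restrict_space N Y)" by simp
    then have B: "B \<in> sets N" "B \<subseteq> Y" by (auto simp: sets_restrict_space_iff[OF YI])
    have eq: "\<Phi> -` B \<inter> X = {w \<in> X. \<Phi> w \<in> B}" by auto
    have "emeasure (distr (restrict_space M X) (restrict_space N Y) \<Phi>) B = emeasure M (\<Phi> -` B \<inter> X)"
      using emeasure_distr[OF \<Phi>_meas Br] emeasure_restrict_space[OF XI, of "\<Phi> -` B \<inter> X"] by (simp add: spX)
    also have "\<dots> = emeasure N B" unfolding eq by (rule emeasure_\<Phi>[OF B(1)])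
    also have "\<dots> = emeasure (restrict_space N Y) B"
      using emeasure_restrict_space[OF YI B(2)] by simp
    finally show "emeasure (distr (restrict_space M X) (restrict_space N Y) \<Phi>) B = emeasure (restrict_space N Y) B" .
  qed simp
  moreover have "emeasure M (space M - X) = 0" using X_full by (simp add: space_M Compl_eq_Diff_UNIV)
  moreover have "emeasure N (space N - Y) = 0"
  proof -
    have eq: "{w \<in> X. \<Phi> w \<in> space N - Y} = {}" using \<Phi>Y by auto
    have "space N - Y \<in> sets N" using YN by blast
    from emeasure_\<Phi>[OF this] show ?thesis unfolding eq by simp
  qed
  moreover have "h ` Y \<subseteq> Y"
    using T_A k by (auto simp: Y_def h_eq C_eq)
  ultimately show ?thesis
    unfolding mp_isomorphic_def
    using g_mp h_mp XM YN X_g \<Phi>_meas \<Psi>_meas \<Psi>\<Phi> \<Psi>X(2) \<Phi>_g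
    by (intro conjI bexI[of _ X] bexI[of _ Y] exI[of _ \<Phi>] exI[of _ \<Psi>]) auto
qed

end

section \<open>Maps near the automorphism\<close>

lemma C2_circle_param_loop:
  assumes "C2_circle_param L \<gamma>" shows "loop_param L (\<lambda>s. abs_torus (\<gamma> s))"
proof -
  have "continuous_on UNIV \<gamma>"
    using assms unfolding C2_circle_param_def C2_on_def
    by (meson UNIV_I continuous_at_imp_continuous_on has_derivative_continuous)
  then show ?thesis
    using assms continuous_on_abs_torus[of UNIV \<gamma>] by (auto simp: loop_param_def C2_circle_param_def o_def)
qed

lemma loop_no_isolated_point:
  assumes c: "loop_param L c" shows "at (c t) within L \<noteq> bot"
proof -
  have "continuous_on UNIV c" using c by (simp add: loop_param_def)
  then have "isCont c t" by (simp add: continuous_on_eq_continuous_at)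
  then have "(c \<longlongrightarrow> c t) (at t)" by (simp add: isCont_def)
  moreover have "\<forall>\<^sub>F s in at t. c s \<in> L \<and> c s \<noteq> c t"
  proof -
    have "c s \<noteq> c t" if "s \<noteq> t" "dist s t < 1" for s
    proof
      assume "c s = c t"
      then have "s - t \<in> \<int>" using c by (simp add: loop_param_def)
      then show False using that Ints_nonzero_abs_less1[of "s - t"] by (simp add: dist_real_def)
    qed
    then show ?thesis unfolding eventually_at using loop_param_in[OF c] by (intro exI[of _ 1]) auto
  qed
  ultimately have "filterlim c (at (c t) within L) (at t)"
    unfolding filterlim_at by auto
  then have lim: "\<forall>P. eventually P (at (c t) within L) \<longrightarrow> (\<forall>\<^sub>F s in at t. P (c s))"
    by (simp add: filterlim_iff)
  show ?thesis
  proof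
    assume "at (c t) within L = bot"
    then have "\<forall>\<^sub>F s in at t. False" using lim[rule_format, of "\<lambda>_. False"] by simp
    then show False by simp
  qed
qed

text \<open>The chain rule along the fibres, for derivatives that are limits of ratios of distances.\<close>

lemma dilation_product:
  fixes g :: "'a::metric_space \<Rightarrow> 'a" and \<pi> :: "'a \<Rightarrow> 'b"
  assumes g: "continuous_on UNIV g" "inj g" and equiv: "\<And>w. \<pi> (g w) = A (\<pi> w)"
    and dil: "\<And>w. ((\<lambda>y. dist (g y) (g w) / dist y w) \<longlongrightarrow> l w) (at w within \<pi> -` {\<pi> w})"
  shows "((\<lambda>y. dist ((g ^^ n) y) ((g ^^ n) w) / dist y w) \<longlongrightarrow> (\<Prod>i<n. l ((g ^^ i) w))) (at w within \<pi> -` {\<pi> w})"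
proof (induction n)
  case 0
  have "\<forall>\<^sub>F y in at w within \<pi> -` {\<pi> w}. dist y w / dist y w = 1"
    unfolding eventually_at by (intro exI[of _ 1]) auto
  then show ?case by (simp add: tendsto_eventually)
next
  case (Suc n)
  have inj: "inj (g ^^ n)" using g(2) by (rule inj_fn)
  have "isCont (g ^^ n) w" using continuous_on_funpow[OF g(1)] by (simp add: continuous_on_eq_continuous_at)
  then have lim: "((g ^^ n) \<longlongrightarrow> (g ^^ n) w) (at w within \<pi> -` {\<pi> w})"
    using isCont_def tendsto_within_subset[OF _ subset_UNIV] by blast
  have \<pi>n: "\<pi> ((g ^^ n) y) = (A ^^ n) (\<pi> y)" for y by (induction n) (auto simp: equiv)
  have ne: "\<forall>\<^sub>F y in at w within \<pi> -` {\<pi> w}. y \<noteq> w \<and> (g ^^ n) y \<in> \<pi> -` {\<pi> ((g ^^ n) w)} \<and> (g ^^ n) y \<noteq> (g ^^ n) w"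
    unfolding eventually_at using inj by (intro exI[of _ 1]) (auto simp: inj_eq \<pi>n)
  have "filterlim (g ^^ n) (at ((g ^^ n) w) within \<pi> -` {\<pi> ((g ^^ n) w)}) (at w within \<pi> -` {\<pi> w})"
    unfolding filterlim_at using lim ne by (auto elim: eventually_mono)
  from filterlim_compose[OF dil this]
  have "((\<lambda>y. dist (g ((g ^^ n) y)) (g ((g ^^ n) w)) / dist ((g ^^ n) y) ((g ^^ n) w)) \<longlongrightarrow> l ((g ^^ n) w))
      (at w within \<pi> -` {\<pi> w})" .
  from tendsto_mult[OF Suc.IH this]
  have "((\<lambda>y. dist ((g ^^ n) y) ((g ^^ n) w) / dist y w * (dist (g ((g ^^ n) y)) (g ((g ^^ n) w)) / dist ((g ^^ n) y) ((g ^^ n) w)))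
      \<longlongrightarrow> (\<Prod>i<Suc n. l ((g ^^ i) w))) (at w within \<pi> -` {\<pi> w})" by simp
  moreover have "\<forall>\<^sub>F y in at w within \<pi> -` {\<pi> w}.
      dist ((g ^^ n) y) ((g ^^ n) w) / dist y w * (dist (g ((g ^^ n) y)) (g ((g ^^ n) w)) / dist ((g ^^ n) y) ((g ^^ n) w))
      = dist ((g ^^ Suc n) y) ((g ^^ Suc n) w) / dist y w"
    using ne by eventually_elim simp
  ultimately show ?case by (rule Lim_transform_eventually)
qed

lemma emeasure_torus_haar_UNIV: "emeasure (torus_haar :: 3 torus measure) UNIV = 1"
proof -
  have "emeasure (torus_haar :: 3 torus measure) UNIV = emeasure lborel (unit_cube :: (real ^ 3) set)"
    by (simp add: emeasure_torus_haar)
  also have "\<dots> = 1"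
  proof -
    have "emeasure lborel (box 0 (1 :: real ^ 3)) \<le> emeasure lborel (unit_cube :: (real ^ 3) set)"
      by (rule emeasure_mono) (auto simp: unit_cube_def mem_box_cart less_imp_le)
    moreover have "emeasure lborel (unit_cube :: (real ^ 3) set) \<le> emeasure lborel (cbox 0 (1 :: real ^ 3))"
      by (rule emeasure_mono) (auto simp: unit_cube_def mem_box_cart less_imp_le)
    moreover have "(\<Prod>b\<in>Basis. ((1 :: real ^ 3) - 0) \<bullet> b) = 1"
      by (rule prod.neutral) (auto simp: Basis_vec_def inner_axis)
    moreover have "(0 :: real ^ 3) \<bullet> b \<le> 1 \<bullet> b" if "b \<in> Basis" for b
      using that by (auto simp: Basis_vec_def inner_axis)
    ultimately show ?thesis
      using emeasure_lborel_box[of "0 :: real ^ 3" 1] emeasure_lborel_cbox[of "0 :: real ^ 3" 1] by auto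
  qed
  finally show ?thesis .
qed

text \<open>Compare the two expressions for the derivative of \<open>g ^^ n\<close> along a leaf, \<open>leaf_dilation_limit\<close> and \<open>dilation_product\<close>: the
exponent of the tangent vectors is the exponent of the Birkhoff sums of \<open>ln (l w)\<close>.\<close>

theorem point_extension_of_A2:
  fixes g :: "3 torus \<Rightarrow> 3 torus" and \<pi> :: "3 torus \<Rightarrow> 2 torus"
  assumes g: "g \<in> A3_nbhd" and erg: "ergodic torus_haar g"
    and fib: "fibration \<pi>" and semi: "\<pi> \<circ> g = A2 \<circ> \<pi>"
    and fol: "foliation_by_C2_circles (fibers \<pi>)"
    and lam: "lam > 0" and exponent: "AE w in torus_haar. \<forall>L\<in>fibers \<pi>. \<forall>v.
           w \<in> L \<and> tangent_to L w v \<and> v \<noteq> 0 \<longrightarrow>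
           (\<lambda>n. 1 / real n * ln (norm (torus_deriv (g ^^ n) w v))) \<longlonglongrightarrow> lam"
  shows "\<exists>k\<ge>1. \<exists>\<phi>\<in>measurable (distr torus_haar borel \<pi>) (count_space (carrier (integer_mod_group k))).
    ergodic (point_extension_measure k (distr torus_haar borel \<pi>)) (point_extension k A2 \<phi>) \<and>
    mp_isomorphic torus_haar g (point_extension_measure k (distr torus_haar borel \<pi>)) (point_extension k A2 \<phi>)"
proof -
  define g' where "g' = inv_into UNIV g"
  obtain r where gD: "g \<in> Diff2_mu" and r: "r < 1/4" "\<And>w. dist (A3 w) (g w) \<le> r"
    using g unfolding A3_nbhd_def by blast
  have bij: "bij g" and C2: "torus_C2 g" "torus_C2 g'"
    using gD by (auto simp: Diff2_mu_def g'_def)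
  have gg': "g (g' w) = w" "g' (g w) = w" for w
    using bij by (simp_all add: g'_def bij_is_surj surj_f_inv_f bij_is_inj)
  have g_cont: "continuous_on UNIV g" "continuous_on UNIV g'" using torus_C2_continuous C2 by blast+
  have \<pi>_cont: "continuous_on UNIV \<pi>" using fib by (simp add: fibration_def)
  have equiv: "\<pi> (g w) = A2 (\<pi> w)" for w using semi by (metis comp_apply)
  define A' where "A' = toral_map mat2'"
  have AA': "A2 (A' p) = p" "A' (A2 p) = p" for p
    unfolding A2_toral A'_def
    using toral_map_inverse[of mat2 mat2'] toral_map_inverse[of mat2' mat2] mat_Ints mat2_Ints mat_inverse by auto
  have A_cont: "continuous_on UNIV A2" "continuous_on UNIV A'"
    unfolding A2_toral A'_def by (intro continuous_toral_map mat2_Ints mat_Ints)+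
  obtain K1 where K1: "K1-lipschitz_on UNIV g" using torus_C2_Lipschitz[OF C2(1)] .
  obtain K2 where K2: "K2-lipschitz_on UNIV g'" using torus_C2_Lipschitz[OF C2(2)] .
  define K where "K = max 1 (max K1 K2)"
  have K_lip: "dist (g x) (g y) \<le> K * dist x y" "dist (g' x) (g' y) \<le> K * dist x y" for x y
  proof -
    have "dist (g x) (g y) \<le> K1 * dist x y" "dist (g' x) (g' y) \<le> K2 * dist x y"
      using lipschitz_onD[OF K1] lipschitz_onD[OF K2] by auto
    moreover have "K1 * dist x y \<le> K * dist x y" "K2 * dist x y \<le> K * dist x y"
      by (intro mult_right_mono; simp add: K_def)+
    ultimately show "dist (g x) (g y) \<le> K * dist x y" "dist (g' x) (g' y) \<le> K * dist x y" by linarith+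
  qed
  have circ: "\<exists>\<gamma>. C2_circle_param (\<pi> -` {p}) \<gamma>" for p
    using fol unfolding foliation_by_C2_circles_def fibers_def C2_circle_def by blast
  have loops: "\<exists>c. loop_param (\<pi> -` {p}) c" for p
    using circ[of p] C2_circle_param_loop by blast
  have tangent: "\<exists>v. v \<noteq> 0 \<and> tangent_to (\<pi> -` {\<pi> w}) w v" for w
  proof -
    obtain \<gamma> where \<gamma>: "C2_circle_param (\<pi> -` {\<pi> w}) \<gamma>" using circ by blast
    then have "w \<in> range (abs_torus \<circ> \<gamma>)" by (auto simp: C2_circle_param_def)
    then obtain t where t: "abs_torus (\<gamma> t) = w" by auto
    have "tangent_to (\<pi> -` {\<pi> w}) w (vector_derivative \<gamma> (at t))"
      unfolding tangent_to_def using \<gamma> t by (intro exI[of _ \<gamma>] exI[of _ t] exI[of _ 1]) simp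
    moreover have "vector_derivative \<gamma> (at t) \<noteq> 0" using \<gamma> by (simp add: C2_circle_param_def)
    ultimately show ?thesis by blast
  qed
  have isolated: "at w within \<pi> -` {\<pi> w} \<noteq> bot" for w
  proof -
    obtain c where c: "loop_param (\<pi> -` {\<pi> w}) c" using loops by blast
    then have "w \<in> range c" by (simp add: loop_param_def)
    then obtain t where "w = c t" by blast
    then show ?thesis using loop_no_isolated_point[OF c, of t] by simp
  qed
  have "\<exists>l. ((\<lambda>y. dist (g y) (g w) / dist y w) \<longlongrightarrow> l) (at w within \<pi> -` {\<pi> w})" for w
  proof -
    obtain v where "v \<noteq> 0" "tangent_to (\<pi> -` {\<pi> w}) w v" using tangent by blast
    moreover obtain D where "torus_has_derivative g D w" using torus_C2_has_derivative[OF C2(1)] .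
    ultimately show ?thesis using leaf_dilation_limit by blast
  qed
  then obtain l where dil: "\<And>w. ((\<lambda>y. dist (g y) (g w) / dist y w) \<longlongrightarrow> l w) (at w within \<pi> -` {\<pi> w})"
    by metis
  have l_pos: "0 < l w" for w
  proof -
    have "1 / K \<le> l w"
    proof (rule tendsto_lowerbound[OF dil _ isolated])
      have "1 / K \<le> dist (g y) (g w) / dist y w" if "y \<noteq> w" for y
      proof -
        have "dist y w \<le> K * dist (g y) (g w)" using K_lip(2)[of "g y" "g w"] by (simp add: gg')
        moreover have "0 < K" by (simp add: K_def)
        ultimately show ?thesis using that by (simp add: field_simps)
      qed
      then show "\<forall>\<^sub>F y in at w within \<pi> -` {\<pi> w}. 1 / K \<le> dist (g y) (g w) / dist y w"
        unfolding eventually_at by (intro exI[of _ 1]) auto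
    qed
    moreover have "0 < 1 / K" by (simp add: K_def)
    ultimately show ?thesis by linarith
  qed
  have growth: "AE w in torus_haar. (\<lambda>n. (\<Sum>i<n. ln (l ((g ^^ i) w))) / real n) \<longlonglongrightarrow> lam"
    using exponent
  proof eventually_elim
    case (elim w)
    obtain v where v: "v \<noteq> 0" "tangent_to (\<pi> -` {\<pi> w}) w v" using tangent by blast
    define L where "L n = norm (torus_deriv (g ^^ n) w v)" for n
    have "(\<lambda>n. 1 / real n * ln (L n)) \<longlonglongrightarrow> lam"
      unfolding L_def using elim v by (auto simp: fibers_def)
    moreover have "(\<lambda>n. (1 / real n) * ln (norm v)) \<longlonglongrightarrow> 0 * ln (norm v)"
      by (intro tendsto_mult tendsto_const lim_1_over_n)
    ultimately have lim: "(\<lambda>n. 1 / real n * ln (L n) - 1 / real n * ln (norm v)) \<longlonglongrightarrow> lam - 0 * ln (norm v)"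
      by (rule tendsto_diff)
    have "1 / real n * ln (L n) - 1 / real n * ln (norm v) = (\<Sum>i<n. ln (l ((g ^^ i) w))) / real n" for n
    proof -
      obtain D where D: "torus_has_derivative (g ^^ n) D w" using torus_has_derivative_funpow[OF C2(1)] by blast
      have "((\<lambda>y. dist ((g ^^ n) y) ((g ^^ n) w) / dist y w) \<longlongrightarrow> norm (D v) / norm v) (at w within \<pi> -` {\<pi> w})"
        by (rule leaf_dilation_limit[OF v(2,1) D])
      moreover have "((\<lambda>y. dist ((g ^^ n) y) ((g ^^ n) w) / dist y w) \<longlongrightarrow> (\<Prod>i<n. l ((g ^^ i) w))) (at w within \<pi> -` {\<pi> w})"
        by (rule dilation_product[OF g_cont(1) bij_is_inj[OF bij] equiv dil])
      ultimately have "norm (D v) / norm v = (\<Prod>i<n. l ((g ^^ i) w))" by (rule tendsto_unique[OF isolated])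
      then have prod: "L n / norm v = (\<Prod>i<n. l ((g ^^ i) w))" by (simp add: L_def torus_deriv_eq[OF D])
      have pp: "0 < (\<Prod>i<n. l ((g ^^ i) w))" by (intro prod_pos) (simp add: l_pos)
      then have Lpos: "0 < L n" using prod v(1) by (metis divide_eq_0_iff less_irrefl norm_ge_zero order_le_less L_def)
      have "ln (L n) - ln (norm v) = ln (L n / norm v)" using Lpos v(1) by (simp add: ln_div)
      also have "\<dots> = (\<Sum>i<n. ln (l ((g ^^ i) w)))"
        unfolding prod by (rule ln_prod) (simp_all add: l_pos less_imp_neq[OF l_pos, symmetric])
      finally show ?thesis by (simp add: diff_divide_distrib[symmetric])
    qed
    then show ?case using lim by simp
  qed
  interpret expanding_fibres torus_haar \<pi> g g' A2 A' K l lam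
  proof
    show "1 \<le> K" by (simp add: K_def)
  qed (rule sets_torus_haar emeasure_torus_haar_UNIV \<pi>_cont erg g_cont A_cont gg' AA' equiv compact_UNIV_torus
        K_lip dil isolated lam growth)+
  obtain D where "compact D" "inj_on \<pi> D" "measure torus_haar D > 0" by (rule compact_section)
  then obtain k X T S where fs: "k \<ge> (1::nat)" "X \<in> sets borel" "T \<in> sets borel"
    "emeasure torus_haar (- X) = 0" "emeasure \<nu> (- T) = 0"
    "\<pi> ` X \<subseteq> T" "A2 ` T \<subseteq> T" "g ` X \<subseteq> X" "\<And>p. p \<in> T \<Longrightarrow> card (X \<inter> \<pi> -` {p}) = k"
    "\<And>W. W \<in> sets borel \<Longrightarrow> W \<subseteq> X \<Longrightarrow> \<pi> ` W \<in> sets borel"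
    "\<And>i::nat. S i \<in> sets borel" "\<And>i. inj_on \<pi> (S i)" "X = (\<Union>i. S i)" "disjoint_family S"
    "\<And>W. W \<in> sets borel \<Longrightarrow> W \<subseteq> X \<Longrightarrow> inj_on \<pi> W \<Longrightarrow> of_nat k * emeasure torus_haar W = emeasure \<nu> (\<pi> ` W)"
    by (rule finite_sections) (rule that)
  have "dist (A3 w) (g w) < 1/4" for w using r(1) r(2)[of w] by linarith
  then obtain \<delta> where \<delta>: "continuous_on UNIV \<delta>" "\<And>w. third (g w) = third w * cis (2 * pi * \<delta> w)"
    using third_displacement[OF g_cont(1)] by blast
  have pos: "\<exists>c. positive third (\<pi> -` {p}) c" for p
    by (rule fibres_positive[OF fib loops g_cont(1) equiv \<delta>])
  have g_fibre: "g ` (\<pi> -` {p}) = \<pi> -` {A2 p}" for p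
  proof (intro equalityI subsetI)
    fix z assume z: "z \<in> \<pi> -` {A2 p}"
    have "\<pi> (g' z) = A' (A2 p)" using z by simp
    then show "z \<in> g ` (\<pi> -` {p})" by (intro image_eqI[of _ _ "g' z"]) (auto simp: gg' AA')
  qed auto
  interpret labelled_sections torus_haar \<pi> g g' A2 A' "\<lambda>p c. positive third (\<pi> -` {p}) c" k X T S "cyclic_arcs \<pi> third"
  proof
    show "\<exists>c. positive third (\<pi> -` {p}) c" for p by (rule pos)
    show "c s = c t \<longleftrightarrow> s - t \<in> \<int>" if "positive third (\<pi> -` {p}) c" for p c s t
      using that by (simp add: positive_def loop_param_def)
    show "range c = \<pi> -` {p}" if "positive third (\<pi> -` {p}) c" for p c
      using that by (simp add: positive_def loop_param_def)
    show "\<exists>h. strict_mono h \<and> (\<forall>s::real. h (s + 1) = h s + 1) \<and> (\<forall>s. c' s = c (h s))"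
      if c: "positive third (\<pi> -` {p}) c" "positive third (\<pi> -` {p}) c'" for p c c'
    proof -
      obtain h where "strict_mono h" "\<And>s::real. h (s + 1) = h s + 1" "\<And>s. c' s = c (h s)"
        by (rule positive_reparam[OF c]) (rule that)
      then show ?thesis by blast
    qed
    show "positive third (\<pi> -` {A2 p}) (\<lambda>s. g (c s))" if "positive third (\<pi> -` {p}) c" for p c
      using positive_image[OF that g_cont(1) bij_is_inj[OF bij] \<delta>] by (simp add: g_fibre)
    show "cyclic_arcs \<pi> third = {(c s, c t, c u) | p c s t u. positive third (\<pi> -` {p}) c \<and> s \<le> t \<and> t < u \<and> u < s + 1}"
      by (simp add: cyclic_arcs_def)
    show "cyclic_arcs \<pi> third \<in> sets borel" by (rule cyclic_arcs_borel[OF fib pos continuous_third norm_third])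
  qed (fact fs)+
  have "\<phi> \<in> measurable \<nu> (count_space C)"
    using \<phi>_measurable measurable_cong_sets[OF sets_\<nu> refl] by blast
  then show ?thesis
    using fs(1) h_ergodic isomorphic unfolding \<nu>_def by blast
qed

theorem mainTheorem2:
  shows "\<exists>N :: (3 torus \<Rightarrow> 3 torus) set. C1_open N \<and> A3 \<in> N \<and>
    (\<forall>(U :: (3 torus \<Rightarrow> 3 torus) set) (\<pi> :: (3 torus \<Rightarrow> 3 torus) \<Rightarrow> 3 torus \<Rightarrow> 2 torus).
      C1_open U \<and> U \<subseteq> N \<and>
      (\<forall>g\<in>U.
        ergodic torus_haar g \<and>
        (fibration (\<pi> g) \<and> \<pi> g \<circ> g = A2 \<circ> \<pi> g \<and>
         foliation_by_C2_circles (fibers (\<pi> g)) \<and>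
         closure (\<Union>{L \<in> fibers (\<pi> g). periodic_leaf g L}) = UNIV) \<and>
        (\<exists>lam>0. AE w in torus_haar. \<forall>L\<in>fibers (\<pi> g). \<forall>v.
           w \<in> L \<and> tangent_to L w v \<and> v \<noteq> 0 \<longrightarrow>
           (\<lambda>n. 1 / real n * ln (norm (torus_deriv (g ^^ n) w v))) \<longlonglongrightarrow> lam) \<and>
        (\<exists>S\<in>sets torus_haar. emeasure torus_haar (UNIV - S) = 0 \<and>
           (\<forall>L\<in>fibers (\<pi> g). S \<inter> L \<in> null_sets (leaf_measure L))) \<and>
        \<not> absolutely_continuous_foliation (fibers (\<pi> g)))
      \<longrightarrow> (\<forall>g\<in>U. \<exists>k\<ge>1.
            \<exists>\<phi>\<in>measurable (distr torus_haar borel (\<pi> g))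
                   (count_space (carrier (integer_mod_group k))).
              let \<nu> = point_extension_measure k (distr torus_haar borel (\<pi> g));
                  h = point_extension k A2 \<phi>
              in ergodic \<nu> h \<and> mp_isomorphic torus_haar g \<nu> h))"
proof (intro exI[of _ A3_nbhd] conjI C1_open_nbhd A3_in_nbhd allI impI ballI)
  fix U :: "(3 torus \<Rightarrow> 3 torus) set" and \<pi> :: "(3 torus \<Rightarrow> 3 torus) \<Rightarrow> 3 torus \<Rightarrow> 2 torus" and g
  assume H: "C1_open U \<and> U \<subseteq> A3_nbhd \<and>
      (\<forall>g\<in>U.
        ergodic torus_haar g \<and>
        (fibration (\<pi> g) \<and> \<pi> g \<circ> g = A2 \<circ> \<pi> g \<and>
         foliation_by_C2_circles (fibers (\<pi> g)) \<and>
         closure (\<Union>{L \<in> fibers (\<pi> g). periodic_leaf g L}) = UNIV) \<and>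
        (\<exists>lam>0. AE w in torus_haar. \<forall>L\<in>fibers (\<pi> g). \<forall>v.
           w \<in> L \<and> tangent_to L w v \<and> v \<noteq> 0 \<longrightarrow>
           (\<lambda>n. 1 / real n * ln (norm (torus_deriv (g ^^ n) w v))) \<longlonglongrightarrow> lam) \<and>
        (\<exists>S\<in>sets torus_haar. emeasure torus_haar (UNIV - S) = 0 \<and>
           (\<forall>L\<in>fibers (\<pi> g). S \<inter> L \<in> null_sets (leaf_measure L))) \<and>
        \<not> absolutely_continuous_foliation (fibers (\<pi> g)))" and gU: "g \<in> U"
  have gN: "g \<in> A3_nbhd" using H gU by blast
  from H[THEN conjunct2, THEN conjunct2, rule_format, OF gU]
  have g: "ergodic torus_haar g" "fibration (\<pi> g)" "\<pi> g \<circ> g = A2 \<circ> \<pi> g" "foliation_by_C2_circles (fibers (\<pi> g))"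
    and ex: "\<exists>lam>0. AE w in torus_haar. \<forall>L\<in>fibers (\<pi> g). \<forall>v.
           w \<in> L \<and> tangent_to L w v \<and> v \<noteq> 0 \<longrightarrow>
           (\<lambda>n. 1 / real n * ln (norm (torus_deriv (g ^^ n) w v))) \<longlonglongrightarrow> lam"
    by - (elim conjE, assumption)+
  from ex obtain lam where lam: "lam > 0" "AE w in torus_haar. \<forall>L\<in>fibers (\<pi> g). \<forall>v.
           w \<in> L \<and> tangent_to L w v \<and> v \<noteq> 0 \<longrightarrow>
           (\<lambda>n. 1 / real n * ln (norm (torus_deriv (g ^^ n) w v))) \<longlonglongrightarrow> lam"
    by (elim exE conjE)
  show "\<exists>k\<ge>1. \<exists>\<phi>\<in>measurable (distr torus_haar borel (\<pi> g)) (count_space (carrier (integer_mod_group k))).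
              let \<nu> = point_extension_measure k (distr torus_haar borel (\<pi> g));
                  h = point_extension k A2 \<phi>
              in ergodic \<nu> h \<and> mp_isomorphic torus_haar g \<nu> h"
    unfolding Let_def by (rule point_extension_of_A2[OF gN g lam])
qed

end
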